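(* Let $\mathbb{F}$ be a perfect field, $k\ge2$, and let $T\in V_1\otimes\cdots\otimes V_k$ be a $k$-tensor over $\mathbb{F}$ with slicing $\bar T\colon V_1\times\cdots\times V_{k-1}\to V_k$, viewed via fixed bases as a polynomial map $\bar T\colon\mathbb{F}^n\to\mathbb{F}^m$. Let $X\subseteq\ker\bar T$ be an irreducible variety defined over $\mathbb{F}$ that has an $\mathbb{F}$-rational point which is neither singular nor $D\bar T$-singular. Then $$\mathrm{PR}(T)\le(2^{k-1}-1)\operatorname{codim}X.$$
   Context: Partition rank $\mathrm{PR}(T)$ over $\mathbb{F}$: the smallest $r$ such that $T$ (as a $k$-linear form) is a sum of $r$ products $p\cdot q$ with $p,q$ multilinear forms over $\mathbb{F}$ in the variables indexed by complementary nonempty subsets $S,S'$ of $[k]$. The slicing $\bar T$ is the $(k-1)$-linear map whose coordinates are the slices of $T$ along the last axis; $\ker\bar T=\{x\in\overline{\mathbb{F}}^n:\bar T(x)=0\}$. A variety is defined over $\mathbb{F}$ if cut out by polynomials with coefficients in $\mathbb{F}$; an $\mathbb{F}$-rational point is a point with coordinates in $\mathbb{F}$; $\operatorname{codim}X=n-\dim X$. $D\bar T(x)\in\mathbb{F}^m\otimes\mathbb{F}^n$ is the Jacobian matrix $(\partial_j\bar T_i(x))$. For $g$ in the ideal $I(X)$ of polynomials over $\overline{\mathbb{F}}$ vanishing on $X$, the tangent space is $\mathbf{T}_xX=\{v:(Dg(x))v=0\ \forall g\in I(X)\}$; a point $x\in X$ is non-singular if $\dim\mathbf{T}_xX=\dim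 X$ and singular otherwise. For a polynomial matrix $f$, a point $x\in X$ is $f$-singular if $\operatorname{rank}f(x)<\max_{y\in X}\operatorname{rank}f(y)$. *)

theory Defs
  imports Main "HOL-Library.Poly_Mapping" "HOL-Library.Function_Algebras" "HOL-Computational_Algebra.Polynomial"
begin

definition subfield :: "'k::field set \<Rightarrow> bool" where
  "subfield F \<longleftrightarrow> 0 \<in> F \<and> 1 \<in> F \<and> (\<forall>a\<in>F. \<forall>b\<in>F. a + b \<in> F \<and> a - b \<in> F \<and> a * b \<in> F)
     \<and> (\<forall>a\<in>F. a \<noteq> 0 \<longrightarrow> inverse a \<in> F)"

definition perfect_subfield :: "'k::field set \<Rightarrow> bool" where
  "perfect_subfield F \<longleftrightarrow>
     (\<forall>n::nat. n > 0 \<longrightarrow> (of_nat n :: 'k) \<noteq> 0) \<or>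
     (\<exists>p::nat. prime p \<and> (of_nat p :: 'k) = 0 \<and> (\<forall>a\<in>F. \<exists>b\<in>F. b ^ p = a))"

definition is_algebraic_closure_of :: "'k::field set \<Rightarrow> bool" where
  "is_algebraic_closure_of F \<longleftrightarrow>
     (\<forall>p::'k poly. degree p > 0 \<longrightarrow> (\<exists>z. poly p z = 0)) \<and>
     (\<forall>z::'k. \<exists>p::'k poly. p \<noteq> 0 \<and> (\<forall>i. coeff p i \<in> F) \<and> poly p z = 0)"

type_synonym ('v, 'k) mpoly = "('v \<Rightarrow>\<^sub>0 nat) \<Rightarrow>\<^sub>0 'k"

definition mpoly_vars :: "('v, 'k::zero) mpoly \<Rightarrow> 'v set" where
  "mpoly_vars p = (\<Union>m\<in>Poly_Mapping.keys p. Poly_Mapping.keys m)"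

definition mpoly_eval :: "('v, 'k::field) mpoly \<Rightarrow> ('v \<Rightarrow> 'k) \<Rightarrow> 'k" where
  "mpoly_eval p x = (\<Sum>(m::'v \<Rightarrow>\<^sub>0 nat)\<in>Poly_Mapping.keys p.
      Poly_Mapping.lookup p m * (\<Prod>v\<in>Poly_Mapping.keys m. x v ^ Poly_Mapping.lookup m v))"

definition mpoly_deriv_eval :: "'v \<Rightarrow> ('v, 'k::field) mpoly \<Rightarrow> ('v \<Rightarrow> 'k) \<Rightarrow> 'k" where
  "mpoly_deriv_eval v p x = (\<Sum>(m::'v \<Rightarrow>\<^sub>0 nat)\<in>Poly_Mapping.keys p.
      Poly_Mapping.lookup p m * of_nat (Poly_Mapping.lookup m v) * x v ^ (Poly_Mapping.lookup m v - 1)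
        * (\<Prod>w\<in>Poly_Mapping.keys m - {v}. x w ^ Poly_Mapping.lookup m w))"

definition polys_in :: "'v set \<Rightarrow> ('v, 'k::zero) mpoly set" where
  "polys_in V = {p. mpoly_vars p \<subseteq> V}"

definition polys_over :: "'k::zero set \<Rightarrow> 'v set \<Rightarrow> ('v, 'k) mpoly set" where
  "polys_over F V = {p \<in> polys_in V. \<forall>m. Poly_Mapping.lookup p m \<in> F}"

definition aff :: "'v set \<Rightarrow> ('v \<Rightarrow> 'k::zero) set" where
  "aff V = {x. \<forall>v. v \<notin> V \<longrightarrow> x v = 0}"

definition zero_set :: "'v set \<Rightarrow> ('v, 'k::field) mpoly set \<Rightarrow> ('v \<Rightarrow> 'k) set" where
  "zero_set V S = {x \<in> aff V. \<forall>p\<in>S. mpoly_eval p x = 0}"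

definition zclosed :: "'v set \<Rightarrow> ('v \<Rightarrow> 'k::field) set \<Rightarrow> bool" where
  "zclosed V X \<longleftrightarrow> (\<exists>S \<subseteq> polys_in V. X = zero_set V S)"

definition defined_over :: "'k::field set \<Rightarrow> 'v set \<Rightarrow> ('v \<Rightarrow> 'k) set \<Rightarrow> bool" where
  "defined_over F V X \<longleftrightarrow> (\<exists>S \<subseteq> polys_over F V. X = zero_set V S)"

definition irreducible_variety :: "'v set \<Rightarrow> ('v \<Rightarrow> 'k::field) set \<Rightarrow> bool" where
  "irreducible_variety V X \<longleftrightarrow> zclosed V X \<and> X \<noteq> {} \<and>
     (\<forall>Y Z. zclosed V Y \<and> zclosed V Z \<and> X = Y \<union> Z \<longrightarrow> X = Y \<or> X = Z)"

definition var_dim :: "'v set \<Rightarrow> ('v \<Rightarrow> 'k::field) set \<Rightarrow> nat" where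
  "var_dim V X = (GREATEST d. \<exists>Y :: nat \<Rightarrow> ('v \<Rightarrow> 'k) set.
       (\<forall>i\<le>d. irreducible_variety V (Y i)) \<and> (\<forall>i<d. Y i \<subset> Y (Suc i)) \<and> Y d \<subseteq> X)"

definition vanishing_ideal :: "'v set \<Rightarrow> ('v \<Rightarrow> 'k::field) set \<Rightarrow> ('v, 'k) mpoly set" where
  "vanishing_ideal V X = {g \<in> polys_in V. \<forall>x\<in>X. mpoly_eval g x = 0}"

abbreviation fscale :: "'k::field \<Rightarrow> ('v \<Rightarrow> 'k) \<Rightarrow> ('v \<Rightarrow> 'k)" where
  "fscale c u \<equiv> (\<lambda>v. c * u v)"

definition vdim :: "('v \<Rightarrow> 'k::field) set \<Rightarrow> nat" where
  "vdim W = vector_space.dim fscale W"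

definition tangent_space :: "'v set \<Rightarrow> ('v \<Rightarrow> 'k::field) set \<Rightarrow> ('v \<Rightarrow> 'k) \<Rightarrow> ('v \<Rightarrow> 'k) set" where
  "tangent_space V X x = {u \<in> aff V. \<forall>g\<in>vanishing_ideal V X.
       (\<Sum>v\<in>V. mpoly_deriv_eval v g x * u v) = 0}"

definition nonsingular_point :: "'v set \<Rightarrow> ('v \<Rightarrow> 'k::field) set \<Rightarrow> ('v \<Rightarrow> 'k) \<Rightarrow> bool" where
  "nonsingular_point V X x \<longleftrightarrow> x \<in> X \<and> vdim (tangent_space V X x) = var_dim V X"

definition mat_rank :: "nat \<Rightarrow> (nat \<Rightarrow> 'v \<Rightarrow> 'k::field) \<Rightarrow> nat" where
  "mat_rank m rows = vdim (module.span fscale (rows ` {..<m}))"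

text \<open>A k-tensor with dimensions d 0, ..., d (k-1) is given by its coefficient array
  on multi-indices j (with j i < d i for i < k, and j i = 0 otherwise).\<close>
definition tidx :: "nat \<Rightarrow> (nat \<Rightarrow> nat) \<Rightarrow> (nat \<Rightarrow> nat) set" where
  "tidx k d = {j. (\<forall>i<k. j i < d i) \<and> (\<forall>i. k \<le> i \<longrightarrow> j i = 0)}"

definition restr_idx :: "(nat \<Rightarrow> nat) \<Rightarrow> nat set \<Rightarrow> (nat \<Rightarrow> nat)" where
  "restr_idx j S = (\<lambda>i. if i \<in> S then j i else 0)"

text \<open>Partition rank over F: minimal r with T = sum of r products p*q of F-multilinear forms
  in complementary nonempty sets of the k variable groups.\<close>
definition partition_rank :: "'k::field set \<Rightarrow> nat \<Rightarrow> (nat \<Rightarrow> nat) \<Rightarrow> ((nat \<Rightarrow> nat) \<Rightarrow> 'k) \<Rightarrow> nat" where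
  "partition_rank F k d T = (LEAST r. \<exists>(S :: nat \<Rightarrow> nat set) (P :: nat \<Rightarrow> (nat \<Rightarrow> nat) \<Rightarrow> 'k) Q.
      (\<forall>l<r. S l \<subseteq> {..<k} \<and> S l \<noteq> {} \<and> S l \<noteq> {..<k}) \<and>
      (\<forall>l<r. \<forall>j. P l j \<in> F \<and> Q l j \<in> F) \<and>
      (\<forall>j\<in>tidx k d. T j = (\<Sum>l<r. P l (restr_idx j (S l)) * Q l (restr_idx j ({..<k} - S l)))))"

text \<open>Variables of the slicing: x = (x_0,...,x_{k-2}), coordinate (i,a) = a-th coordinate of x_i.\<close>
definition slice_vars :: "nat \<Rightarrow> (nat \<Rightarrow> nat) \<Rightarrow> (nat \<times> nat) set" where
  "slice_vars k d = {(i, a). i < k - 1 \<and> a < d i}"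

definition slicing_poly :: "nat \<Rightarrow> (nat \<Rightarrow> nat) \<Rightarrow> ((nat \<Rightarrow> nat) \<Rightarrow> 'k::field) \<Rightarrow> nat \<Rightarrow> (nat \<times> nat, 'k) mpoly" where
  "slicing_poly k d T c = (\<Sum>j\<in>{j\<in>tidx k d. j (k - 1) = c}.
       Poly_Mapping.single (\<Sum>i<k - 1. Poly_Mapping.single (i, j i) (1::nat)) (T j))"

definition slicing_kernel :: "nat \<Rightarrow> (nat \<Rightarrow> nat) \<Rightarrow> ((nat \<Rightarrow> nat) \<Rightarrow> 'k::field) \<Rightarrow> (nat \<times> nat \<Rightarrow> 'k) set" where
  "slicing_kernel k d T = zero_set (slice_vars k d) (slicing_poly k d T ` {..<d (k - 1)})"

definition jac_rank :: "nat \<Rightarrow> (nat \<Rightarrow> nat) \<Rightarrow> ((nat \<Rightarrow> nat) \<Rightarrow> 'k::field) \<Rightarrow> (nat \<times> nat \<Rightarrow> 'k) \<Rightarrow> nat" where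
  "jac_rank k d T x = mat_rank (d (k - 1))
     (\<lambda>c v. if v \<in> slice_vars k d then mpoly_deriv_eval v (slicing_poly k d T c) x else 0)"

definition jac_singular :: "nat \<Rightarrow> (nat \<Rightarrow> nat) \<Rightarrow> ((nat \<Rightarrow> nat) \<Rightarrow> 'k::field) \<Rightarrow> (nat \<times> nat \<Rightarrow> 'k) set \<Rightarrow> (nat \<times> nat \<Rightarrow> 'k) \<Rightarrow> bool" where
  "jac_singular k d T X x \<longleftrightarrow> (\<exists>y\<in>X. jac_rank k d T x < jac_rank k d T y)"

end

theory Submission
  imports Defs "HOL-Computational_Algebra.Primes" "HOL-Library.FuncSet"
begin

text \<open>Let \<open>r = codim X\<close>. At a nonsingular rational point \<open>x\<^sub>0\<close> all but \<open>r\<close> of the coordinates serve as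
  parameters: there are vector fields over \<open>F\<close> that preserve the ideal \<open>I\<close> of \<open>X\<close> and are dual to these coordinates.
  Iterating them gives a ring homomorphism from polynomials to polynomials in the parameters \<open>t\<close> modulo all \<open>t\<^sub>i\<^sup>2\<close>
  that kills \<open>I\<close>, hence a truncated parametrisation \<open>\<psi>\<close> of \<open>X\<close> with \<open>\<tau>(x\<^sub>0 + \<psi>(y)) = 0\<close> for the slicing
  \<open>\<tau>\<close> of \<open>T\<close>, in which only \<open>r\<close> coordinates of \<open>\<psi>\<close> differ from those of \<open>y\<close>. Telescoping the multilinear expression
  \<open>\<tau>(x\<^sub>0 + y) - \<tau>(x\<^sub>0 + \<psi>(y))\<close> gives \<open>\<Sum>\<^sub>b \<alpha>\<^sub>b(y) (y\<^sub>b - \<psi>\<^sub>b(y))\<close> over these \<open>r\<close> coordinates, and the part of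
  multidegree \<open>(1, \<dots>, 1)\<close> is the claimed sum, as \<open>y\<^sub>b - \<psi>\<^sub>b(y)\<close> has no constant term.

  That the vector fields preserve \<open>I\<close> means that the Jacobian of \<open>I\<close> has rank at most \<open>r\<close> on \<open>X\<close>. This is derived from
  a separating transcendence basis of the function field, found by eliminating one variable at a time, and the
  dimension enters through the growth of the space of polynomial functions of bounded degree on \<open>X\<close>.
  Galois descent shows that \<open>I\<close> is spanned by polynomials over the perfect field \<open>F\<close>.\<close>

section \<open>Polynomials: evaluation, formal derivatives, degrees\<close>

text \<open>Squares of parameters may be discarded because the slices are multilinear: only
  coefficients of squarefree monomials are ever read. Each field is then applied at most once, in a
  fixed order, so neither factorials, which can vanish in positive characteristic, nor commuting
  fields are needed. The fields must have polynomial coefficients in F, whereas dimension and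
  irreducibility live over the closure. Hence two families of fields: one over the closure, dual to
  uncontrolled coordinates up to a factor that may vanish at the rational point, and one over F,
  read off from a Jacobian whose pivot does not vanish there. The former only serves to show that
  the latter preserves the ideal. That pivot is invertible at the point but not as a polynomial, so
  duality holds up to \<open>e ^ N\<close> with \<open>e\<close> zero at the point; the error is
  invisible once \<open>N\<close> exceeds the number of fields. The constant
  \<open>2 ^ (k - 1) - 1\<close> counts the proper subsets of the first \<open>k - 1\<close> axes:
  each of them gives one product per remaining coordinate.\<close>

definition mconst :: "'k \<Rightarrow> ('v, 'k::zero) mpoly" where
  "mconst c = Poly_Mapping.single 0 c"

definition mvar :: "'v \<Rightarrow> ('v, 'k::zero_neq_one) mpoly" where
  "mvar v = Poly_Mapping.single (Poly_Mapping.single v 1) 1"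

definition monom_eval :: "('v \<Rightarrow> 'k::field) \<Rightarrow> ('v \<Rightarrow>\<^sub>0 nat) \<Rightarrow> 'k" where
  "monom_eval x m = (\<Prod>v\<in>Poly_Mapping.keys m. x v ^ Poly_Mapping.lookup m v)"

lemma mpoly_decomp: "p = (\<Sum>m\<in>Poly_Mapping.keys p. Poly_Mapping.single m (Poly_Mapping.lookup p m))"
  by (rule poly_mapping_eqI)
    (auto simp: lookup_sum lookup_single when_def in_keys_iff sum.delta)

lemma mpoly_induct [case_names single add]:
  fixes p :: "('v, 'k::comm_monoid_add) mpoly"
  assumes single: "\<And>m c. P (Poly_Mapping.single m c)"
    and add: "\<And>p q. P p \<Longrightarrow> P q \<Longrightarrow> P (p + q)"
  shows "P p"
proof -
  have "P (\<Sum>m\<in>A. Poly_Mapping.single m (Poly_Mapping.lookup p m))" if "finite A" for A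
    using that by (induction A rule: finite_induct) (auto intro: add single simp: single[of 0 0, simplified])
  then show ?thesis
    by (subst mpoly_decomp) simp
qed

lemma monom_eval_superset:
  assumes "finite A" "Poly_Mapping.keys m \<subseteq> A"
  shows "monom_eval x m = (\<Prod>v\<in>A. x v ^ Poly_Mapping.lookup m v)"
  unfolding monom_eval_def using assms
  by (intro prod.mono_neutral_left) (auto simp: in_keys_iff)

lemma monom_eval_0 [simp]: "monom_eval x 0 = 1"
  by (simp add: monom_eval_def)

lemma monom_eval_add: "monom_eval x (m + n) = monom_eval x m * monom_eval x n"
proof -
  let ?A = "Poly_Mapping.keys m \<union> Poly_Mapping.keys n"
  have "Poly_Mapping.keys (m + n) \<subseteq> ?A" by (rule keys_add)
  then show ?thesis
    by (simp add: monom_eval_superset[of ?A] lookup_add power_add prod.distrib)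
qed

lemma monom_eval_single [simp]: "monom_eval x (Poly_Mapping.single v n) = x v ^ n"
  by (simp add: monom_eval_def)

lemma mpoly_eval_superset:
  assumes "finite A" "Poly_Mapping.keys p \<subseteq> A"
  shows "mpoly_eval p x = (\<Sum>m\<in>A. Poly_Mapping.lookup p m * monom_eval x m)"
  unfolding mpoly_eval_def monom_eval_def using assms
  by (intro sum.mono_neutral_left) (auto simp: in_keys_iff)

lemma mpoly_eval_single [simp]: "mpoly_eval (Poly_Mapping.single m c) x = c * monom_eval x m"
  by (simp add: mpoly_eval_def monom_eval_def)

lemma mpoly_eval_0 [simp]: "mpoly_eval 0 x = 0"
  by (simp add: mpoly_eval_def)

lemma mpoly_eval_add [simp]: "mpoly_eval (p + q) x = mpoly_eval p x + mpoly_eval q x"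
proof -
  let ?A = "Poly_Mapping.keys p \<union> Poly_Mapping.keys q"
  have "Poly_Mapping.keys (p + q) \<subseteq> ?A" by (rule keys_add)
  then show ?thesis
    by (simp add: mpoly_eval_superset[of ?A] lookup_add sum.distrib distrib_right)
qed

lemma mpoly_eval_uminus [simp]: "mpoly_eval (- p) x = - mpoly_eval p x"
  using mpoly_eval_add[of p "- p" x] by (simp add: eq_neg_iff_add_eq_0 add.commute)

lemma mpoly_eval_diff [simp]: "mpoly_eval (p - q) x = mpoly_eval p x - mpoly_eval q x"
  using mpoly_eval_add[of p "- q" x] by simp

lemma mpoly_eval_mult [simp]: "mpoly_eval (p * q) x = mpoly_eval p x * mpoly_eval q x"
proof (induction p rule: mpoly_induct)
  case (single m c)
  then show ?case
    by (induction q rule: mpoly_induct) (auto simp: mult_single monom_eval_add algebra_simps)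
qed (auto simp: algebra_simps)

lemma mpoly_eval_sum [simp]: "mpoly_eval (sum f A) x = (\<Sum>a\<in>A. mpoly_eval (f a) x)"
  by (induction A rule: infinite_finite_induct) auto

lemma mpoly_eval_mconst [simp]: "mpoly_eval (mconst c) x = c"
  by (simp add: mconst_def)

lemma mpoly_eval_1 [simp]: "mpoly_eval 1 x = 1"
  using mpoly_eval_mconst[of 1 x] by (simp add: mconst_def)

lemma mpoly_eval_power [simp]: "mpoly_eval (p ^ n) x = mpoly_eval p x ^ n"
  by (induction n) auto

lemma mpoly_eval_mvar [simp]: "mpoly_eval (mvar v) x = x v"
  by (simp add: mvar_def)

lemma mconst_add: "mconst (a + b) = mconst a + mconst b"
  by (simp add: mconst_def single_add)

lemma mconst_mult: "mconst (a * b) = mconst a * (mconst b :: ('v, 'k::field) mpoly)"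
  by (simp add: mconst_def mult_single)

lemma mconst_0 [simp]: "mconst 0 = 0" and mconst_1 [simp]: "mconst 1 = 1"
  by (simp_all add: mconst_def)

lemma mconst_sum: "mconst (sum f A) = (\<Sum>a\<in>A. mconst (f a))"
  by (induction A rule: infinite_finite_induct) (auto simp: mconst_add)

lemma lookup_mconst_mult [simp]:
  "Poly_Mapping.lookup (mconst c * p) m = c * Poly_Mapping.lookup (p :: ('v, 'k::field) mpoly) m"
proof (induction p rule: mpoly_induct)
  case (single n a)
  then show ?case by (simp add: mconst_def mult_single lookup_single when_def)
qed (auto simp: distrib_left lookup_add)

text \<open>\<open>mpoly_deriv_eval\<close> only yields values; iterating derivations and testing
  membership in an ideal need the derivative as a polynomial. The truncated subtraction of exponents
  is harmless: where \<open>v\<close> does not occur, the factor \<open>of_nat 0\<close> removes the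
  term.\<close>

definition mderiv :: "'v \<Rightarrow> ('v, 'k::field) mpoly \<Rightarrow> ('v, 'k) mpoly" where
  "mderiv v p = (\<Sum>m\<in>Poly_Mapping.keys p.
     Poly_Mapping.single (m - Poly_Mapping.single v 1) (Poly_Mapping.lookup p m * of_nat (Poly_Mapping.lookup m v)))"

lemma mderiv_superset:
  assumes "finite A" "Poly_Mapping.keys p \<subseteq> A"
  shows "mderiv v p = (\<Sum>m\<in>A.
     Poly_Mapping.single (m - Poly_Mapping.single v 1) (Poly_Mapping.lookup p m * of_nat (Poly_Mapping.lookup m v)))"
  unfolding mderiv_def using assms
  by (intro sum.mono_neutral_left) (auto simp: in_keys_iff)

lemma mderiv_add [simp]: "mderiv v (p + q) = mderiv v p + mderiv v q"
proof -
  let ?A = "Poly_Mapping.keys p \<union> Poly_Mapping.keys q"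
  have "Poly_Mapping.keys (p + q) \<subseteq> ?A" by (rule keys_add)
  then show ?thesis
    by (simp add: mderiv_superset[of ?A] lookup_add single_add sum.distrib distrib_right)
qed

lemma mderiv_single:
  "mderiv v (Poly_Mapping.single m c) =
    Poly_Mapping.single (m - Poly_Mapping.single v 1) (c * of_nat (Poly_Mapping.lookup m v))"
  by (simp add: mderiv_def)

lemma mderiv_0 [simp]: "mderiv v 0 = 0"
  by (simp add: mderiv_def)

lemma mderiv_mult: "mderiv v (p * q) = mderiv v p * q + p * mderiv v q"
proof (induction p rule: mpoly_induct)
  case (single m c)
  show ?case
  proof (induction q rule: mpoly_induct)
    case (single n d)
    let ?s = "Poly_Mapping.single v (1::nat)"
    have 1: "Poly_Mapping.lookup m v > 0 \<Longrightarrow> m - ?s + n = m + n - ?s"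
      by (rule poly_mapping_eqI) (auto simp: lookup_add lookup_minus lookup_single when_def)
    have 2: "Poly_Mapping.lookup n v > 0 \<Longrightarrow> m + (n - ?s) = m + n - ?s"
      by (rule poly_mapping_eqI) (auto simp: lookup_add lookup_minus lookup_single when_def)
    show ?case
      using 1 2
      by (cases "Poly_Mapping.lookup m v = 0"; cases "Poly_Mapping.lookup n v = 0")
        (auto simp: mderiv_single mult_single lookup_add algebra_simps single_add)
  qed (auto simp: algebra_simps)
qed (auto simp: algebra_simps)

lemma mderiv_mconst [simp]: "mderiv v (mconst c) = 0"
  by (simp add: mconst_def mderiv_single)

lemma mderiv_1 [simp]: "mderiv v 1 = 0"
  using mderiv_mconst[of v 1] by (simp add: mconst_def)

lemma mderiv_mvar [simp]: "mderiv v (mvar w) = (if v = w then 1 else 0)"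
  by (simp add: mvar_def mderiv_single lookup_single when_def)

lemma mderiv_uminus [simp]: "mderiv v (- p) = - mderiv v p"
  using mderiv_add[of v p "- p"] by (simp add: eq_neg_iff_add_eq_0 add.commute)

lemma mderiv_diff [simp]: "mderiv v (p - q) = mderiv v p - mderiv v q"
  using mderiv_add[of v p "- q"] by simp

lemma mderiv_sum [simp]: "mderiv v (sum f A) = (\<Sum>a\<in>A. mderiv v (f a))"
  by (induction A rule: infinite_finite_induct) auto

lemma mpoly_eval_mderiv: "mpoly_eval (mderiv v p) x = mpoly_deriv_eval v p x"
proof -
  have "of_nat (Poly_Mapping.lookup m v) * monom_eval x (m - Poly_Mapping.single v 1) =
    of_nat (Poly_Mapping.lookup m v) * x v ^ (Poly_Mapping.lookup m v - 1)
        * (\<Prod>w\<in>Poly_Mapping.keys m - {v}. x w ^ Poly_Mapping.lookup m w)" for m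
  proof (cases "Poly_Mapping.lookup m v = 0")
    case False
    have sub: "Poly_Mapping.keys (m - Poly_Mapping.single v 1) \<subseteq> Poly_Mapping.keys m"
      by (auto simp: in_keys_iff lookup_minus)
    have v: "v \<in> Poly_Mapping.keys m" using False by (simp add: in_keys_iff)
    show ?thesis
      unfolding monom_eval_superset[OF finite_keys sub] prod.remove[OF finite_keys v]
      by (auto simp: lookup_minus lookup_single when_def intro!: prod.cong)
  qed simp
  note * = this
  show ?thesis
    unfolding mderiv_def mpoly_deriv_eval_def mpoly_eval_sum mpoly_eval_single
    by (rule sum.cong[OF refl]) (simp only: mult.assoc *)
qed

lemma lookup_mderiv:
  "Poly_Mapping.lookup (mderiv v p) m =
    of_nat (Poly_Mapping.lookup m v + 1) * Poly_Mapping.lookup p (m + Poly_Mapping.single v 1)"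
proof (induction p rule: mpoly_induct)
  case (single n c)
  let ?s = "Poly_Mapping.single v (1::nat)"
  have "(n - ?s = m \<and> Poly_Mapping.lookup n v \<noteq> 0) \<longleftrightarrow> n = m + ?s"
  proof
    assume a: "n - ?s = m \<and> Poly_Mapping.lookup n v \<noteq> 0"
    show "n = m + ?s"
      by (rule poly_mapping_eqI)
        (use a in \<open>auto simp: lookup_add lookup_minus lookup_single when_def\<close>)
  qed (auto simp: lookup_add)
  then show ?case
    by (cases "Poly_Mapping.lookup n v = 0")
      (auto simp: mderiv_single lookup_single when_def lookup_add)
qed (auto simp: lookup_add algebra_simps)

section \<open>Polynomials in prescribed variables and of bounded degree\<close>

lemma polys_inI: "(\<And>m v. m \<in> Poly_Mapping.keys p \<Longrightarrow> v \<in> Poly_Mapping.keys m \<Longrightarrow> v \<in> W) \<Longrightarrow> p \<in> polys_in W"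
  by (auto simp: polys_in_def mpoly_vars_def)

lemma polys_inD: "p \<in> polys_in W \<Longrightarrow> m \<in> Poly_Mapping.keys p \<Longrightarrow> Poly_Mapping.keys m \<subseteq> W"
  by (auto simp: polys_in_def mpoly_vars_def)

lemma polys_in_add: "p \<in> polys_in W \<Longrightarrow> q \<in> polys_in W \<Longrightarrow> p + q \<in> polys_in W"
  by (rule polys_inI) (use keys_add[of p q] in \<open>blast dest: polys_inD\<close>)

lemma polys_in_0 [simp]: "0 \<in> polys_in W"
  by (auto simp: polys_in_def mpoly_vars_def)

lemma polys_in_uminus: "p \<in> polys_in W \<Longrightarrow> - p \<in> polys_in W"
  for p :: "('v, 'k::field) mpoly"
  by (auto simp: polys_in_def mpoly_vars_def in_keys_iff)

lemma polys_in_diff: "p \<in> polys_in W \<Longrightarrow> q \<in> polys_in W \<Longrightarrow> p - q \<in> polys_in W"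
  for p :: "('v, 'k::field) mpoly"
  using polys_in_add[of p W "- q"] polys_in_uminus[of q W] by simp

lemma polys_in_mult: "p \<in> polys_in W \<Longrightarrow> q \<in> polys_in W \<Longrightarrow> p * q \<in> polys_in W"
  for p :: "('v, 'k::field) mpoly"
proof (rule polys_inI)
  fix m v assume pq: "p \<in> polys_in W" "q \<in> polys_in W"
    and m: "m \<in> Poly_Mapping.keys (p * q)" and v: "v \<in> Poly_Mapping.keys m"
  obtain a b where "m = a + b" "a \<in> Poly_Mapping.keys p" "b \<in> Poly_Mapping.keys q"
    using m keys_mult[of p q] by blast
  then show "v \<in> W" using v keys_add[of a b] pq by (auto dest: polys_inD)
qed

lemma polys_in_mconst [simp]: "mconst c \<in> polys_in W"
  by (auto simp: polys_in_def mpoly_vars_def mconst_def)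

lemma polys_in_1 [simp]: "(1 :: ('v, 'k::field) mpoly) \<in> polys_in W"
  by (auto simp: polys_in_def mpoly_vars_def)

lemma polys_in_mvar: "v \<in> W \<Longrightarrow> (mvar v :: ('v, 'k::field) mpoly) \<in> polys_in W"
  by (auto simp: polys_in_def mpoly_vars_def mvar_def)

lemma polys_in_sum: "(\<And>a. a \<in> A \<Longrightarrow> f a \<in> polys_in W) \<Longrightarrow> sum f A \<in> polys_in W"
  by (induction A rule: infinite_finite_induct) (auto intro: polys_in_add)

lemma polys_in_power: "p \<in> polys_in W \<Longrightarrow> p ^ n \<in> polys_in W"
  for p :: "('v, 'k::field) mpoly"
  by (induction n) (auto intro: polys_in_mult)

lemma polys_in_prod: "(\<And>a. a \<in> A \<Longrightarrow> f a \<in> polys_in W) \<Longrightarrow> prod f A \<in> polys_in W"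
  for f :: "'a \<Rightarrow> ('v, 'k::field) mpoly"
  by (induction A rule: infinite_finite_induct) (auto intro: polys_in_mult)

lemma polys_in_mderiv: "p \<in> polys_in W \<Longrightarrow> mderiv v p \<in> polys_in W"
proof (rule polys_inI)
  fix m w assume p: "p \<in> polys_in W" and m: "m \<in> Poly_Mapping.keys (mderiv v p)"
    and w: "w \<in> Poly_Mapping.keys m"
  have "m + Poly_Mapping.single v 1 \<in> Poly_Mapping.keys p"
    using m by (auto simp: in_keys_iff lookup_mderiv)
  moreover have "w \<in> Poly_Mapping.keys (m + Poly_Mapping.single v 1)"
    using w by (simp add: in_keys_iff lookup_add)
  ultimately show "w \<in> W" using polys_inD[OF p] by blast
qed

lemma polys_in_UNIV [simp]: "p \<in> polys_in UNIV"
  by (simp add: polys_in_def)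

lemma mderiv_polys_in_eq_0: "p \<in> polys_in W \<Longrightarrow> v \<notin> W \<Longrightarrow> mderiv v p = 0"
proof (rule poly_mapping_eqI)
  fix m assume p: "p \<in> polys_in W" and v: "v \<notin> W"
  have "m + Poly_Mapping.single v 1 \<notin> Poly_Mapping.keys p"
  proof
    assume "m + Poly_Mapping.single v 1 \<in> Poly_Mapping.keys p"
    moreover have "v \<in> Poly_Mapping.keys (m + Poly_Mapping.single v 1)"
      by (simp add: in_keys_iff lookup_add)
    ultimately show False using polys_inD[OF p] v by blast
  qed
  then show "Poly_Mapping.lookup (mderiv v p) m = Poly_Mapping.lookup 0 m"
    by (simp add: lookup_mderiv in_keys_iff)
qed

text \<open>A bound instead of a degree function, so that the zero polynomial needs no
  convention.\<close>

definition deg_le :: "'v set \<Rightarrow> nat \<Rightarrow> ('v, 'k::zero) mpoly \<Rightarrow> bool" where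
  "deg_le V N p \<longleftrightarrow> (\<forall>m\<in>Poly_Mapping.keys p. (\<Sum>v\<in>V. Poly_Mapping.lookup m v) \<le> N)"

lemma deg_le_mono: "deg_le V N p \<Longrightarrow> N \<le> M \<Longrightarrow> deg_le V M p"
  unfolding deg_le_def using le_trans by blast

lemma deg_le_add: "deg_le V N p \<Longrightarrow> deg_le V N q \<Longrightarrow> deg_le V N (p + q)"
  using keys_add[of p q] by (auto simp: deg_le_def)

lemma deg_le_0 [simp]: "deg_le V N 0"
  by (simp add: deg_le_def)

lemma deg_le_sum: "(\<And>a. a \<in> A \<Longrightarrow> deg_le V N (f a)) \<Longrightarrow> deg_le V N (sum f A)"
  by (induction A rule: infinite_finite_induct) (auto intro: deg_le_add)

lemma deg_le_1 [simp]: "deg_le V N (1 :: ('v, 'k::field) mpoly)"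
  by (simp add: deg_le_def)

lemma deg_le_uminus: "deg_le V N p \<Longrightarrow> deg_le V N (- p)"
  for p :: "('v, 'k::field) mpoly"
  by (auto simp: deg_le_def in_keys_iff)

lemma deg_le_diff: "deg_le V N p \<Longrightarrow> deg_le V N q \<Longrightarrow> deg_le V N (p - q)"
  for p :: "('v, 'k::field) mpoly"
  using deg_le_add[of V N p "- q"] deg_le_uminus[of V N q] by simp

lemma deg_le_mult: "deg_le V N p \<Longrightarrow> deg_le V M q \<Longrightarrow> deg_le V (N + M) (p * q)"
  for p :: "('v, 'k::field) mpoly"
  unfolding deg_le_def
proof
  fix m assume p: "\<forall>m\<in>Poly_Mapping.keys p. (\<Sum>v\<in>V. Poly_Mapping.lookup m v) \<le> N"
    and q: "\<forall>m\<in>Poly_Mapping.keys q. (\<Sum>v\<in>V. Poly_Mapping.lookup m v) \<le> M"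
    and m: "m \<in> Poly_Mapping.keys (p * q)"
  obtain a b where "m = a + b" "a \<in> Poly_Mapping.keys p" "b \<in> Poly_Mapping.keys q"
    using m keys_mult[of p q] by blast
  then show "(\<Sum>v\<in>V. Poly_Mapping.lookup m v) \<le> N + M"
    using p q by (auto simp: lookup_add sum.distrib intro!: add_mono)
qed

lemma deg_le_power: "deg_le V N p \<Longrightarrow> deg_le V (n * N) (p ^ n)"
  for p :: "('v, 'k::field) mpoly"
  by (induction n) (auto intro: deg_le_mult)

lemma deg_le_prod: 
  fixes f :: "'a \<Rightarrow> ('v, 'k::field) mpoly"
  assumes "\<And>a. a \<in> A \<Longrightarrow> deg_le V (N a) (f a)"
  shows "deg_le V (\<Sum>a\<in>A. N a) (prod f A)"
  using assms by (induction A rule: infinite_finite_induct) (auto intro: deg_le_mult)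

lemma deg_le_exists: "\<exists>N. deg_le V N p"
  unfolding deg_le_def
  by (rule exI[of _ "\<Sum>m\<in>Poly_Mapping.keys p. \<Sum>v\<in>V. Poly_Mapping.lookup m v"])
    (auto intro!: member_le_sum)

lemma deg_le_mderiv: 
  assumes "deg_le V N p" "v \<in> V" "finite V"
  shows "deg_le V (N - 1) (mderiv v p)"
  unfolding deg_le_def
proof
  fix m assume "m \<in> Poly_Mapping.keys (mderiv v p)"
  then have "m + Poly_Mapping.single v 1 \<in> Poly_Mapping.keys p"
    by (auto simp: in_keys_iff lookup_mderiv)
  then have "(\<Sum>w\<in>V. Poly_Mapping.lookup (m + Poly_Mapping.single v 1) w) \<le> N"
    using assms(1) unfolding deg_le_def by blast
  then show "(\<Sum>w\<in>V. Poly_Mapping.lookup m w) \<le> N - 1"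
    using assms by (simp add: lookup_add lookup_single sum.distrib when_def)
qed

section \<open>Vector fields tangent to a prime ideal\<close>

locale prime_ideal_set =
  fixes I :: "'a::comm_ring_1 set"
  assumes zero: "0 \<in> I"
    and add: "a \<in> I \<Longrightarrow> b \<in> I \<Longrightarrow> a + b \<in> I"
    and mult_left: "a \<in> I \<Longrightarrow> r * a \<in> I"
    and one: "1 \<notin> I"
    and prime: "a * b \<in> I \<Longrightarrow> a \<in> I \<or> b \<in> I"
begin

lemma mult_right: "a \<in> I \<Longrightarrow> a * r \<in> I"
  using mult_left[of a r] by (simp add: mult.commute)

lemma uminus: "a \<in> I \<Longrightarrow> - a \<in> I"
  using mult_left[of a "- 1"] by simp

lemma diff: "a \<in> I \<Longrightarrow> b \<in> I \<Longrightarrow> a - b \<in> I"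
  using add[of a "- b"] uminus[of b] by simp

lemma sum: "(\<And>x. x \<in> A \<Longrightarrow> f x \<in> I) \<Longrightarrow> sum f A \<in> I"
  by (induction A rule: infinite_finite_induct) (auto intro: zero add)

lemma power: "a ^ n \<in> I \<Longrightarrow> a \<in> I"
  by (induction n) (use one prime in auto)

lemma add_iff: "b \<in> I \<Longrightarrow> a + b \<in> I \<longleftrightarrow> a \<in> I"
  using add diff by (metis add_diff_cancel_right')

end

section \<open>Derivations and vector fields\<close>

definition derivation :: "('a::comm_ring_1 \<Rightarrow> 'a) \<Rightarrow> bool" where
  "derivation D \<longleftrightarrow> (\<forall>p q. D (p + q) = D p + D q) \<and> (\<forall>p q. D (p * q) = D p * q + p * D q)"

lemma derivation_add: "derivation D \<Longrightarrow> D (p + q) = D p + D q"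
  and derivation_mult: "derivation D \<Longrightarrow> D (p * q) = D p * q + p * D q"
  by (auto simp: derivation_def)

lemma derivation_0: "derivation D \<Longrightarrow> D 0 = 0"
  using derivation_add[of D 0 0] by simp

lemma derivation_1: "derivation D \<Longrightarrow> D 1 = 0"
  using derivation_mult[of D 1 1] by simp

lemma derivation_diff: "derivation D \<Longrightarrow> D (p - q) = D p - D q"
  using derivation_add[of D "p - q" q] by (simp add: algebra_simps)

lemma derivation_sum: "derivation D \<Longrightarrow> D (sum f A) = (\<Sum>a\<in>A. D (f a))"
  by (induction A rule: infinite_finite_induct) (auto simp: derivation_0 derivation_add)

lemma derivation_mderiv: "derivation (mderiv v)"
  by (auto simp: derivation_def mderiv_mult)

definition vfield :: "'v set \<Rightarrow> ('v \<Rightarrow> ('v, 'k::field) mpoly) \<Rightarrow> ('v, 'k) mpoly \<Rightarrow> ('v, 'k) mpoly" where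
  "vfield V c p = (\<Sum>v\<in>V. c v * mderiv v p)"

lemma derivation_vfield: "derivation (vfield V c)"
  unfolding derivation_def vfield_def
  by (auto simp: mderiv_mult algebra_simps sum.distrib sum_distrib_left)

lemma mvar_power: "mvar v ^ n = Poly_Mapping.single (Poly_Mapping.single v n) (1::'k::field)"
  by (induction n) (auto simp: mvar_def mult_single simp flip: single_add)

text \<open>The bound \<open>N\<close> controls both the degree of the coefficients and the number
  of terms; counting functions of bounded degree requires both.\<close>

lemma mpoly_expand:
  fixes g :: "('v, 'k::field) mpoly"
  assumes g: "g \<in> polys_in (insert v W)" and N: "deg_le V N g" and V: "finite V" "v \<in> V"
  obtains r where "\<And>i. r i \<in> polys_in W" "\<And>i. deg_le V N (r i)"
    "g = (\<Sum>i<Suc N. r i * mvar v ^ i)"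
proof
  let ?k = "Poly_Mapping.keys g" and ?l = Poly_Mapping.lookup
  define h where "h m = Poly_Mapping.single (m - Poly_Mapping.single v (?l m v)) (?l g m)" for m
  define r where "r i = (\<Sum>m\<in>?k. if ?l m v = i then h m else 0)" for i
  have h: "h m \<in> polys_in W" "deg_le V N (h m)" if "m \<in> ?k" for m
  proof -
    have "u \<in> W" if "u \<in> Poly_Mapping.keys (m - Poly_Mapping.single v (?l m v))" for u
    proof -
      have "u \<noteq> v" "u \<in> Poly_Mapping.keys m"
        using that by (auto simp: in_keys_iff lookup_minus lookup_single when_def split: if_splits)
      then show "u \<in> W" using polys_inD[OF g \<open>m \<in> ?k\<close>] by auto
    qed
    then show "h m \<in> polys_in W" by (auto simp: h_def intro!: polys_inI split: if_splits)
    have "(\<Sum>u\<in>V. ?l m u) \<le> N" using N that by (auto simp: deg_le_def)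
    moreover have "(\<Sum>u\<in>V. ?l (m - Poly_Mapping.single v (?l m v)) u) \<le> (\<Sum>u\<in>V. ?l m u)"
      by (intro sum_mono) (auto simp: lookup_minus)
    ultimately show "deg_le V N (h m)" by (auto simp: deg_le_def h_def)
  qed
  show "r i \<in> polys_in W" for i
    unfolding r_def by (intro polys_in_sum) (use h in auto)
  show "deg_le V N (r i)" for i
    unfolding r_def by (intro deg_le_sum) (use h in auto)
  have "h m * mvar v ^ ?l m v = Poly_Mapping.single m (?l g m)" for m
  proof -
    have "m - Poly_Mapping.single v (?l m v) + Poly_Mapping.single v (?l m v) = m"
      by (rule poly_mapping_eqI) (auto simp: lookup_add lookup_minus lookup_single when_def)
    then show ?thesis by (simp add: h_def mvar_power mult_single)
  qed
  then have g': "g = (\<Sum>m\<in>?k. h m * mvar v ^ ?l m v)"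
    by (simp flip: mpoly_decomp)
  have lt: "?l m v < Suc N" if "m \<in> ?k" for m
    using N that member_le_sum[of v V "?l m"] V by (auto simp: deg_le_def less_Suc_eq_le intro: le_trans)
  have "(\<Sum>i<Suc N. r i * mvar v ^ i) = (\<Sum>i<Suc N. \<Sum>m\<in>?k. if ?l m v = i then h m * mvar v ^ i else 0)"
    by (intro sum.cong refl) (auto simp: r_def sum_distrib_right intro!: sum.cong)
  also have "\<dots> = (\<Sum>m\<in>?k. \<Sum>i<Suc N. if ?l m v = i then h m * mvar v ^ i else 0)"
    by (rule sum.swap)
  also have "\<dots> = (\<Sum>m\<in>?k. h m * mvar v ^ ?l m v)"
    using lt by (intro sum.cong refl) (simp add: sum.delta' del: sum.lessThan_Suc)
  finally show "g = (\<Sum>i<Suc N. r i * mvar v ^ i)" using g' by simp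
qed

section \<open>Roots of polynomials in positive characteristic\<close>

lemma single_power:
  "Poly_Mapping.single m c ^ n = Poly_Mapping.single (Poly_Mapping.map ((*) n) m) (c ^ n :: 'k::field)"
  for m :: "'v \<Rightarrow>\<^sub>0 nat"
proof (induction n)
  case 0
  have "Poly_Mapping.map ((*) 0) m = 0"
    by (rule poly_mapping_eqI) (auto simp: Poly_Mapping.map.rep_eq when_def)
  then show ?case by (simp only: power_0 single_one)
next
  case (Suc n)
  have "m + Poly_Mapping.map ((*) n) m = Poly_Mapping.map ((*) (Suc n)) m"
    by (rule poly_mapping_eqI) (auto simp: Poly_Mapping.map.rep_eq when_def lookup_add)
  then show ?case by (simp only: power_Suc Suc mult_single)
qed

text \<open>Vanishing derivatives force every exponent to be divisible by \<open>p\<close>. The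
  Frobenius map is additive, so the root can be taken monomial by monomial. The drop of the degree
  bound to \<open>N div p\<close> is what contradicts a minimal choice later.\<close>

lemma mpoly_pth_root:
  fixes f :: "('v, 'k::field) mpoly"
  assumes f: "f \<in> polys_in W" "\<And>v. v \<in> W \<Longrightarrow> mderiv v f = 0"
    and p: "prime p" "of_nat p = (0::'k)" "\<And>a::'k. \<exists>b. b ^ p = a"
    and N: "deg_le V N f" and V: "finite V" "W \<subseteq> V"
  obtains g where "g \<in> polys_in W" "g ^ p = f" "deg_le V (N div p) g"
proof -
  let ?l = Poly_Mapping.lookup
  have CHk: "CHAR('k) = p"
  proof -
    have "CHAR('k) dvd p" using p(2) by (simp add: of_nat_eq_0_iff_char_dvd)
    then show ?thesis using p(1) CHAR_not_1'[where 'a='k] by (auto simp: prime_nat_iff)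
  qed
  have CH: "CHAR(('v, 'k) mpoly) = p"
  proof (rule CHAR_eqI)
    have "of_nat n = (mconst (of_nat n) :: ('v, 'k) mpoly)" for n
      by (induction n) (auto simp: mconst_add)
    note eq = this
    show "of_nat p = (0 :: ('v, 'k) mpoly)" by (simp add: eq p(2))
    fix n assume "of_nat n = (0 :: ('v, 'k) mpoly)"
    then have "mconst (of_nat n) = (0 :: ('v, 'k) mpoly)"
      by (simp only: eq)
    then have "of_nat n = (0::'k)"
      by (metis mpoly_eval_0 mpoly_eval_mconst)
    then show "p dvd n" by (simp add: of_nat_eq_0_iff_char_dvd CHk)
  qed
  have dv: "p dvd ?l m v" if m: "m \<in> Poly_Mapping.keys f" for m v
  proof (cases "v \<in> W \<and> ?l m v > 0")
    case True
    define n where "n = m - Poly_Mapping.single v 1"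
    have mn: "m = n + Poly_Mapping.single v 1"
      using True by (intro poly_mapping_eqI) (auto simp: n_def lookup_add lookup_minus lookup_single when_def)
    have "?l (mderiv v f) n = 0" using f(2) True by simp
    then have "(of_nat (?l n v + 1) :: 'k) = 0"
      using m unfolding lookup_mderiv mn[symmetric] by (simp add: in_keys_iff del: of_nat_add)
    then have "p dvd ?l n v + 1" by (simp only: of_nat_eq_0_iff_char_dvd CHk)
    then show ?thesis by (simp add: mn lookup_add)
  next
    case False
    have "v \<notin> W \<Longrightarrow> v \<notin> Poly_Mapping.keys m" using polys_inD[OF f(1) m] by blast
    then have "?l m v = 0" using False by (auto simp: in_keys_iff)
    then show ?thesis by simp
  qed
  obtain rt :: "'k \<Rightarrow> 'k" where rt: "rt a ^ p = a" for a using p(3) by metis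
  let ?q = "\<lambda>m. Poly_Mapping.map (\<lambda>k. k div p) m :: 'v \<Rightarrow>\<^sub>0 nat"
  have lq: "?l (?q m) v = ?l m v div p" for m v
    by (simp add: Poly_Mapping.map.rep_eq when_def)
  have pq: "Poly_Mapping.map ((*) p) (?q m) = m" if "m \<in> Poly_Mapping.keys f" for m
  proof (rule poly_mapping_eqI)
    fix k
    have "?l (Poly_Mapping.map ((*) p) (?q m)) k = p * (?l m k div p)"
      by (auto simp: Poly_Mapping.map.rep_eq when_def)
    then show "?l (Poly_Mapping.map ((*) p) (?q m)) k = ?l m k" using dv[OF that] by simp
  qed
  define g where "g = (\<Sum>m\<in>Poly_Mapping.keys f. Poly_Mapping.single (?q m) (rt (?l f m)))"
  show ?thesis
  proof
    show "g \<in> polys_in W"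
      unfolding g_def
    proof (intro polys_in_sum polys_inI)
      fix m n v assume "m \<in> Poly_Mapping.keys f" "n \<in> Poly_Mapping.keys (Poly_Mapping.single (?q m) (rt (?l f m)))"
        "v \<in> Poly_Mapping.keys n"
      then have "?l m v div p \<noteq> 0"
        by (auto simp: in_keys_iff lq lookup_single when_def split: if_splits)
      then have "v \<in> Poly_Mapping.keys m" unfolding in_keys_iff by (metis div_0)
      then show "v \<in> W" using polys_inD[OF f(1) \<open>m \<in> _\<close>] by blast
    qed
    have "g ^ p = (\<Sum>m\<in>Poly_Mapping.keys f. Poly_Mapping.single (?q m) (rt (?l f m)) ^ p)"
      unfolding g_def using freshmans_dream_sum[where 'a="('v, 'k) mpoly"] p(1) CH by auto
    also have "\<dots> = (\<Sum>m\<in>Poly_Mapping.keys f. Poly_Mapping.single m (?l f m))"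
      by (intro sum.cong refl) (simp add: single_power rt pq)
    finally show "g ^ p = f" by (simp flip: mpoly_decomp)
    have "deg_le V (N div p) (Poly_Mapping.single (?q m) (rt (?l f m)))" if "m \<in> Poly_Mapping.keys f" for m
    proof -
      have "p * (\<Sum>v\<in>V. ?l (?q m) v) = (\<Sum>v\<in>V. ?l m v)"
        using dv[OF that] by (simp add: sum_distrib_left lq)
      moreover have "(\<Sum>v\<in>V. ?l m v) \<le> N" using N that by (auto simp: deg_le_def)
      ultimately have "p * (\<Sum>v\<in>V. ?l (?q m) v) \<le> N" by simp
      then have "(\<Sum>v\<in>V. ?l (?q m) v) \<le> N div p"
        using p(1) by (simp add: less_eq_div_iff_mult_less_eq prime_gt_0_nat mult.commute)
      then show ?thesis by (auto simp: deg_le_def split: if_splits)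
    qed
    then show "deg_le V (N div p) g" unfolding g_def by (rule deg_le_sum)
  qed
qed

section \<open>Growth of the space of functions modulo an ideal\<close>

definition spans_mod :: "('v, 'k::field) mpoly set \<Rightarrow> ('v, 'k) mpoly set \<Rightarrow> ('v, 'k) mpoly set" where
  "spans_mod I S = {g. \<exists>l. g - (\<Sum>s\<in>S. mconst (l s) * s) \<in> I}"

text \<open>The factor \<open>c\<close> is a common denominator and may depend on \<open>N\<close>.
  For prime \<open>I\<close>, multiplication by it is injective modulo \<open>I\<close>, so the
  dimension of the space of functions of degree at most \<open>N\<close> is bounded by a polynomial
  in \<open>N\<close> of degree \<open>\<tau>\<close>. This replaces the statement that the
  transcendence degree is at most \<open>\<tau>\<close>.\<close>

definition growth_le :: "'v set \<Rightarrow> ('v, 'k::field) mpoly set \<Rightarrow> 'v set \<Rightarrow> nat \<Rightarrow> bool" where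
  "growth_le V I W \<tau> \<longleftrightarrow> (\<exists>C. \<forall>N. \<exists>c S. c \<notin> I \<and> finite S \<and> card S \<le> C * (N + 1) ^ \<tau> \<and>
     (\<forall>g\<in>polys_in W. deg_le V N g \<longrightarrow> c * g \<in> spans_mod I S))"

locale prime_ideal_mpoly = prime_ideal_set I
  for I :: "('v, 'k::field) mpoly set"
begin

lemma mconst_notin: "a \<noteq> 0 \<Longrightarrow> mconst a \<notin> I"
proof
  assume "a \<noteq> 0" "mconst a \<in> I"
  then have "mconst (inverse a) * mconst a \<in> I" by (intro mult_left)
  then show False using \<open>a \<noteq> 0\<close> one by (simp flip: mconst_mult)
qed

lemma spans_mod_add: "a \<in> spans_mod I S \<Longrightarrow> b \<in> spans_mod I S \<Longrightarrow> a + b \<in> spans_mod I S"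
proof -
  assume "a \<in> spans_mod I S" "b \<in> spans_mod I S"
  then obtain l k where "a - (\<Sum>s\<in>S. mconst (l s) * s) \<in> I" "b - (\<Sum>s\<in>S. mconst (k s) * s) \<in> I"
    by (auto simp: spans_mod_def)
  then have "(a - (\<Sum>s\<in>S. mconst (l s) * s)) + (b - (\<Sum>s\<in>S. mconst (k s) * s)) \<in> I" by (rule add)
  also have "(a - (\<Sum>s\<in>S. mconst (l s) * s)) + (b - (\<Sum>s\<in>S. mconst (k s) * s)) =
    a + b - (\<Sum>s\<in>S. mconst (l s + k s) * s)"
    by (simp add: mconst_add algebra_simps sum.distrib)
  finally show ?thesis unfolding spans_mod_def by (intro CollectI exI[of _ "\<lambda>s. l s + k s"])
qed

lemma spans_mod_ideal: "a \<in> I \<Longrightarrow> a \<in> spans_mod I S"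
  unfolding spans_mod_def by (intro CollectI exI[of _ "\<lambda>_. 0"]) simp

lemma spans_mod_sum: "(\<And>x. x \<in> A \<Longrightarrow> f x \<in> spans_mod I S) \<Longrightarrow> sum f A \<in> spans_mod I S"
  by (induction A rule: infinite_finite_induct) (auto intro: spans_mod_add spans_mod_ideal zero)

lemma spans_mod_base: "finite S \<Longrightarrow> s \<in> S \<Longrightarrow> mconst a * s \<in> spans_mod I S"
  unfolding spans_mod_def 
  by (intro CollectI exI[of _ "\<lambda>t. if t = s then a else 0"])
    (simp add: if_distrib[of mconst] if_distrib[of "\<lambda>x. x * _"] sum.delta zero cong: if_cong)

text \<open>The monomials with all exponents at most \<open>N\<close> already span; no relation
  modulo \<open>I\<close> is used.\<close>

lemma growth_le_trivial:
  assumes "finite V" "W \<subseteq> V"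
  shows "growth_le V I W (card W)"
  unfolding growth_le_def
proof (rule exI[of _ 1], rule allI)
  fix N :: nat
  have fW: "finite W" using assms finite_subset by blast
  let ?B = "PiE W (\<lambda>_. {..N})"
  define mo :: "('v \<Rightarrow> nat) \<Rightarrow> ('v, 'k) mpoly" where "mo u = (\<Prod>v\<in>W. mvar v ^ u v)" for u
  have fin: "finite ?B" using fW by (intro finite_PiE) auto
  have "card (mo ` ?B) \<le> (N + 1) ^ card W"
    using card_image_le[OF fin, of mo] fW by (simp add: card_PiE)
  moreover have "1 * g \<in> spans_mod I (mo ` ?B)" if g: "g \<in> polys_in W" "deg_le V N g" for g
  proof -
    have "Poly_Mapping.single m (Poly_Mapping.lookup g m) \<in> spans_mod I (mo ` ?B)"
      if m: "m \<in> Poly_Mapping.keys g" for m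
    proof -
      let ?u = "restrict (Poly_Mapping.lookup m) W"
      have mW: "Poly_Mapping.keys m \<subseteq> W" using g(1) m by (rule polys_inD)
      have "mo ?u = (\<Prod>v\<in>W. Poly_Mapping.single (Poly_Mapping.single v (Poly_Mapping.lookup m v)) 1)"
        by (simp add: mo_def mvar_power)
      also have "\<dots> = Poly_Mapping.single (\<Sum>v\<in>W. Poly_Mapping.single v (Poly_Mapping.lookup m v)) 1"
        using fW by (induction W rule: finite_induct) (auto simp: mult_single)
      also have "(\<Sum>v\<in>W. Poly_Mapping.single v (Poly_Mapping.lookup m v)) = m"
        using mW fW by (intro poly_mapping_eqI)
          (auto simp: lookup_sum lookup_single when_def sum.delta in_keys_iff subset_eq)
      finally have eq: "Poly_Mapping.single m (Poly_Mapping.lookup g m) = mconst (Poly_Mapping.lookup g m) * mo ?u"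
        by (simp only: mconst_def mult_single add_0 mult_1_right)
      have "Poly_Mapping.lookup m v \<le> N" if "v \<in> W" for v
        using g(2) m member_le_sum[of v V "Poly_Mapping.lookup m"] that assms
        by (auto simp: deg_le_def intro: le_trans)
      then have "?u \<in> ?B" by auto
      then show ?thesis unfolding eq by (intro spans_mod_base) (use fin in auto)
    qed
    then have "(\<Sum>m\<in>Poly_Mapping.keys g. Poly_Mapping.single m (Poly_Mapping.lookup g m)) \<in> spans_mod I (mo ` ?B)"
      by (rule spans_mod_sum)
    then show ?thesis by (simp flip: mpoly_decomp)
  qed
  ultimately show "\<exists>c S. c \<notin> I \<and> finite S \<and> card S \<le> 1 * (N + 1) ^ card W \<and>
     (\<forall>g\<in>polys_in W. deg_le V N g \<longrightarrow> c * g \<in> spans_mod I S)"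
    using one fin by (intro exI[of _ 1] exI[of _ "mo ` ?B"]) auto
qed

end

text \<open>The relation \<open>r\<close> is the minimal polynomial of \<open>v\<close> over the
  fraction field of the polynomials in \<open>W\<close> modulo \<open>I\<close>, with denominators
  cleared. Minimality concerns leading coefficients, because a coefficient in \<open>I\<close>
  counts as zero.\<close>

locale elimination = prime_ideal_mpoly I
  for I :: "('v, 'k::field) mpoly set" +
  fixes W :: "'v set" and v :: 'v and r :: "nat \<Rightarrow> ('v, 'k) mpoly" and e :: nat
  assumes r: "\<And>i. r i \<in> polys_in W"
    and rel: "(\<Sum>i<Suc e. r i * mvar v ^ i) \<in> I"
    and lead: "r e \<notin> I"
    and minimal: "\<And>n s. n < e \<Longrightarrow> (\<And>i. s i \<in> polys_in W) \<Longrightarrow> (\<Sum>i<Suc n. s i * mvar v ^ i) \<in> I \<Longrightarrow> s n \<in> I"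
begin

lemma low_degree:
  assumes "\<And>i. s i \<in> polys_in W" "(\<Sum>i<n. s i * mvar v ^ i) \<in> I" "n \<le> e" "i < n"
  shows "s i \<in> I"
  using assms(2-4)
proof (induction n)
  case (Suc n)
  have sn: "s n \<in> I" by (rule minimal[of n s]) (use Suc.prems assms(1) in auto)
  show ?case
  proof (cases "i = n")
    case False
    have "(\<Sum>i<n. s i * mvar v ^ i) \<in> I"
      using Suc.prems(1) mult_right[OF sn, of "mvar v ^ n"] by (simp add: add_iff)
    then show ?thesis using Suc False by auto
  qed (use sn in simp)
qed auto

text \<open>Pseudo-division: subtracting a multiple of the minimal relation from \<open>r e\<close>
  times the given one lowers the degree in \<open>v\<close>, and \<open>r e\<close> is cancelled at
  the end because \<open>I\<close> is prime. Below degree \<open>e\<close> all coefficients lie in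
  \<open>I\<close>, where the assumption on \<open>W\<close> applies.\<close>

lemma derivation_preserves_aux:
  assumes D: "derivation D" "D (\<Sum>i<Suc e. r i * mvar v ^ i) \<in> I"
    and W: "\<And>f. f \<in> I \<Longrightarrow> f \<in> polys_in W \<Longrightarrow> D f \<in> I"
    and s: "\<And>i. s i \<in> polys_in W" "(\<Sum>i<n. s i * mvar v ^ i) \<in> I"
  shows "D (\<Sum>i<n. s i * mvar v ^ i) \<in> I"
  using s
proof (induction n arbitrary: s)
  case 0
  then show ?case by (simp add: derivation_0[OF D(1)] zero)
next
  case (Suc n)
  let ?x = "mvar v :: ('v, 'k) mpoly"
  let ?f = "\<Sum>i<Suc e. r i * ?x ^ i" and ?g = "\<Sum>i<Suc n. s i * ?x ^ i"
  show ?case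
  proof (cases "Suc n \<le> e")
    case True
    have "s i \<in> I" if "i < Suc n" for i
      using low_degree[OF Suc.prems(1,2) True that] .
    then have "D (s i * ?x ^ i) \<in> I" if "i < Suc n" for i
      unfolding derivation_mult[OF D(1)] using that
      by (intro add mult_right W Suc.prems) auto
    then show ?thesis unfolding derivation_sum[OF D(1)] by (intro sum) auto
  next
    case False
    then have en: "e \<le> n" by simp
    define a where "a = s n * ?x ^ (n - e)"
    \<comment> \<open>Coefficients of the pseudo-remainder; the shift by \<open>n - e\<close> aligns
      the two leading terms, so that \<open>s' n\<close> is zero.\<close>
    define s' where "s' i = r e * s i - (if n - e \<le> i then s n * r (i - (n - e)) else 0)" for i
    have "a * ?f = (\<Sum>i<Suc e. s n * r i * ?x ^ (i + (n - e)))"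
      by (simp add: a_def sum_distrib_left power_add algebra_simps del: sum.lessThan_Suc)
    also have "\<dots> = (\<Sum>i\<in>{n - e..<Suc n}. s n * r (i - (n - e)) * ?x ^ i)"
      by (rule sum.reindex_bij_witness[of _ "\<lambda>i. i - (n - e)" "\<lambda>i. i + (n - e)"]) (use en in auto)
    also have "\<dots> = (\<Sum>i<Suc n. (if n - e \<le> i then s n * r (i - (n - e)) else 0) * ?x ^ i)"
      by (rule sum.mono_neutral_cong_left) auto
    finally have "r e * ?g - a * ?f = (\<Sum>i<Suc n. s' i * ?x ^ i)"
      by (simp add: s'_def left_diff_distrib sum_subtractf sum_distrib_left mult.assoc del: sum.lessThan_Suc)
    moreover have "s' n = 0" using en by (simp add: s'_def mult.commute)
    ultimately have eq: "r e * ?g - a * ?f = (\<Sum>i<n. s' i * ?x ^ i)" by simp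
    have "s' i \<in> polys_in W" for i
      unfolding s'_def using r Suc.prems by (intro polys_in_diff polys_in_mult) (auto intro: polys_in_mult)
    moreover have "r e * ?g - a * ?f \<in> I"
      using rel Suc.prems(2) by (intro diff mult_left)
    ultimately have "D (r e * ?g - a * ?f) \<in> I"
      unfolding eq by (intro Suc.IH) auto
    also have "D (r e * ?g - a * ?f) = r e * D ?g + (D (r e) * ?g - (D a * ?f + a * D ?f))"
      by (simp only: derivation_diff[OF D(1)] derivation_mult[OF D(1)]) (simp only: algebra_simps)
    finally have "r e * D ?g \<in> I"
      using rel Suc.prems(2) D(2)
      by (subst (asm) add_iff) (intro diff add mult_left mult_left[THEN mult_right], auto)
    then show ?thesis using prime lead by blast
  qed
qed

lemma derivation_preserves:
  assumes D: "derivation D" "D (\<Sum>i<Suc e. r i * mvar v ^ i) \<in> I"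
    and W: "\<And>f. f \<in> I \<Longrightarrow> f \<in> polys_in W \<Longrightarrow> D f \<in> I"
    and f: "f \<in> I" "f \<in> polys_in (insert v W)"
  shows "D f \<in> I"
proof -
  obtain N where N: "deg_le {v} N f" using deg_le_exists by blast
  obtain s where "\<And>i. s i \<in> polys_in W" "f = (\<Sum>i<Suc N. s i * mvar v ^ i)"
    using mpoly_expand[OF f(2) N] by (metis finite.emptyI finite_insert insertI1)
  then show ?thesis using derivation_preserves_aux[OF D W, of s "Suc N"] f(1) by auto
qed

text \<open>Horner scheme with pseudo-division: each of the \<open>n\<close> steps multiplies by
  \<open>v\<close> and by \<open>r e\<close> and replaces the resulting power \<open>v ^ e\<close>
  by lower ones, at a cost of \<open>A\<close> in degree.\<close>

lemma reduce:
  assumes A: "\<And>i. i \<le> e \<Longrightarrow> deg_le V A (r i)"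
    and s: "\<And>i. s i \<in> polys_in W" "\<And>i. deg_le V \<delta> (s i)"
  shows "\<exists>w. (\<forall>j. w j \<in> polys_in W \<and> deg_le V (\<delta> + n * A) (w j)) \<and>
    r e ^ n * (\<Sum>i<n. s i * mvar v ^ i) - (\<Sum>j<e. w j * mvar v ^ j) \<in> I"
  using s
proof (induction n arbitrary: s)
  case 0
  then show ?case by (intro exI[of _ "\<lambda>_. 0"]) (simp add: zero)
next
  case (Suc n)
  let ?x = "mvar v :: ('v, 'k) mpoly"
  have "e \<noteq> 0" using rel lead by (cases e) auto
  then obtain d where d: "e = Suc d" by (cases e) auto
  define g where "g = (\<Sum>i<n. s (Suc i) * ?x ^ i)"
  obtain w where w: "\<And>j. w j \<in> polys_in W" "\<And>j. deg_le V (\<delta> + n * A) (w j)"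
    "r e ^ n * g - (\<Sum>j<e. w j * ?x ^ j) \<in> I"
    using Suc.IH[of "\<lambda>i. s (Suc i)"] Suc.prems unfolding g_def by auto
  define r' where "r' j = (if j < e then r j else 0)" for j
  \<comment> \<open>Multiplying the previous remainder by \<open>r e * ?x\<close> produces the term
    \<open>r e * w d * ?x ^ e\<close>; the relation turns it into \<open>- w d * r j\<close> in the
    degrees \<open>j < e\<close>.\<close>
  define w' where "w' j = (case j of 0 \<Rightarrow> r e ^ Suc n * s 0 | Suc i \<Rightarrow> r e * w i) - w d * r' j" for j
  have r': "r' j \<in> polys_in W" "deg_le V A (r' j)" for j
    using A r by (auto simp: r'_def)
  have 1: "deg_le V (A + (\<delta> + n * A)) (r e * w i)" for i
    using A w by (intro deg_le_mult) auto
  have 2: "deg_le V (A + (\<delta> + n * A)) (w d * r' j)" for j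
    using deg_le_mult[OF w(2)[of d] r'(2)[of j]] by (simp add: add_ac)
  have 3: "deg_le V (A + (\<delta> + n * A)) (r e ^ Suc n * s 0)"
    using deg_le_mult[OF deg_le_power[of V A "r e" "Suc n"] Suc.prems(2)[of 0]] A[of e] by (simp add: add_ac)
  have w'1: "deg_le V (\<delta> + Suc n * A) (w' j)" for j
    using deg_le_diff[OF 1 2] deg_le_diff[OF 3 2] by (auto simp: w'_def add_ac split: nat.split)
  have w'2: "w' j \<in> polys_in W" for j
    unfolding w'_def using r r' w(1) Suc.prems(1)
    by (intro polys_in_diff polys_in_mult)
      (auto split: nat.split intro!: polys_in_mult polys_in_power simp del: power_Suc)
  have g: "(\<Sum>i<Suc n. s i * ?x ^ i) = s 0 + ?x * g"
    unfolding sum.lessThan_Suc_shift g_def by (simp add: sum_distrib_left mult_ac)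
  have rel': "(\<Sum>j<e. r j * ?x ^ j) = (\<Sum>i<Suc e. r i * ?x ^ i) - r e * ?x ^ e" by simp
  have "(\<Sum>j<e. w' j * ?x ^ j) =
      (\<Sum>j<e. (case j of 0 \<Rightarrow> r e ^ Suc n * s 0 | Suc i \<Rightarrow> r e * w i) * ?x ^ j) - w d * (\<Sum>j<e. r j * ?x ^ j)"
    by (simp add: w'_def r'_def left_diff_distrib sum_subtractf sum_distrib_left mult.assoc)
  also have "(\<Sum>j<e. (case j of 0 \<Rightarrow> r e ^ Suc n * s 0 | Suc i \<Rightarrow> r e * w i) * ?x ^ j) =
      r e ^ Suc n * s 0 + (\<Sum>i<d. r e * w i * ?x ^ Suc i)"
    unfolding d sum.lessThan_Suc_shift by simp
  also have "(\<Sum>i<d. r e * w i * ?x ^ Suc i) = r e * ?x * (\<Sum>i<e. w i * ?x ^ i) - r e * w d * ?x ^ e"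
    unfolding d by (simp add: sum_distrib_left algebra_simps)
  finally have "r e ^ Suc n * (\<Sum>i<Suc n. s i * ?x ^ i) - (\<Sum>j<e. w' j * ?x ^ j) =
     r e * ?x * (r e ^ n * g - (\<Sum>j<e. w j * ?x ^ j)) + w d * (\<Sum>i<Suc e. r i * ?x ^ i)"
    unfolding g rel' by (simp add: algebra_simps del: sum.lessThan_Suc)
  also have "\<dots> \<in> I" using w(3) rel by (intro add mult_left)
  finally show ?case using w'1 w'2 by (intro exI[of _ w']) auto
qed

text \<open>An algebraic variable does not raise the exponent: multiplication by
  \<open>r e ^ Suc N\<close> leaves only powers of \<open>v\<close> below \<open>e\<close>, so the
  spanning set for \<open>W\<close>, taken at a degree linear in \<open>N\<close>, is merely copied
  \<open>e\<close> times.\<close>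

lemma growth_step:
  assumes V: "finite V" "v \<in> V" and W: "growth_le V I W \<tau>"
  shows "growth_le V I (insert v W) \<tau>"
proof -
  obtain C where C: "\<And>N. \<exists>c S. c \<notin> I \<and> finite S \<and> card S \<le> C * (N + 1) ^ \<tau> \<and>
     (\<forall>g\<in>polys_in W. deg_le V N g \<longrightarrow> c * g \<in> spans_mod I S)"
    using W unfolding growth_le_def by blast
  have "\<forall>i. \<exists>N. deg_le V N (r i)" using deg_le_exists by blast
  then obtain a where a: "\<And>i. deg_le V (a i) (r i)" by metis
  define A where "A = (\<Sum>i\<le>e. a i)"
  have A: "deg_le V A (r i)" if "i \<le> e" for i
    using a[of i] that by (rule_tac deg_le_mono[OF a]) (auto simp: A_def intro!: member_le_sum)
  let ?x = "mvar v :: ('v, 'k) mpoly"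
  show ?thesis unfolding growth_le_def
  proof (intro exI[of _ "C * (A + 1) ^ \<tau> * e"] allI)
    fix N
    \<comment> \<open>The degree after \<open>Suc N\<close> reduction steps. As
      \<open>M + 1 = (A + 1) * (N + 1)\<close>, the change of degree only affects the
      constant.\<close>
    define M where "M = N + Suc N * A"
    obtain c S where cS: "c \<notin> I" "finite S" "card S \<le> C * (M + 1) ^ \<tau>"
      "\<And>g. g \<in> polys_in W \<Longrightarrow> deg_le V M g \<Longrightarrow> c * g \<in> spans_mod I S"
      using C[of M] by blast
    define S' where "S' = (\<lambda>(s, j). s * ?x ^ j) ` (S \<times> {..<e})"
    have fS': "finite S'" using cS by (simp add: S'_def)
    have "M + 1 = (A + 1) * (N + 1)" by (simp add: M_def algebra_simps)
    then have "card S * e \<le> C * ((A + 1) * (N + 1)) ^ \<tau> * e"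
      using mult_right_mono[OF cS(3), of e] by simp
    moreover have "card S' \<le> card S * e"
      using card_image_le[of "S \<times> {..<e}" "\<lambda>(s, j). s * ?x ^ j"] cS(2)
      unfolding S'_def by (simp add: card_cartesian_product)
    ultimately have "card S' \<le> C * (A + 1) ^ \<tau> * e * (N + 1) ^ \<tau>"
      unfolding power_mult_distrib by (simp only: mult_ac)
    moreover have "c * r e ^ Suc N \<notin> I"
      using cS(1) lead prime power by blast
    moreover have "c * r e ^ Suc N * g \<in> spans_mod I S'" if g: "g \<in> polys_in (insert v W)" "deg_le V N g" for g
    proof -
      obtain s where s: "\<And>i. s i \<in> polys_in W" "\<And>i. deg_le V N (s i)" "g = (\<Sum>i<Suc N. s i * ?x ^ i)"
        using mpoly_expand[OF g V] by blast
      obtain w where w: "\<And>j. w j \<in> polys_in W" "\<And>j. deg_le V M (w j)"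
         "r e ^ Suc N * g - (\<Sum>j<e. w j * ?x ^ j) \<in> I"
        using reduce[of V A s N "Suc N"] A s(1,2) unfolding s(3) M_def by blast
      have cw: "c * w j * ?x ^ j \<in> spans_mod I S'" if j: "j < e" for j
      proof -
        obtain l where l: "c * w j - (\<Sum>s\<in>S. mconst (l s) * s) \<in> I"
          using cS(4)[OF w(1,2)] unfolding spans_mod_def by blast
        have "(c * w j - (\<Sum>s\<in>S. mconst (l s) * s)) * ?x ^ j + (\<Sum>s\<in>S. mconst (l s) * (s * ?x ^ j)) \<in> spans_mod I S'"
          using mult_right[OF l] j fS'
          by (intro spans_mod_add spans_mod_sum spans_mod_ideal spans_mod_base) (auto simp: S'_def)
        then show ?thesis by (simp add: algebra_simps sum_distrib_left)
      qed
      have "c * (r e ^ Suc N * g - (\<Sum>j<e. w j * ?x ^ j)) + (\<Sum>j<e. c * w j * ?x ^ j) \<in> spans_mod I S'"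
        by (rule spans_mod_add[OF spans_mod_ideal[OF mult_left[OF w(3)]] spans_mod_sum]) (use cw in auto)
      then show ?thesis by (simp add: algebra_simps sum_distrib_left)
    qed
    ultimately show "\<exists>c S. c \<notin> I \<and> finite S \<and> card S \<le> C * (A + 1) ^ \<tau> * e * (N + 1) ^ \<tau> \<and>
       (\<forall>g\<in>polys_in (insert v W). deg_le V N g \<longrightarrow> c * g \<in> spans_mod I S)"
      using fS' by blast
  qed
qed

end

section \<open>Separating variables and fields obtained by implicit differentiation\<close>

context prime_ideal_mpoly
begin

text \<open>Take a nonzero element of least degree of \<open>I\<close> in the variables
  \<open>W\<close>. If no derivative leaves \<open>I\<close>, minimality makes all its derivatives
  zero. In characteristic zero it would be a constant; in characteristic \<open>p\<close> it is the
  \<open>p\<close>-th power of a polynomial of smaller degree, which lies in \<open>I\<close> by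
  primality.\<close>

lemma separating_variable:
  assumes perf: "perfect_subfield (UNIV :: 'k set)" and V: "finite V" "W \<subseteq> V"
    and f0: "f0 \<in> I" "f0 \<in> polys_in W" "f0 \<noteq> 0"
  obtains v f where "v \<in> W" "f \<in> I" "f \<in> polys_in W" "mderiv v f \<notin> I"
proof (rule ccontr)
  assume "\<not> thesis"
  then have all: "mderiv v f \<in> I" if "v \<in> W" "f \<in> I" "f \<in> polys_in W" for v f
    using that \<open>\<And>v f. v \<in> W \<Longrightarrow> f \<in> I \<Longrightarrow> f \<in> polys_in W \<Longrightarrow> mderiv v f \<notin> I \<Longrightarrow> thesis\<close> by blast
  let ?P = "\<lambda>N. \<exists>f. f \<in> I \<and> f \<in> polys_in W \<and> f \<noteq> 0 \<and> deg_le V N f"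
  define N where "N = (LEAST N. ?P N)"
  have "\<exists>N. ?P N" using f0 deg_le_exists by blast
  then have "?P N" unfolding N_def by (rule LeastI_ex)
  then obtain f where f: "f \<in> I" "f \<in> polys_in W" "f \<noteq> 0" "deg_le V N f" by blast
  have min: "\<not> ?P M" if "M < N" for M using that not_less_Least unfolding N_def by blast
  have ex: "\<exists>m\<in>Poly_Mapping.keys f. \<exists>v\<in>W. Poly_Mapping.lookup m v > 0"
  proof (rule ccontr)
    assume neg: "\<not> ?thesis"
    have "Poly_Mapping.keys f \<subseteq> {0}"
    proof
      fix m assume m: "m \<in> Poly_Mapping.keys f"
      have "Poly_Mapping.lookup m v = 0" for v
        using neg m polys_inD[OF f(2) m] by (cases "v \<in> W") (auto simp: in_keys_iff subset_eq)
      then have "m = 0" by (intro poly_mapping_eqI) simp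
      then show "m \<in> {0}" by simp
    qed
    then have "f = mconst (Poly_Mapping.lookup f 0)"
      unfolding mconst_def
      by (intro poly_mapping_eqI) (auto simp: lookup_single when_def in_keys_iff)
    moreover from this have "Poly_Mapping.lookup f 0 \<noteq> 0" using f(3) by auto
    ultimately show False using mconst_notin f(1) by metis
  qed
  have Npos: "N > 0"
  proof -
    obtain m v where m: "m \<in> Poly_Mapping.keys f" "v \<in> W" "Poly_Mapping.lookup m v > 0" using ex by blast
    then have "Poly_Mapping.lookup m v \<le> (\<Sum>v\<in>V. Poly_Mapping.lookup m v)"
      using V by (intro member_le_sum) auto
    then show ?thesis using m f(4) unfolding deg_le_def by fastforce
  qed
  have zero_deriv: "mderiv v f = 0" if v: "v \<in> W" for v
  proof (rule ccontr)
    assume "mderiv v f \<noteq> 0"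
    moreover have "deg_le V (N - 1) (mderiv v f)" using f(4) v V by (intro deg_le_mderiv) auto
    ultimately show False using all[OF v f(1,2)] polys_in_mderiv[OF f(2)] min[of "N - 1"] Npos by auto
  qed
  show False
  proof (cases "\<forall>n::nat. n > 0 \<longrightarrow> (of_nat n :: 'k) \<noteq> 0")
    case True
    obtain m v where m: "m \<in> Poly_Mapping.keys f" "v \<in> W" "Poly_Mapping.lookup m v > 0" using ex by blast
    define n where "n = m - Poly_Mapping.single v 1"
    have mn: "m = n + Poly_Mapping.single v 1"
      using m by (intro poly_mapping_eqI) (auto simp: n_def lookup_add lookup_minus lookup_single when_def)
    have "Poly_Mapping.lookup (mderiv v f) n = 0" using zero_deriv m by simp
    moreover have "(of_nat (Poly_Mapping.lookup n v + 1) :: 'k) \<noteq> 0" by (rule True[rule_format]) simp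
    ultimately show False
      using m(1) unfolding lookup_mderiv mn[symmetric] by (simp add: in_keys_iff del: of_nat_add)
  next
    case False
    then obtain p where p: "prime p" "of_nat p = (0::'k)" "\<And>a::'k. \<exists>b. b ^ p = a"
      using perf unfolding perfect_subfield_def by auto
    obtain g where g: "g \<in> polys_in W" "g ^ p = f" "deg_le V (N div p) g"
      using mpoly_pth_root[OF f(2) zero_deriv p f(4) V] by blast
    have "g \<in> I" using g(2) f(1) power by blast
    moreover have "g \<noteq> 0" using g(2) f(3) p(1) by (auto simp: power_0_left)
    moreover have "N div p < N" using Npos p(1) prime_gt_1_nat by (intro div_less_dividend) auto
    ultimately show False using g min by blast
  qed
qed

text \<open>If all coefficients of \<open>f\<close> as a polynomial in \<open>v\<close> were in
  \<open>I\<close>, so would be its derivative. Hence some relation has its leading coefficient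
  outside \<open>I\<close>, and one of least degree is taken.\<close>

lemma exists_elimination:
  assumes v: "v \<in> W" and f: "f \<in> I" "f \<in> polys_in W" "mderiv v f \<notin> I"
  obtains r e where "elimination I (W - {v}) v r e"
proof -
  let ?W = "W - {v}"
  let ?Q = "\<lambda>e. \<exists>r. (\<forall>i. r i \<in> polys_in ?W) \<and> (\<Sum>i<Suc e. r i * mvar v ^ i) \<in> I \<and> r e \<notin> I"
  have ins: "insert v ?W = W" using v by auto
  obtain N where N: "deg_le {v} N f" using deg_le_exists by blast
  obtain s where s: "\<And>i. s i \<in> polys_in ?W" "f = (\<Sum>i<Suc N. s i * mvar v ^ i)"
    using mpoly_expand[of f v ?W "{v}" N] f(2) N unfolding ins by auto
  have "\<exists>i<Suc N. s i \<notin> I"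
  proof (rule ccontr)
    assume "\<not> ?thesis"
    then have "mderiv v (s i * mvar v ^ i) \<in> I" if "i < Suc N" for i
      using that mderiv_polys_in_eq_0[OF s(1), of v i]
      by (auto simp: mderiv_mult intro: mult_right)
    then have "(\<Sum>i<Suc N. mderiv v (s i * mvar v ^ i)) \<in> I" by (intro sum) blast
    then show False using f(3) unfolding s(2) mderiv_sum by blast
  qed
  have "\<exists>e. ?Q e" if "(\<Sum>i<n. s i * mvar v ^ i) \<in> I" "\<exists>i<n. s i \<notin> I" for n
    using that
  proof (induction n)
    case (Suc n)
    show ?case
    proof (cases "s n \<in> I")
      case True
      then have "(\<Sum>i<n. s i * mvar v ^ i) \<in> I"
        using Suc.prems(1) mult_right[OF True, of "mvar v ^ n"] by (simp add: add_iff)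
      moreover have "\<exists>i<n. s i \<notin> I" using Suc.prems(2) True less_Suc_eq by auto
      ultimately show ?thesis by (rule Suc.IH)
    qed (use s(1) Suc.prems in blast)
  qed auto
  then have ex: "\<exists>e. ?Q e" using f(1) s(2) \<open>\<exists>i<Suc N. s i \<notin> I\<close> by blast
  define e where "e = (LEAST e. ?Q e)"
  have "?Q e" unfolding e_def using ex by (rule LeastI_ex)
  then obtain r where r: "\<And>i. r i \<in> polys_in ?W" "(\<Sum>i<Suc e. r i * mvar v ^ i) \<in> I" "r e \<notin> I" by blast
  have "elimination I ?W v r e"
  proof (unfold_locales)
    fix n s assume n: "n < e" and s: "\<And>i. s i \<in> polys_in ?W" "(\<Sum>i<Suc n. s i * mvar v ^ i) \<in> I"
    show "s n \<in> I"
    proof (rule ccontr)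
      assume "s n \<notin> I"
      then have "?Q n" using s by blast
      then show False using not_less_Least[of n ?Q] n unfolding e_def by blast
    qed
  qed (use r in auto)
  then show ?thesis by (rule that)
qed

text \<open>\<open>T\<close> is a separating transcendence basis modulo \<open>I\<close>: variables
  are eliminated as long as a relation remains, and each field is extended to the eliminated
  variable by implicit differentiation. The diagonal value \<open>h\<close> is the product of the
  separants \<open>q\<close> met on the way.\<close>

theorem exists_vector_fields:
  assumes perf: "perfect_subfield (UNIV :: 'k set)" and V: "finite V" and W: "W \<subseteq> V"
  shows "\<exists>T h c. T \<subseteq> W \<and> h \<notin> I \<and> (\<forall>t\<in>T. \<forall>u\<in>T. c t u = (if u = t then h else 0)) \<and>
    (\<forall>t\<in>T. \<forall>f\<in>I \<inter> polys_in W. vfield W (c t) f \<in> I) \<and> growth_le V I W (card T)"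
proof -
  have "finite W" using V W by (rule rev_finite_subset)
  then show ?thesis using W
  proof (induction W rule: finite_psubset_induct)
    case (psubset W)
    show ?case
    proof (cases "I \<inter> polys_in W \<subseteq> {0}")
      case True
      then have "vfield W c f \<in> I" if "f \<in> I \<inter> polys_in W" for f c
        using that by (auto simp: vfield_def zero)
      then show ?thesis using one growth_le_trivial[OF V psubset.prems]
        by (intro exI[of _ W] exI[of _ 1] exI[of _ "\<lambda>t u. if u = t then 1 else 0"]) auto
    next
      case False
      then obtain f0 where "f0 \<in> I" "f0 \<in> polys_in W" "f0 \<noteq> 0" by blast
      then obtain v f where v: "v \<in> W" and f: "f \<in> I" "f \<in> polys_in W" "mderiv v f \<notin> I"
        using separating_variable[OF perf V psubset.prems] by blast
      define W' where "W' = W - {v}"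
      have ins: "insert v W' = W" using v by (auto simp: W'_def)
      obtain r e where "elimination I W' v r e"
        using exists_elimination[OF v f] unfolding W'_def by blast
      then interpret elimination I W' v r e .
      define f1 where "f1 = (\<Sum>i<Suc e. r i * mvar v ^ i)"
      define q where "q = mderiv v f1"
      \<comment> \<open>Were \<open>q\<close> in \<open>I\<close>, then \<open>mderiv v\<close>
        would map the minimal relation into \<open>I\<close>, hence all of \<open>I\<close> in the
        variables \<open>W\<close>, contrary to the choice of \<open>f\<close>.\<close>
      have q: "q \<notin> I"
      proof
        assume "q \<in> I"
        have "mderiv v f \<in> I"
        proof (rule derivation_preserves[OF derivation_mderiv])
          show "mderiv v (\<Sum>i<Suc e. r i * mvar v ^ i) \<in> I"
            using \<open>q \<in> I\<close> unfolding q_def f1_def .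
          show "mderiv v g \<in> I" if "g \<in> polys_in W'" for g
            using mderiv_polys_in_eq_0[OF that] zero by (simp add: W'_def)
        qed (use f ins in auto)
        then show False using f(3) by blast
      qed
      have W'1: "W' \<subset> W" using v by (auto simp: W'_def)
      have W'2: "W' \<subseteq> V" using psubset.prems by (auto simp: W'_def)
      obtain T h c' where T: "T \<subseteq> W'" "h \<notin> I"
        and c0: "\<forall>t\<in>T. \<forall>u\<in>T. c' t u = (if u = t then h else 0)"
        and pres0: "\<forall>t\<in>T. \<forall>f\<in>I \<inter> polys_in W'. vfield W' (c' t) f \<in> I"
        and growth: "growth_le V I W' (card T)"
        using psubset.IH[OF W'1 W'2] by (elim exE conjE)
      have c': "c' t u = (if u = t then h else 0)" if "t \<in> T" "u \<in> T" for t u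
        using c0 that by blast
      have pres: "vfield W' (c' t) g \<in> I" if "t \<in> T" "g \<in> I" "g \<in> polys_in W'" for t g
        using pres0 that by blast
      \<comment> \<open>The old field, scaled by \<open>q\<close>, is corrected in direction
        \<open>v\<close> so that it annihilates the minimal relation \<open>f1\<close>.\<close>
      define c where "c t u = (if u = v then - vfield W' (c' t) f1 else q * c' t u)" for t u
      have vf: "vfield W (c t) g = q * vfield W' (c' t) g - vfield W' (c' t) f1 * mderiv v g" for t g
      proof -
        have "vfield W (c t) g = c t v * mderiv v g + (\<Sum>u\<in>W'. c t u * mderiv u g)"
          unfolding vfield_def W'_def using psubset.hyps v by (simp add: sum.remove)
        also have "(\<Sum>u\<in>W'. c t u * mderiv u g) = q * vfield W' (c' t) g"
          unfolding vfield_def sum_distrib_left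
          by (intro sum.cong) (auto simp: c_def W'_def mult.assoc)
        also have "c t v = - vfield W' (c' t) f1" by (simp add: c_def)
        finally show ?thesis by simp
      qed
      have "vfield W (c t) g \<in> I" if t: "t \<in> T" and g: "g \<in> I \<inter> polys_in W" for t g
      proof (rule derivation_preserves[OF derivation_vfield])
        show "vfield W (c t) (\<Sum>i<Suc e. r i * mvar v ^ i) \<in> I"
          unfolding vf f1_def[symmetric] q_def by (simp add: mult.commute zero)
        show "vfield W (c t) g \<in> I" if "g \<in> I" "g \<in> polys_in W'" for g
          unfolding vf using pres[OF t that] mderiv_polys_in_eq_0[OF that(2), of v]
          by (simp add: W'_def mult_left)
      qed (use g ins in auto)
      moreover have "c t u = (if u = t then q * h else 0)" if "t \<in> T" "u \<in> T" for t u
        using c'[OF that] T(1) that by (auto simp: c_def W'_def)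
      moreover have "q * h \<notin> I" using q T(2) prime by blast
      moreover have "growth_le V I W (card T)"
        using growth_step[OF V _ growth] v psubset.prems ins by auto
      ultimately show ?thesis
        using T(1) by (intro exI[of _ T] exI[of _ "q * h"] exI[of _ c]) (auto simp: W'_def)
    qed
  qed
qed

end

section \<open>Chains of prime ideals\<close>

text \<open>A homogeneous system with more unknowns \<open>\<mu> a\<close> than equations
  \<open>s\<close>; each pivot eliminates one of both.\<close>

lemma exists_kernel_vector:
  fixes M :: "'a \<Rightarrow> 's \<Rightarrow> 'k::field"
  assumes "finite S" "finite A" "card S < card A"
  shows "\<exists>\<mu>. (\<exists>a\<in>A. \<mu> a \<noteq> 0) \<and> (\<forall>s\<in>S. (\<Sum>a\<in>A. \<mu> a * M a s) = 0)"
  using assms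
proof (induction S arbitrary: A M rule: finite_induct)
  case empty
  then show ?case by (intro exI[of _ "\<lambda>_. 1"]) (auto simp: card_gt_0_iff)
next
  case (insert s S)
  show ?case
  proof (cases "\<forall>a\<in>A. M a s = 0")
    case True
    then show ?thesis using insert.IH[OF insert.prems(1), of M] insert.prems(2) insert.hyps by auto
  next
    case False
    then obtain b where b: "b \<in> A" "M b s \<noteq> 0" by blast
    define A' where "A' = A - {b}"
    have A': "finite A'" "card S < card A'" "A = insert b A'" "b \<notin> A'"
      using insert b by (auto simp: A'_def)
    define M' where "M' a t = M a t - M a s / M b s * M b t" for a t
    obtain \<nu> where nu: "\<exists>a\<in>A'. \<nu> a \<noteq> 0" "\<And>t. t \<in> S \<Longrightarrow> (\<Sum>a\<in>A'. \<nu> a * M' a t) = 0"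
      using insert.IH[OF A'(1,2), of M'] by blast
    define \<mu> where "\<mu> a = (if a = b then - (\<Sum>a\<in>A'. \<nu> a * (M a s / M b s)) else \<nu> a)" for a
    have eq: "(\<Sum>a\<in>A. \<mu> a * M a t) = (\<Sum>a\<in>A'. \<nu> a * M' a t)" for t
    proof -
      have "(\<Sum>a\<in>A. \<mu> a * M a t) = \<mu> b * M b t + (\<Sum>a\<in>A'. \<mu> a * M a t)"
        using A' by simp
      also have "(\<Sum>a\<in>A'. \<mu> a * M a t) = (\<Sum>a\<in>A'. \<nu> a * M a t)"
        using A'(4) by (intro sum.cong) (auto simp: \<mu>_def)
      finally have "(\<Sum>a\<in>A. \<mu> a * M a t) = \<mu> b * M b t + (\<Sum>a\<in>A'. \<nu> a * M a t)" .
      also have "\<mu> b = - (\<Sum>a\<in>A'. \<nu> a * (M a s / M b s))" by (simp add: \<mu>_def)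
      finally show ?thesis
        by (simp add: M'_def right_diff_distrib sum_subtractf sum_distrib_right mult.assoc)
    qed
    have "M' a s = 0" for a using b by (simp add: M'_def)
    then have "(\<Sum>a\<in>A. \<mu> a * M a t) = 0" if "t \<in> insert s S" for t
      unfolding eq using nu(2) that by auto
    moreover have "\<exists>a\<in>A. \<mu> a \<noteq> 0" using nu(1) A' by (auto simp: \<mu>_def)
    ultimately show ?thesis by blast
  qed
qed

text \<open>If \<open>f\<^sub>i \<in> J\<^sub>i - J\<^sub>i\<^sub>+\<^sub>1\<close> along a descending chain of primes, then the \<open>f\<^sub>i\<close> are algebraically independent
  modulo the last prime: the lowest power of the last \<open>f\<close> can be cancelled.\<close>

lemma chain_independent:
  fixes J :: "nat \<Rightarrow> ('v, 'k::field) mpoly set"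
  assumes J: "\<And>i. i \<le> d \<Longrightarrow> prime_ideal_set (J i)" "\<And>i. i < d \<Longrightarrow> J (Suc i) \<subseteq> J i"
    and f: "\<And>i. i < d \<Longrightarrow> f i \<in> J i" "\<And>i. i < d \<Longrightarrow> f i \<notin> J (Suc i)"
    and n: "n \<le> d"
    and rel: "(\<Sum>a\<in>PiE {..<n} (\<lambda>_. {..N}). mconst (l a) * (\<Prod>i<n. f i ^ a i)) \<in> J n"
    and a: "a \<in> PiE {..<n} (\<lambda>_. {..N::nat})"
  shows "l a = 0"
  using n rel a
proof (induction n arbitrary: l a)
  case 0
  interpret prime_ideal_mpoly "J 0" unfolding prime_ideal_mpoly_def using J by simp
  show ?case using 0 mconst_notin by auto
next
  case (Suc n)
  interpret prime_ideal_mpoly "J (Suc n)" unfolding prime_ideal_mpoly_def using J Suc.prems by simp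
  interpret Jn: prime_ideal_mpoly "J n" unfolding prime_ideal_mpoly_def using J Suc.prems by simp
  let ?P = "PiE {..<n} (\<lambda>_. {..N})"
  define p where "p b = (\<Sum>a\<in>?P. mconst (l (a(n := b))) * (\<Prod>i<n. f i ^ a i))" for b
  have ins: "{..<Suc n} = insert n {..<n}" by auto
  have "(\<Sum>a\<in>PiE {..<Suc n} (\<lambda>_. {..N}). mconst (l a) * (\<Prod>i<Suc n. f i ^ a i)) =
    (\<Sum>(b, a)\<in>{..N} \<times> ?P. mconst (l (a(n := b))) * (\<Prod>i<Suc n. f i ^ (a(n := b)) i))"
    unfolding ins PiE_insert_eq
    by (subst sum.reindex[OF inj_combinator]) (simp_all add: case_prod_unfold o_def)
  also have "\<dots> = (\<Sum>(b, a)\<in>{..N} \<times> ?P. mconst (l (a(n := b))) * (\<Prod>i<n. f i ^ a i) * f n ^ b)"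
    by (intro sum.cong refl) (auto simp: mult.assoc intro!: arg_cong2[of _ _ _ _ "(*)"] prod.cong)
  also have "\<dots> = (\<Sum>b\<le>N. p b * f n ^ b)"
    by (simp add: p_def sum_distrib_right flip: sum.cartesian_product)
  finally have rel': "(\<Sum>b\<le>N. p b * f n ^ b) \<in> J (Suc n)" using Suc.prems by simp
  have zero: "l (a(n := b)) = 0" if "b \<le> N" "a \<in> ?P" for b a
    using that
  proof (induction b arbitrary: a rule: less_induct)
    case (less b)
    have p0: "p b' = 0" if b': "b' < b" for b'
    proof -
      have "b' \<le> N" using b' less.prems(1) by simp
      then have l0: "l (a(n := b')) = 0" if "a \<in> ?P" for a using less.IH[OF b' _ that] by blast
      show ?thesis unfolding p_def by (rule sum.neutral, intro ballI, subst l0) simp_all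
    qed
    have "(\<Sum>b\<le>N. p b * f n ^ b) = (\<Sum>c\<in>{b..N}. p c * f n ^ c)"
      by (rule sum.mono_neutral_right) (auto simp: p0)
    also have "\<dots> = p b * f n ^ b + (\<Sum>c\<in>{Suc b..N}. p c * f n ^ c)"
      using less.prems(1) by (simp add: sum.atLeast_Suc_atMost)
    also have "(\<Sum>c\<in>{Suc b..N}. p c * f n ^ c) = f n ^ b * (f n * (\<Sum>c\<in>{Suc b..N}. p c * f n ^ (c - Suc b)))"
      unfolding sum_distrib_left
    proof (intro sum.cong refl)
      fix c assume "c \<in> {Suc b..N}"
      then have "f n ^ c = f n ^ (b + Suc (c - Suc b))" by (intro arg_cong[of _ _ "(^) (f n)"]) auto
      then show "p c * f n ^ c = f n ^ b * (f n * (p c * f n ^ (c - Suc b)))"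
        by (simp add: power_add mult_ac)
    qed
    finally have "f n ^ b * (p b + f n * (\<Sum>c\<in>{Suc b..N}. p c * f n ^ (c - Suc b))) \<in> J (Suc n)"
      using rel' by (simp add: algebra_simps)
    moreover have "f n ^ b \<notin> J (Suc n)" using f(2)[of n] Suc.prems power by auto
    ultimately have "p b + f n * (\<Sum>c\<in>{Suc b..N}. p c * f n ^ (c - Suc b)) \<in> J (Suc n)"
      using prime by blast
    \<comment> \<open>Passing to the larger ideal \<open>J n\<close>, which contains
      \<open>f n\<close>, leaves only \<open>p b\<close>, a relation in one function fewer.\<close>
    then have "p b + f n * (\<Sum>c\<in>{Suc b..N}. p c * f n ^ (c - Suc b)) \<in> J n"
      using J(2)[of n] Suc.prems(1) by (simp add: subset_eq)
    moreover have "f n * (\<Sum>c\<in>{Suc b..N}. p c * f n ^ (c - Suc b)) \<in> J n"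
      using f(1)[of n] Suc.prems(1) by (intro Jn.mult_right) simp
    ultimately have "p b \<in> J n" using Jn.add_iff by blast
    then show ?case
      unfolding p_def by (intro Suc.IH[of "\<lambda>a. l (a(n := b))"]) (use Suc.prems(1) less.prems(2) in simp_all)
  qed
  have "a = (restrict a {..<n})(n := a n)" "restrict a {..<n} \<in> ?P" "a n \<le> N"
    using Suc.prems(3) by (auto simp: fun_eq_iff PiE_def extensional_def)
  then show ?case using zero by metis
qed

text \<open>There are \<open>(N + 1) ^ d\<close> products of powers up to \<open>N\<close> of the
  functions \<open>f i\<close>, and their degree is linear in \<open>N\<close>. For
  \<open>d > \<tau>\<close> they outnumber the spanning set when \<open>N\<close> is large, and the
  resulting linear relation contradicts \<open>chain_independent\<close>.\<close>

lemma chain_length_le_growth: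
  fixes J :: "nat \<Rightarrow> ('v, 'k::field) mpoly set"
  assumes J: "\<And>i. i \<le> d \<Longrightarrow> prime_ideal_set (J i)" "\<And>i. i < d \<Longrightarrow> J (Suc i) \<subseteq> J i"
    and f: "\<And>i. i < d \<Longrightarrow> f i \<in> J i" "\<And>i. i < d \<Longrightarrow> f i \<notin> J (Suc i)" "\<And>i. i < d \<Longrightarrow> f i \<in> polys_in V"
    and I: "prime_ideal_set I" "I \<subseteq> J d" "growth_le V I V \<tau>"
  shows "d \<le> \<tau>"
proof (rule ccontr)
  assume "\<not> d \<le> \<tau>"
  interpret prime_ideal_mpoly I unfolding prime_ideal_mpoly_def by fact
  have "\<forall>i. \<exists>N. deg_le V N (f i)" using deg_le_exists by blast
  then obtain e where e: "\<And>i. deg_le V (e i) (f i)" by metis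
  define E where "E = (\<Sum>i<d. e i)"
  have E: "deg_le V E (f i)" if "i < d" for i
    using that by (intro deg_le_mono[OF e]) (auto simp: E_def intro!: member_le_sum)
  obtain C where C: "\<And>N. \<exists>c S. c \<notin> I \<and> finite S \<and> card S \<le> C * (N + 1) ^ \<tau> \<and>
     (\<forall>g\<in>polys_in V. deg_le V N g \<longrightarrow> c * g \<in> spans_mod I S)"
    using I(3) unfolding growth_le_def by blast
  \<comment> \<open>Chosen so that \<open>C * ((d * E + 1) * (N + 1)) ^ \<tau>\<close> equals
    \<open>N * (N + 1) ^ \<tau>\<close>, which is less than
    \<open>(N + 1) ^ Suc \<tau>\<close>.\<close>
  define N where "N = C * (d * E + 1) ^ \<tau>"
  define M where "M = d * (N * E)"
  obtain c S where cS: "c \<notin> I" "finite S" "card S \<le> C * (M + 1) ^ \<tau>"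
      "\<And>g. g \<in> polys_in V \<Longrightarrow> deg_le V M g \<Longrightarrow> c * g \<in> spans_mod I S"
    using C[of M] by blast
  define A where "A = PiE {..<d} (\<lambda>_. {..N})"
  define mo where "mo a = (\<Prod>i<d. f i ^ a i)" for a
  have finA: "finite A" unfolding A_def by (intro finite_PiE) auto
  have "card S \<le> C * (M + 1) ^ \<tau>" by fact
  also have "\<dots> \<le> C * ((d * E + 1) * (N + 1)) ^ \<tau>"
    unfolding M_def by (intro mult_left_mono power_mono) (auto simp: algebra_simps)
  also have "\<dots> = N * (N + 1) ^ \<tau>" by (simp only: power_mult_distrib N_def mult.assoc)
  also have "\<dots> < (N + 1) * (N + 1) ^ \<tau>" by simp
  also have "\<dots> = (N + 1) ^ Suc \<tau>" by simp
  also have "\<dots> \<le> (N + 1) ^ d" using \<open>\<not> d \<le> \<tau>\<close> by (intro power_increasing) auto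
  also have "\<dots> = card A" by (simp add: A_def card_PiE)
  finally have card: "card S < card A" .
  have "c * mo a \<in> spans_mod I S" if a: "a \<in> A" for a
  proof (rule cS(4))
    show "mo a \<in> polys_in V" unfolding mo_def using f(3) by (intro polys_in_prod polys_in_power) auto
    have "deg_le V (\<Sum>i<d. a i * E) (mo a)"
      unfolding mo_def using E by (intro deg_le_prod deg_le_power) auto
    moreover have "(\<Sum>i<d. a i * E) \<le> (\<Sum>i<d. N * E)"
      using a by (intro sum_mono mult_right_mono) (auto simp: A_def)
    ultimately show "deg_le V M (mo a)" unfolding M_def by (auto intro: deg_le_mono)
  qed
  then have "\<forall>a\<in>A. \<exists>l. c * mo a - (\<Sum>s\<in>S. mconst (l s) * s) \<in> I" by (auto simp: spans_mod_def)
  then obtain l where l: "\<forall>a\<in>A. c * mo a - (\<Sum>s\<in>S. mconst (l a s) * s) \<in> I"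
    unfolding bchoice_iff by (elim exE)
  obtain \<mu> where mu: "\<exists>a\<in>A. \<mu> a \<noteq> 0" "\<And>s. s \<in> S \<Longrightarrow> (\<Sum>a\<in>A. \<mu> a * l a s) = 0"
    using exists_kernel_vector[OF cS(2) finA card, of l] by blast
  have "(\<Sum>a\<in>A. mconst (\<mu> a) * (\<Sum>s\<in>S. mconst (l a s) * s)) = (\<Sum>s\<in>S. mconst (\<Sum>a\<in>A. \<mu> a * l a s) * s)"
    unfolding mconst_sum mconst_mult sum_distrib_left sum_distrib_right
    by (subst sum.swap) (simp add: mult.assoc)
  also have "\<dots> = 0" using mu(2) by simp
  finally have z: "(\<Sum>a\<in>A. mconst (\<mu> a) * (\<Sum>s\<in>S. mconst (l a s) * s)) = 0" .
  have "(\<Sum>a\<in>A. mconst (\<mu> a) * (c * mo a - (\<Sum>s\<in>S. mconst (l a s) * s))) \<in> I"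
    using bspec[OF l] by (intro sum mult_left)
  also have "(\<Sum>a\<in>A. mconst (\<mu> a) * (c * mo a - (\<Sum>s\<in>S. mconst (l a s) * s))) =
      c * (\<Sum>a\<in>A. mconst (\<mu> a) * mo a)"
    using z by (simp add: right_diff_distrib sum_subtractf sum_distrib_left mult_ac)
  finally have "(\<Sum>a\<in>A. mconst (\<mu> a) * mo a) \<in> J d" using cS(1) prime I(2) by blast
  then have "\<mu> a = 0" if "a \<in> A" for a
    using chain_independent[where J=J and f=f and n=d and l=\<mu> and N=N and d=d and a=a] J f(1,2) that
    unfolding A_def mo_def by blast
  then show False using mu(1) by blast
qed

section \<open>Automorphisms of an algebraic closure\<close>

text \<open>Partial homomorphisms over \<open>F\<close> are represented by their graphs, which are subrings of \<open>K \<times> K\<close>.\<close>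

lemma degree_pos_of_root:
  assumes "p \<noteq> 0" "poly p (z::'k::field) = 0"
  shows "degree p > 0"
proof (rule ccontr)
  assume "\<not> degree p > 0"
  then obtain c where "p = [:c:]" using degree_eq_zeroE[of p] by auto
  then show False using assms by simp
qed

text \<open>Closure under differences turns the last clause into single-valuedness. A graph carries
  its own domain, so the union of a chain of graphs is again one, as Zorn's lemma requires.\<close>

definition hom_graph :: "'k::field set \<Rightarrow> ('k \<times> 'k) set \<Rightarrow> bool" where
  "hom_graph F G \<longleftrightarrow> (\<forall>a\<in>F. (a, a) \<in> G) \<and>
     (\<forall>a b c d. (a, b) \<in> G \<longrightarrow> (c, d) \<in> G \<longrightarrow> (a + c, b + d) \<in> G \<and> (a - c, b - d) \<in> G \<and> (a * c, b * d) \<in> G) \<and>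
     (\<forall>b. (0, b) \<in> G \<longrightarrow> b = 0)"

definition poly_graph :: "('k::field \<times> 'k) set \<Rightarrow> ('k poly \<times> 'k poly) set" where
  "poly_graph G = {(p, q). \<forall>i. (coeff p i, coeff q i) \<in> G}"

text \<open>The candidate extension to the ring generated by \<open>z\<close>, sending
  \<open>z\<close> to \<open>w\<close>. It is single-valued only for suitable
  \<open>w\<close>.\<close>

definition adjoin :: "('k::field \<times> 'k) set \<Rightarrow> 'k \<Rightarrow> 'k \<Rightarrow> ('k \<times> 'k) set" where
  "adjoin G z w = {(poly p z, poly q w) | p q. (p, q) \<in> poly_graph G}"

locale partial_hom =
  fixes F :: "'k::field set" and G :: "('k \<times> 'k) set"
  assumes F: "subfield F" and closure: "is_algebraic_closure_of F" and G: "hom_graph F G"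
begin

lemma F_01: "0 \<in> F" "1 \<in> F"
  using F by (auto simp: subfield_def)

lemma base: "a \<in> F \<Longrightarrow> (a, a) \<in> G"
  and plus: "(a, b) \<in> G \<Longrightarrow> (c, d) \<in> G \<Longrightarrow> (a + c, b + d) \<in> G"
  and minus: "(a, b) \<in> G \<Longrightarrow> (c, d) \<in> G \<Longrightarrow> (a - c, b - d) \<in> G"
  and times: "(a, b) \<in> G \<Longrightarrow> (c, d) \<in> G \<Longrightarrow> (a * c, b * d) \<in> G"
  and zero_left: "(0, b) \<in> G \<Longrightarrow> b = 0"
  using G by (auto simp: hom_graph_def)

lemma zero_in: "(0, 0) \<in> G" 
  using base F_01 by auto

lemma single_valued: "(a, b) \<in> G \<Longrightarrow> (a, b') \<in> G \<Longrightarrow> b = b'"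
  using minus[of a b a b'] zero_left[of "b - b'"] by simp

lemma pair_sum: "(\<And>i. i \<in> A \<Longrightarrow> (f i, g i) \<in> G) \<Longrightarrow> (sum f A, sum g A) \<in> G"
  by (induction A rule: infinite_finite_induct) (auto intro: zero_in plus)

lemma pair_power: "(a, b) \<in> G \<Longrightarrow> (a ^ n, b ^ n) \<in> G"
  by (induction n) (auto intro: times base F_01)

lemma pair_poly: 
  assumes "\<And>i. coeff p i \<in> F" "(a, b) \<in> G"
  shows "(poly p a, poly p b) \<in> G"
  unfolding poly_altdef using assms by (intro pair_sum times pair_power base)

lemma annihilator:
  obtains q where "q \<noteq> 0" "\<And>i. coeff q i \<in> F" "poly q z = 0" 
  using closure unfolding is_algebraic_closure_of_def by metis

text \<open>The domain is only known to be a ring, so injectivity is not automatic. Being algebraic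
  over \<open>F\<close>, a nonzero \<open>a\<close> is a root of a polynomial over \<open>F\<close>
  with nonzero constant term; \<open>b\<close> is a root of it too, which excludes
  \<open>b = 0\<close>.\<close>

lemma nonzero_right:
  assumes ab: "(a, b) \<in> G" "a \<noteq> 0"
  shows "b \<noteq> 0"
proof
  assume "b = 0"
  obtain q where q: "q \<noteq> 0" "\<And>i. coeff q i \<in> F" "poly q a = 0" using annihilator by blast
  have "\<exists>q. coeff q 0 \<noteq> 0 \<and> (\<forall>i. coeff q i \<in> F) \<and> poly q a = 0"
    using q
  proof (induction q)
    case (pCons c q)
    show ?case
    proof (cases "c = 0")
      case True
      have "coeff q i \<in> F" for i using pCons.prems(2)[of "Suc i"] by simp
      then show ?thesis using True pCons.prems ab(2) by (intro pCons.IH) auto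
    qed (use pCons.prems in \<open>auto intro!: exI[of _ "pCons c q"]\<close>)
  qed auto
  then obtain q where q: "coeff q 0 \<noteq> 0" "\<And>i. coeff q i \<in> F" "poly q a = 0" by blast
  have "(poly q a, poly q b) \<in> G" using q ab by (intro pair_poly)
  then have "poly q b = 0" using zero_left q by simp
  then show False using \<open>b = 0\<close> q by (simp add: poly_0_coeff_0)
qed

lemma poly_graph_degree:
  assumes "(p, q) \<in> poly_graph G"
  shows "degree q = degree p"
proof -
  have "coeff p i = 0 \<longleftrightarrow> coeff q i = 0" for i
    using assms nonzero_right zero_left unfolding poly_graph_def
    by (metis (mono_tags, lifting) case_prodD mem_Collect_eq)
  then show ?thesis unfolding degree_def by simp
qed

lemma poly_graph_plus: "(p, q) \<in> poly_graph G \<Longrightarrow> (p', q') \<in> poly_graph G \<Longrightarrow> (p + p', q + q') \<in> poly_graph G"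
  by (auto simp: poly_graph_def intro: plus)

lemma poly_graph_minus: "(p, q) \<in> poly_graph G \<Longrightarrow> (p', q') \<in> poly_graph G \<Longrightarrow> (p - p', q - q') \<in> poly_graph G"
  by (auto simp: poly_graph_def intro: minus)

lemma poly_graph_times: "(p, q) \<in> poly_graph G \<Longrightarrow> (p', q') \<in> poly_graph G \<Longrightarrow> (p * p', q * q') \<in> poly_graph G"
  by (auto simp: poly_graph_def coeff_mult intro!: pair_sum times)

lemma poly_graph_monom: "(a, b) \<in> G \<Longrightarrow> (monom a n, monom b n) \<in> poly_graph G"
  by (auto simp: poly_graph_def intro: zero_in)

lemma poly_graph_F: "(\<And>i. coeff p i \<in> F) \<Longrightarrow> (p, p) \<in> poly_graph G"
  by (auto simp: poly_graph_def intro: base)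

context
  fixes z w p0 q0
  assumes p0: "(p0, q0) \<in> poly_graph G" "p0 \<noteq> 0" "poly p0 z = 0" "poly q0 w = 0"
    and minimal: "\<And>p q. (p, q) \<in> poly_graph G \<Longrightarrow> p \<noteq> 0 \<Longrightarrow> poly p z = 0 \<Longrightarrow> degree p0 \<le> degree p"
begin

text \<open>Pseudo-division by the polynomial \<open>p0\<close> of least degree, carried out in
  parallel on both sides of the graph. Leading coefficients are multiplied across since inverses may
  be missing from the domain, and the one of \<open>q0\<close> is cancelled by
  \<open>nonzero_right\<close>.\<close>

lemma adjoin_well_defined: "(p, q) \<in> poly_graph G \<Longrightarrow> poly p z = 0 \<Longrightarrow> poly q w = 0"
proof (induction "if p = 0 then 0 else Suc (degree p)" arbitrary: p q rule: less_induct)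
  case less
  show ?case
  proof (cases "p = 0")
    case True
    then have "q = 0"
      using less.prems by (intro poly_eqI) (auto simp: poly_graph_def intro: zero_left)
    then show ?thesis by simp
  next
    case False
    define n where "n = degree p"
    define e where "e = degree p0"
    have en: "e \<le> n" using minimal[OF less.prems(1) False less.prems(2)] by (simp add: e_def n_def)
    define p' where "p' = monom (coeff p0 e) 0 * p - monom (coeff p n) (n - e) * p0"
    define q' where "q' = monom (coeff q0 e) 0 * q - monom (coeff q n) (n - e) * q0"
    have co: "(coeff p i, coeff q i) \<in> G" "(coeff p0 i, coeff q0 i) \<in> G" for i
      using less.prems p0 by (auto simp: poly_graph_def)
    have pq': "(p', q') \<in> poly_graph G"
      unfolding p'_def q'_def using p0 less.prems co
      by (intro poly_graph_minus poly_graph_times poly_graph_monom)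
    have "coeff p' i = 0" if "i \<ge> n" for i
    proof (cases "i = n")
      case True
      have "coeff p' n = coeff p0 e * coeff p n - coeff p n * coeff p0 e"
        using en by (simp add: p'_def coeff_monom_mult)
      then show ?thesis using True by (simp add: mult.commute)
    next
      case False
      then have "coeff p i = 0" "coeff p0 (i - (n - e)) = 0"
        using that en by (auto intro!: coeff_eq_0 simp: n_def e_def)
      then show ?thesis by (simp add: p'_def coeff_monom_mult)
    qed
    then have "p' = 0 \<or> degree p' < n"
      using leading_coeff_0_iff not_le by blast
    moreover have "poly p' z = 0" using less.prems p0 by (simp add: p'_def)
    ultimately have "poly q' w = 0"
      using False pq' by (intro less.hyps[of p']) (auto simp: n_def)
    then have "coeff q0 e * poly q w = 0" using p0 by (simp add: q'_def poly_monom)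
    moreover have "coeff q0 e \<noteq> 0"
      using nonzero_right[OF co(2)[of e]] p0 by (simp add: e_def)
    ultimately show ?thesis by simp
  qed
qed

lemma hom_graph_adjoin: "hom_graph F (adjoin G z w)"
  unfolding hom_graph_def
proof (intro conjI allI impI ballI)
  show "(a, a) \<in> adjoin G z w" if "a \<in> F" for a
    unfolding adjoin_def using that poly_graph_monom[OF base, of a 0]
    by (auto intro!: exI[of _ "monom a 0"] simp: poly_monom)
  fix a b c d assume "(a, b) \<in> adjoin G z w" "(c, d) \<in> adjoin G z w"
  then obtain p q p' q' where pq: "(p, q) \<in> poly_graph G" "(p', q') \<in> poly_graph G"
    "a = poly p z" "b = poly q w" "c = poly p' z" "d = poly q' w"
    by (auto simp: adjoin_def)
  show "(a + c, b + d) \<in> adjoin G z w" "(a - c, b - d) \<in> adjoin G z w" "(a * c, b * d) \<in> adjoin G z w"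
    unfolding adjoin_def pq
    using pq(1,2) poly_graph_plus[OF pq(1,2)] poly_graph_minus[OF pq(1,2)] poly_graph_times[OF pq(1,2)]
    by (force simp flip: poly_add poly_diff poly_mult)+
next
  fix b assume "(0, b) \<in> adjoin G z w"
  then show "b = 0" using adjoin_well_defined by (auto simp: adjoin_def)
qed

lemma adjoin_extends: "G \<subseteq> adjoin G z w"
proof clarify
  fix a b assume "(a, b) \<in> G"
  from poly_graph_monom[OF this, of 0] show "(a, b) \<in> adjoin G z w"
    unfolding adjoin_def by (force simp: poly_monom)
qed

lemma adjoin_contains: "(z, w) \<in> adjoin G z w"
proof -
  have "(1, 1) \<in> G" using base F_01 by auto
  from poly_graph_monom[OF this, of 1] show ?thesis
    unfolding adjoin_def by (force simp: poly_monom)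
qed

end

lemma exists_minimal:
  obtains p q where "(p, q) \<in> poly_graph G" "p \<noteq> 0" "poly p z = 0"
    "\<And>p' q'. (p', q') \<in> poly_graph G \<Longrightarrow> p' \<noteq> 0 \<Longrightarrow> poly p' z = 0 \<Longrightarrow> degree p \<le> degree p'"
proof -
  obtain q where q: "q \<noteq> 0" "\<And>i. coeff q i \<in> F" "poly q z = 0" using annihilator by blast
  let ?P = "\<lambda>pq. pq \<in> poly_graph G \<and> fst pq \<noteq> 0 \<and> poly (fst pq) z = 0"
  have "?P (q, q)" using q poly_graph_F by auto
  then obtain pq where pq: "?P pq" "\<And>pq'. ?P pq' \<Longrightarrow> degree (fst pq) \<le> degree (fst pq')"
    using ex_has_least_nat[of ?P "(q, q)" "\<lambda>pq. degree (fst pq)"] by blast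
  show ?thesis
    by (rule that[of "fst pq" "snd pq"]) (use pq in auto)
qed

lemma extend: "\<exists>w. \<exists>G'. hom_graph F G' \<and> G \<subseteq> G' \<and> (z, w) \<in> G'"
proof -
  obtain p q where pq: "(p, q) \<in> poly_graph G" "p \<noteq> 0" "poly p z = 0"
    "\<And>p' q'. (p', q') \<in> poly_graph G \<Longrightarrow> p' \<noteq> 0 \<Longrightarrow> poly p' z = 0 \<Longrightarrow> degree p \<le> degree p'"
    using exists_minimal by blast
  have "degree p > 0" using pq(2,3) by (rule degree_pos_of_root)
  then have "degree q > 0" using poly_graph_degree[OF pq(1)] by simp
  then obtain w where w: "poly q w = 0" using closure unfolding is_algebraic_closure_of_def by blast
  have "hom_graph F (adjoin G z w)"
    by (rule hom_graph_adjoin[OF pq(1-3) w]) (rule pq(4))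
  moreover have "G \<subseteq> adjoin G z w"
    by (rule adjoin_extends[OF pq(1-3) w]) (rule pq(4))
  moreover have "(z, w) \<in> adjoin G z w"
    by (rule adjoin_contains[OF pq(1-3) w]) (rule pq(4))
  ultimately show ?thesis by blast
qed

end

lemma hom_graph_Union_chain:
  assumes "\<C> \<noteq> {}" "\<And>G. G \<in> \<C> \<Longrightarrow> hom_graph F G" and chain: "\<And>G H. G \<in> \<C> \<Longrightarrow> H \<in> \<C> \<Longrightarrow> G \<subseteq> H \<or> H \<subseteq> G"
  shows "hom_graph F (\<Union>\<C>)"
  unfolding hom_graph_def
proof (intro conjI allI impI ballI)
  show "(a, a) \<in> \<Union>\<C>" if "a \<in> F" for a
    using assms(1,2) that unfolding hom_graph_def by blast
  show "b = 0" if "(0, b) \<in> \<Union>\<C>" for b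
    using assms(2) that unfolding hom_graph_def by blast
  fix a b c d assume "(a, b) \<in> \<Union>\<C>" "(c, d) \<in> \<Union>\<C>"
  then obtain G where "G \<in> \<C>" "(a, b) \<in> G" "(c, d) \<in> G"
    using chain by blast
  then have "(a + c, b + d) \<in> G" "(a - c, b - d) \<in> G" "(a * c, b * d) \<in> G"
    using assms(2)[of G] unfolding hom_graph_def by blast+
  then show "(a + c, b + d) \<in> \<Union>\<C>" "(a - c, b - d) \<in> \<Union>\<C>" "(a * c, b * d) \<in> \<Union>\<C>"
    using \<open>G \<in> \<C>\<close> by blast+
qed

definition field_aut :: "'k::field set \<Rightarrow> ('k \<Rightarrow> 'k) \<Rightarrow> bool" where
  "field_aut F \<sigma> \<longleftrightarrow> bij \<sigma> \<and> (\<forall>a b. \<sigma> (a + b) = \<sigma> a + \<sigma> b) \<and> (\<forall>a b. \<sigma> (a * b) = \<sigma> a * \<sigma> b) \<and> (\<forall>a\<in>F. \<sigma> a = a)"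

text \<open>A maximal graph is total by \<open>extend\<close>. The map is onto because it sends the
  finite root set of a polynomial over \<open>F\<close> injectively into itself, and every element
  is such a root.\<close>

lemma hom_graph_to_aut:
  assumes F: "subfield F" "is_algebraic_closure_of F" and G0: "hom_graph F G0"
  obtains \<sigma> where "field_aut F \<sigma>" "\<And>a b. (a, b) \<in> G0 \<Longrightarrow> \<sigma> a = b"
proof -
  let ?\<A> = "{G. hom_graph F G \<and> G0 \<subseteq> G}"
  have "\<exists>M\<in>?\<A>. \<forall>G\<in>?\<A>. M \<subseteq> G \<longrightarrow> G = M"
  proof (rule subset_Zorn_nonempty)
    show "?\<A> \<noteq> {}" using G0 by blast
    fix \<C> assume "\<C> \<noteq> {}" "subset.chain ?\<A> \<C>"
    then show "\<Union>\<C> \<in> ?\<A>"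
      using hom_graph_Union_chain[of \<C> F] unfolding subset.chain_def by blast
  qed
  then obtain M where M0: "M \<in> ?\<A>" "\<forall>G\<in>?\<A>. M \<subseteq> G \<longrightarrow> G = M" by (elim bexE)
  then have M: "hom_graph F M" "G0 \<subseteq> M" by simp_all
  have max: "G = M" if "hom_graph F G" "M \<subseteq> G" for G
    using M0(2) that M(2) by (simp add: subset_trans)
  interpret partial_hom F M using F M by unfold_locales
  have "\<exists>b. (a, b) \<in> M" for a using extend[of a] max by metis
  then obtain \<sigma> where \<sigma>: "\<And>a. (a, \<sigma> a) \<in> M" by metis
  have eq: "\<sigma> a = b" if "(a, b) \<in> M" for a b using that \<sigma> single_valued by blast
  have hom: "\<sigma> (a + b) = \<sigma> a + \<sigma> b" "\<sigma> (a - b) = \<sigma> a - \<sigma> b" "\<sigma> (a * b) = \<sigma> a * \<sigma> b" for a b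
    by (rule eq plus minus times \<sigma>)+
  have inj: "inj \<sigma>"
  proof (rule injI, rule ccontr)
    fix a b assume "\<sigma> a = \<sigma> b" "a \<noteq> b"
    then show False using nonzero_right[OF \<sigma>[of "a - b"]] hom(2)[of a b] by simp
  qed
  have "\<exists>a. \<sigma> a = b" for b
  proof -
    obtain q where q: "q \<noteq> 0" "\<And>i. coeff q i \<in> F" "poly q b = 0" using annihilator by blast
    let ?R = "{a. poly q a = 0}"
    have "poly q (\<sigma> a) = 0" if "poly q a = 0" for a
      using pair_poly[OF q(2) \<sigma>[of a]] that zero_left by simp
    then have "\<sigma> ` ?R \<subseteq> ?R" by auto
    moreover have "finite ?R" using q(1) by (rule poly_roots_finite)
    ultimately have "\<sigma> ` ?R = ?R" using inj by (intro endo_inj_surj) (auto intro: inj_on_subset)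
    moreover have "b \<in> ?R" using q(3) by simp
    ultimately have "b \<in> \<sigma> ` ?R" by simp
    then show ?thesis by blast
  qed
  then have "surj \<sigma>" by (metis surj_def)
  moreover have "\<sigma> a = a" if "a \<in> F" for a using base[OF that] eq by blast
  ultimately have "field_aut F \<sigma>" unfolding field_aut_def bij_def using inj hom by blast
  then show ?thesis using that eq M(2) by blast
qed

text \<open>Since \<open>F\<close> is perfect, the polynomial \<open>p\<close> of least degree
  annihilating \<open>z\<close> has \<open>z\<close> as a simple root. The cofactor \<open>q\<close>
  of the linear factor is not constant, as \<open>z\<close> is not in \<open>F\<close>, so it has a
  root \<open>w\<close> different from \<open>z\<close>, to which \<open>z\<close> can be
  sent.\<close>

lemma exists_aut_moving:
  assumes Fs: "subfield F" "perfect_subfield F" "is_algebraic_closure_of F" and z: "z \<notin> F"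
  obtains \<sigma> where "field_aut F \<sigma>" "\<sigma> z \<noteq> z"
proof -
  define G where "G = {(a, a) | a. a \<in> F}"
  have "hom_graph F G" using Fs(1) unfolding hom_graph_def G_def subfield_def by auto
  then interpret partial_hom F G using Fs by unfold_locales
  have pg: "(p, q) \<in> poly_graph G \<longleftrightarrow> p = q \<and> (\<forall>i. coeff p i \<in> F)" for p q
    by (auto simp: poly_graph_def G_def poly_eq_iff)
  obtain p where p: "\<And>i. coeff p i \<in> F" "p \<noteq> 0" "poly p z = 0"
    "\<And>q. (\<And>i. coeff q i \<in> F) \<Longrightarrow> q \<noteq> 0 \<Longrightarrow> poly q z = 0 \<Longrightarrow> degree p \<le> degree q"
    using exists_minimal[of z] unfolding pg by metis
  have deg: "degree p > 0" using p(2,3) by (rule degree_pos_of_root)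
  have of_nat_F: "of_nat n \<in> F" for n
    using Fs(1) by (induction n) (auto simp: subfield_def)
  have "pderiv p \<noteq> 0"
  proof
    assume pd: "pderiv p = 0"
    have co: "of_nat (Suc i) * coeff p (Suc i) = 0" for i
      using arg_cong[OF pd, of "\<lambda>q. coeff q i"] by (simp add: coeff_pderiv)
    show False
    proof (cases "\<forall>n::nat. n > 0 \<longrightarrow> (of_nat n :: 'a) \<noteq> 0")
      case True
      then have "coeff p (Suc i) = 0" for i using co[of i] by (metis mult_eq_0_iff zero_less_Suc)
      then have "lead_coeff p = 0" using deg by (cases "degree p") auto
      then show False using p(2) by simp
    next
      case False
      then obtain c where c: "prime c" "of_nat c = (0::'a)" "\<And>a. a \<in> F \<Longrightarrow> \<exists>b\<in>F. b ^ c = a"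
        using Fs(2) unfolding perfect_subfield_def by blast
      have CH: "CHAR('a) = c"
      proof -
        have "CHAR('a) dvd c" using c(2) by (simp add: of_nat_eq_0_iff_char_dvd)
        then show ?thesis using c(1) CHAR_not_1'[where 'a='a] by (auto simp: prime_nat_iff)
      qed
      have nz: "coeff p i = 0" if nd: "\<not> c dvd i" for i
      proof -
        obtain j where "i = Suc j" using nd by (cases i) auto
        moreover have "of_nat i \<noteq> (0::'a)" using nd by (simp add: of_nat_eq_0_iff_char_dvd CH)
        ultimately show ?thesis using co[of j] by simp
      qed
      have c0: "c > 0" using c(1) prime_gt_0_nat by blast
      obtain rt where rt: "\<And>a. a \<in> F \<Longrightarrow> rt a \<in> F \<and> rt a ^ c = a" using c(3) by metis
      have rt0: "rt 0 = 0" using rt[of 0] F_01 by simp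
      define m where "m = degree p div c"
      \<comment> \<open>Only exponents divisible by \<open>c\<close> occur in \<open>p\<close>.
        Taking \<open>c\<close>-th roots of its coefficients within \<open>F\<close> gives
        \<open>r\<close> of smaller degree with \<open>poly r z ^ c = poly p z\<close>.\<close>
      define r where "r = (\<Sum>i\<le>m. monom (rt (coeff p (c * i))) i)"
      have coeff_r: "coeff r i = (if i \<le> m then rt (coeff p (c * i)) else 0)" for i
        by (simp add: r_def coeff_sum sum.delta)
      have rF: "coeff r i \<in> F" for i
        using rt p(1) F_01 by (auto simp: coeff_r)
      have dm: "degree p = c * m"
        using nz[of "degree p"] p(2) by (cases "c dvd degree p") (auto simp: m_def)
      have "coeff p (c * m) \<noteq> 0" using p(2) by (simp flip: dm)
      then have "coeff r m \<noteq> 0"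
        using rt[OF p(1)[of "c * m"]] c0 by (auto simp: coeff_r power_0_left)
      then have "r \<noteq> 0" by auto
      have "poly r z ^ c = (\<Sum>i\<le>m. (rt (coeff p (c * i)) * z ^ i) ^ c)"
        unfolding r_def poly_sum poly_monom using freshmans_dream_sum[where 'a='a] c(1) CH by blast
      also have "\<dots> = (\<Sum>i\<le>m. coeff p (c * i) * z ^ (c * i))"
        using rt[OF p(1)] by (simp add: power_mult_distrib mult.commute flip: power_mult)
      also have "\<dots> = (\<Sum>i\<in>(*) c ` {..m}. coeff p i * z ^ i)"
        using c0 by (subst sum.reindex) (auto intro: inj_onI)
      also have "\<dots> = (\<Sum>i\<le>degree p. coeff p i * z ^ i)"
      proof (rule sum.mono_neutral_left)
        show "\<forall>i\<in>{..degree p} - (*) c ` {..m}. coeff p i * z ^ i = 0"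
        proof
          fix i assume i: "i \<in> {..degree p} - (*) c ` {..m}"
          have "\<not> c dvd i"
          proof
            assume "c dvd i"
            then obtain j where "i = c * j" by (rule dvdE)
            then show False using i dm c0 by auto
          qed
          then show "coeff p i * z ^ i = 0" using nz by simp
        qed
      qed (use dm in auto)
      finally have "poly r z = 0" using p(3) c0 by (simp flip: poly_altdef)
      then have "degree p \<le> degree r" using rF \<open>r \<noteq> 0\<close> by (intro p(4))
      also have "\<dots> \<le> m" by (rule degree_le) (simp add: coeff_r)
      also have "m < degree p" unfolding m_def using deg c(1) prime_gt_1_nat by (intro div_less_dividend) auto
      finally show False by simp
    qed
  qed
  moreover have "coeff (pderiv p) i \<in> F" for i
    using p(1) of_nat_F[of "Suc i"] Fs(1) unfolding coeff_pderiv subfield_def by blast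
  moreover have "degree (pderiv p) < degree p"
  proof (rule ccontr)
    assume "\<not> degree (pderiv p) < degree p"
    then have "coeff p (Suc (degree (pderiv p))) = 0" by (intro coeff_eq_0) simp
    then have "lead_coeff (pderiv p) = 0" by (simp add: coeff_pderiv)
    then show False using \<open>pderiv p \<noteq> 0\<close> by simp
  qed
  ultimately have dz: "poly (pderiv p) z \<noteq> 0" using p(4) not_less by blast
  obtain q where q: "p = [:- z, 1:] * q" using p(3) by (auto simp: poly_eq_0_iff_dvd elim: dvdE)
  have "poly q z \<noteq> 0"
    using dz unfolding q pderiv_mult by (simp add: pderiv_pCons)
  have "degree q > 0"
  proof (rule ccontr)
    assume "\<not> degree q > 0"
    then obtain c where c: "q = [:c:]" using degree_eq_zeroE[of q] by auto
    have "- z * c \<in> F" "c \<in> F" using p(1)[of 0] p(1)[of 1] by (auto simp: q c mult.commute)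
    moreover have "c \<noteq> 0" using \<open>poly q z \<noteq> 0\<close> c by simp
    ultimately have "(0 - (- z * c)) * inverse c \<in> F"
      using Fs(1) unfolding subfield_def by blast
    moreover have "(0 - (- z * c)) * inverse c = z" using \<open>c \<noteq> 0\<close> by (simp add: field_simps)
    ultimately show False using z by metis
  qed
  then obtain w where w: "poly q w = 0" using Fs(3) unfolding is_algebraic_closure_of_def by blast
  have pw: "poly p w = 0" by (simp add: q w)
  have wz: "w \<noteq> z" using w \<open>poly q z \<noteq> 0\<close> by auto
  have pp: "(p, p) \<in> poly_graph G" using p(1) pg by blast
  have min: "\<And>p' q'. (p', q') \<in> poly_graph G \<Longrightarrow> p' \<noteq> 0 \<Longrightarrow> poly p' z = 0 \<Longrightarrow> degree p \<le> degree p'"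
    using p(4) pg by blast
  have "hom_graph F (adjoin G z w)"
    by (rule hom_graph_adjoin[OF pp p(2,3) pw]) (rule min)
  then obtain \<sigma> where \<sigma>: "field_aut F \<sigma>" "\<And>a b. (a, b) \<in> adjoin G z w \<Longrightarrow> \<sigma> a = b"
    using hom_graph_to_aut[OF Fs(1,3)] by blast
  have "(z, w) \<in> adjoin G z w"
    by (rule adjoin_contains[OF pp p(2,3) pw]) (rule min)
  then have "\<sigma> z = w" using \<sigma> by blast
  then show ?thesis using that \<sigma>(1) wz by blast
qed

section \<open>Varieties and their ideals\<close>

definition ideal_of :: "('v \<Rightarrow> 'k::field) set \<Rightarrow> ('v, 'k) mpoly set" where
  "ideal_of X = {g. \<forall>x\<in>X. mpoly_eval g x = 0}"

lemma vanishing_ideal_eq: "vanishing_ideal V X = ideal_of X \<inter> polys_in V"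
  by (auto simp: vanishing_ideal_def ideal_of_def)

lemma restrict_variables:
  "\<exists>f'\<in>polys_in V. \<forall>x\<in>aff V. mpoly_eval f' x = mpoly_eval f x"
proof (induction f rule: mpoly_induct)
  case (single m c)
  show ?case
  proof (cases "Poly_Mapping.keys m \<subseteq> V")
    case True
    then show ?thesis
      by (intro bexI[of _ "Poly_Mapping.single m c"]) (auto intro!: polys_inI split: if_splits)
  next
    case False
    then obtain v where v: "v \<in> Poly_Mapping.keys m" "v \<notin> V" by blast
    have "monom_eval x m = 0" if "x \<in> aff V" for x
    proof -
      have "x v ^ Poly_Mapping.lookup m v = 0"
        using that v by (simp add: aff_def in_keys_iff power_0_left)
      then show ?thesis unfolding monom_eval_def using v(1) by (intro prod_zero) auto
    qed
    then show ?thesis by (intro bexI[of _ 0]) auto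
  qed
next
  case (add p q)
  then obtain p' q' where "p' \<in> polys_in V" "q' \<in> polys_in V"
    "\<forall>x\<in>aff V. mpoly_eval p' x = mpoly_eval p x" "\<forall>x\<in>aff V. mpoly_eval q' x = mpoly_eval q x" by blast
  then show ?case by (intro bexI[of _ "p' + q'"]) (auto intro: polys_in_add)
qed

lemma zclosed_subset_aff: "zclosed V X \<Longrightarrow> X \<subseteq> aff V"
  by (auto simp: zclosed_def zero_set_def)

lemma zclosed_cut: "zclosed V X \<Longrightarrow> a \<in> polys_in V \<Longrightarrow> zclosed V {x \<in> X. mpoly_eval a x = 0}"
proof -
  assume "zclosed V X" and a: "a \<in> polys_in V"
  then obtain S where "S \<subseteq> polys_in V" "X = zero_set V S" by (auto simp: zclosed_def)
  then show ?thesis unfolding zclosed_def using a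
    by (intro exI[of _ "insert a S"]) (auto simp: zero_set_def)
qed

lemma prime_ideal_of:
  assumes X: "irreducible_variety V X"
  shows "prime_ideal_set (ideal_of X)"
proof
  have X': "zclosed V X" "X \<noteq> {}" "X \<subseteq> aff V"
    using X zclosed_subset_aff[of V X] by (simp_all add: irreducible_variety_def)
  have irr: "X = Y \<or> X = Z" if "zclosed V Y" "zclosed V Z" "X = Y \<union> Z" for Y Z
    using X that unfolding irreducible_variety_def by presburger
  show "1 \<notin> ideal_of X" using X' by (auto simp: ideal_of_def)
  show "a \<in> ideal_of X \<or> b \<in> ideal_of X" if ab: "a * b \<in> ideal_of X" for a b
  proof -
    obtain a' b' where a': "a' \<in> polys_in V" "\<And>x. x \<in> aff V \<Longrightarrow> mpoly_eval a' x = mpoly_eval a x"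
      and b': "b' \<in> polys_in V" "\<And>x. x \<in> aff V \<Longrightarrow> mpoly_eval b' x = mpoly_eval b x"
      using restrict_variables by metis
    let ?Y = "{x \<in> X. mpoly_eval a' x = 0}" and ?Z = "{x \<in> X. mpoly_eval b' x = 0}"
    have "\<forall>x\<in>X. mpoly_eval a x = 0 \<or> mpoly_eval b x = 0"
      using ab by (simp add: ideal_of_def)
    moreover have aX: "mpoly_eval a' x = mpoly_eval a x" "mpoly_eval b' x = mpoly_eval b x" if "x \<in> X" for x
      using that X'(3) a'(2) b'(2) by blast+
    ultimately have "X = ?Y \<union> ?Z" by auto
    then have "X = ?Y \<or> X = ?Z"
      by (rule irr[OF zclosed_cut[OF X'(1) a'(1)] zclosed_cut[OF X'(1) b'(1)]])
    then show ?thesis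
    proof
      assume "X = ?Y"
      then have "mpoly_eval a' x = 0" if "x \<in> X" for x using that by blast
      then show ?thesis using aX by (simp add: ideal_of_def)
    next
      assume "X = ?Z"
      then have "mpoly_eval b' x = 0" if "x \<in> X" for x using that by blast
      then show ?thesis using aX by (simp add: ideal_of_def)
    qed
  qed
qed (auto simp: ideal_of_def)

text \<open>An equation of \<open>Y i\<close> that fails on \<open>Y (Suc i)\<close> separates
  neighbouring primes of the reversed chain. The bound on all chains also ensures that the greatest
  length in \<open>var_dim\<close> is attained.\<close>

lemma var_dim_le_growth:
  assumes X: "irreducible_variety V X" and growth: "growth_le V (ideal_of X) V \<tau>"
  shows "var_dim V X \<le> \<tau>"
proof -
  let ?Q = "\<lambda>d. \<exists>Y :: nat \<Rightarrow> ('a \<Rightarrow> 'b) set.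
       (\<forall>i\<le>d. irreducible_variety V (Y i)) \<and> (\<forall>i<d. Y i \<subset> Y (Suc i)) \<and> Y d \<subseteq> X"
  have le: "d \<le> \<tau>" if "?Q d" for d
  proof -
    obtain Y where Y: "\<And>i. i \<le> d \<Longrightarrow> irreducible_variety V (Y i)"
      "\<And>i. i < d \<Longrightarrow> Y i \<subset> Y (Suc i)" "Y d \<subseteq> X" using \<open>?Q d\<close> by blast
    have "\<exists>f. f \<in> ideal_of (Y i) \<and> f \<notin> ideal_of (Y (Suc i)) \<and> f \<in> polys_in V" if i: "i < d" for i
    proof -
      have "zclosed V (Y i)" using Y(1)[of i] i by (simp add: irreducible_variety_def)
      then obtain S where S: "S \<subseteq> polys_in V" "Y i = zero_set V S" by (auto simp: zclosed_def)
      obtain y where y: "y \<in> Y (Suc i)" "y \<notin> Y i" using Y(2)[OF i] by blast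
      have "y \<in> aff V" using Y(1)[of "Suc i"] i y(1) zclosed_subset_aff
        unfolding irreducible_variety_def by (metis Suc_leI subsetD)
      then obtain f where "f \<in> S" "mpoly_eval f y \<noteq> 0" using y(2) S(2) by (auto simp: zero_set_def)
      then show ?thesis using S y(1) by (intro exI[of _ f]) (auto simp: ideal_of_def zero_set_def)
    qed
    then obtain f where f: "\<And>i. i < d \<Longrightarrow> f i \<in> ideal_of (Y i)" "\<And>i. i < d \<Longrightarrow> f i \<notin> ideal_of (Y (Suc i))"
      "\<And>i. i < d \<Longrightarrow> f i \<in> polys_in V" by metis
    show ?thesis
    proof (rule chain_length_le_growth[where J="\<lambda>i. ideal_of (Y i)" and f=f and I="ideal_of X" and V=V])
      show "ideal_of (Y (Suc i)) \<subseteq> ideal_of (Y i)" if "i < d" for i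
        using Y(2)[OF that] by (auto simp: ideal_of_def)
      show "ideal_of X \<subseteq> ideal_of (Y d)" using Y(3) by (auto simp: ideal_of_def)
    qed (use Y(1) f X growth in \<open>auto intro: prime_ideal_of\<close>)
  qed
  have "?Q 0" using X by (intro exI[of _ "\<lambda>_. X"]) auto
  then have "?Q (GREATEST d. ?Q d)" by (rule GreatestI_nat[where b=\<tau>]) (rule le)
  then show ?thesis unfolding var_dim_def by (rule le)
qed

section \<open>Descent of the ideal to a perfect field of definition\<close>

lemma subfield_closed:
  assumes "subfield F"
  shows "0 \<in> F" "1 \<in> F" "a \<in> F \<Longrightarrow> b \<in> F \<Longrightarrow> a + b \<in> F" "a \<in> F \<Longrightarrow> b \<in> F \<Longrightarrow> a - b \<in> F"
    "a \<in> F \<Longrightarrow> b \<in> F \<Longrightarrow> a * b \<in> F" "a \<in> F \<Longrightarrow> inverse a \<in> F"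
  using assms by (auto simp: subfield_def)

lemma subfield_of_nat: "subfield F \<Longrightarrow> of_nat n \<in> F"
  by (induction n) (auto intro: subfield_closed)

lemma subfield_sum: "subfield F \<Longrightarrow> (\<And>a. a \<in> A \<Longrightarrow> f a \<in> F) \<Longrightarrow> sum f A \<in> F"
  by (induction A rule: infinite_finite_induct) (auto intro: subfield_closed)

lemma subfield_prod: "subfield F \<Longrightarrow> (\<And>a. a \<in> A \<Longrightarrow> f a \<in> F) \<Longrightarrow> prod f A \<in> F"
  by (induction A rule: infinite_finite_induct) (auto intro: subfield_closed)

lemma subfield_power: "subfield F \<Longrightarrow> a \<in> F \<Longrightarrow> a ^ n \<in> F"
  by (induction n) (auto intro: subfield_closed)

lemma polys_over_in: "p \<in> polys_over F V \<Longrightarrow> p \<in> polys_in V"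
  by (simp add: polys_over_def)

context
  fixes F :: "'k::field set"
  assumes F: "subfield F"
begin

lemma polys_over_add: "p \<in> polys_over F V \<Longrightarrow> q \<in> polys_over F V \<Longrightarrow> p + q \<in> polys_over F V"
  using F by (auto simp: polys_over_def lookup_add intro: polys_in_add subfield_closed)

lemma polys_over_diff: "p \<in> polys_over F V \<Longrightarrow> q \<in> polys_over F V \<Longrightarrow> p - q \<in> polys_over F V"
  using F by (auto simp: polys_over_def lookup_minus intro: polys_in_diff subfield_closed)

lemma polys_over_mconst: "a \<in> F \<Longrightarrow> mconst a \<in> polys_over F V"
  using F by (auto simp: polys_over_def mconst_def lookup_single when_def intro: subfield_closed)
    (simp flip: mconst_def)

lemma polys_over_0: "0 \<in> polys_over F V"
  using polys_over_mconst[of 0] F by (auto intro: subfield_closed)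

lemma polys_over_1: "1 \<in> polys_over F V"
  using polys_over_mconst[of 1] F by (auto intro: subfield_closed)

lemma polys_over_mvar: "v \<in> V \<Longrightarrow> mvar v \<in> polys_over F V"
  using F by (auto simp: polys_over_def mvar_def lookup_single when_def intro: subfield_closed)
    (use polys_in_mvar in \<open>auto simp: mvar_def\<close>)

lemma polys_over_sum: "(\<And>a. a \<in> A \<Longrightarrow> f a \<in> polys_over F V) \<Longrightarrow> sum f A \<in> polys_over F V"
  by (induction A rule: infinite_finite_induct) (auto intro: polys_over_add polys_over_0)

lemma polys_over_mult: 
  assumes "p \<in> polys_over F V" "q \<in> polys_over F V"
  shows "p * q \<in> polys_over F V"
proof -
  have "p * q = (\<Sum>m\<in>Poly_Mapping.keys p. \<Sum>n\<in>Poly_Mapping.keys q.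
      Poly_Mapping.single (m + n) (Poly_Mapping.lookup p m * Poly_Mapping.lookup q n))"
    unfolding mult_single[symmetric] sum_product[symmetric] by (simp only: mpoly_decomp[symmetric])
  also have "Poly_Mapping.lookup \<dots> l \<in> F" for l
    using assms F unfolding lookup_sum
    by (intro subfield_sum) (auto simp: lookup_single when_def polys_over_def intro: subfield_closed)
  finally show ?thesis using assms by (auto simp: polys_over_def intro: polys_in_mult)
qed

lemma polys_over_power: "p \<in> polys_over F V \<Longrightarrow> p ^ n \<in> polys_over F V"
  by (induction n) (auto intro: polys_over_mult polys_over_1)

lemma polys_over_prod: "(\<And>a. a \<in> A \<Longrightarrow> f a \<in> polys_over F V) \<Longrightarrow> prod f A \<in> polys_over F V"
  by (induction A rule: infinite_finite_induct) (auto intro: polys_over_mult polys_over_1)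

lemma polys_over_mderiv: "p \<in> polys_over F V \<Longrightarrow> mderiv v p \<in> polys_over F V"
  using F subfield_of_nat[OF F]
  by (auto simp: polys_over_def lookup_mderiv intro: polys_in_mderiv subfield_closed simp del: of_nat_add)

lemma polys_over_eval:
  assumes p: "p \<in> polys_over F V" and x: "\<And>v. x v \<in> F"
  shows "mpoly_eval p x \<in> F"
  unfolding mpoly_eval_superset[OF finite_keys subset_refl] monom_eval_def
  using F p x
  by (intro subfield_sum subfield_closed subfield_prod subfield_power) (auto simp: polys_over_def)

lemma polys_over_vfield:
  "(\<And>v. v \<in> V \<Longrightarrow> c v \<in> polys_over F V) \<Longrightarrow> p \<in> polys_over F V \<Longrightarrow> vfield V c p \<in> polys_over F V"
  unfolding vfield_def by (intro polys_over_sum polys_over_mult polys_over_mderiv)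

end

section \<open>The Galois action on the ideal\<close>

lemma field_aut_0_1: "field_aut F \<sigma> \<Longrightarrow> \<sigma> 0 = 0" "field_aut F \<sigma> \<Longrightarrow> \<sigma> 1 = 1"
proof -
  assume s: "field_aut F \<sigma>"
  then have "\<sigma> (0 + 0) = \<sigma> 0 + \<sigma> 0" unfolding field_aut_def by blast
  then have "\<sigma> 0 + \<sigma> 0 = \<sigma> 0 + 0" by simp
  then show z: "\<sigma> 0 = 0" by (rule add_left_imp_eq)
  have "\<sigma> (1 * 1) = \<sigma> 1 * \<sigma> 1" using s unfolding field_aut_def by blast
  moreover have "\<sigma> 1 \<noteq> \<sigma> 0" using s unfolding field_aut_def bij_def by (metis injD zero_neq_one)
  ultimately show "\<sigma> 1 = 1" using z by simp
qed

lemma field_aut_eval: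
  assumes s: "field_aut F \<sigma>"
  shows "mpoly_eval (Poly_Mapping.map \<sigma> p) (\<sigma> \<circ> x) = \<sigma> (mpoly_eval p x)"
proof -
  note s0 = field_aut_0_1[OF s]
  have add: "\<sigma> (a + b) = \<sigma> a + \<sigma> b" and mult: "\<sigma> (a * b) = \<sigma> a * \<sigma> b" for a b
    using s unfolding field_aut_def by blast+
  have sum: "\<sigma> (sum f A) = (\<Sum>a\<in>A. \<sigma> (f a))" for f and A :: "'c set"
    by (induction A rule: infinite_finite_induct) (auto simp: add s0)
  have power: "\<sigma> (a ^ n) = \<sigma> a ^ n" for a n
    by (induction n) (auto simp: mult s0)
  have prod: "\<sigma> (prod f A) = (\<Prod>a\<in>A. \<sigma> (f a))" for f and A :: "'c set"
    by (induction A rule: infinite_finite_induct) (auto simp: mult s0)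
  have sub: "Poly_Mapping.keys (Poly_Mapping.map \<sigma> p) \<subseteq> Poly_Mapping.keys p"
    by (auto simp: in_keys_iff Poly_Mapping.map.rep_eq when_def split: if_splits)
  have "mpoly_eval (Poly_Mapping.map \<sigma> p) (\<sigma> \<circ> x) =
    (\<Sum>m\<in>Poly_Mapping.keys p. \<sigma> (Poly_Mapping.lookup p m) * \<sigma> (monom_eval x m))"
    unfolding mpoly_eval_superset[OF finite_keys sub]
    by (intro sum.cong refl)
      (auto simp: Poly_Mapping.map.rep_eq when_def s0 monom_eval_def prod power)
  also have "\<dots> = \<sigma> (mpoly_eval p x)"
    unfolding mpoly_eval_superset[OF finite_keys subset_refl] by (simp add: sum mult)
  finally show ?thesis .
qed

text \<open>Automorphisms permute the points of \<open>X\<close>, whose equations have fixed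
  coefficients. The transported polynomial vanishes at \<open>x\<close> because \<open>g\<close>
  vanishes at the preimage of \<open>x\<close>.\<close>

lemma ideal_of_aut:
  assumes s: "field_aut F \<sigma>" and X: "defined_over F V X" and g: "g \<in> ideal_of X"
  shows "Poly_Mapping.map \<sigma> g \<in> ideal_of X"
  unfolding ideal_of_def
proof (intro CollectI ballI)
  fix x assume x: "x \<in> X"
  note s0 = field_aut_0_1[OF s]
  obtain S where S: "S \<subseteq> polys_over F V" "X = zero_set V S" using X by (auto simp: defined_over_def)
  have bij: "bij \<sigma>" using s by (simp add: field_aut_def)
  define y where "y = inv \<sigma> \<circ> x"
  have xy: "\<sigma> \<circ> y = x" using bij by (auto simp: y_def fun_eq_iff bij_is_surj surj_f_inv_f)
  have inj: "\<sigma> a = 0 \<Longrightarrow> a = 0" for a using bij s0 by (metis bij_is_inj injD)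
  have "y \<in> aff V"
    using x inj unfolding S(2) zero_set_def aff_def xy[symmetric] by (auto simp: o_def)
  moreover have "mpoly_eval p y = 0" if p: "p \<in> S" for p
  proof -
    have "Poly_Mapping.lookup p m \<in> F" for m using S(1) p by (auto simp: polys_over_def)
    then have "Poly_Mapping.map \<sigma> p = p"
      using s by (intro poly_mapping_eqI) (auto simp: Poly_Mapping.map.rep_eq when_def field_aut_def)
    then have "\<sigma> (mpoly_eval p y) = mpoly_eval p x" using field_aut_eval[OF s, of p y] xy by simp
    then show ?thesis using x p inj unfolding S(2) zero_set_def by auto
  qed
  ultimately have "y \<in> X" unfolding S(2) zero_set_def by blast
  then have "mpoly_eval g y = 0" using g by (simp add: ideal_of_def)
  then show "mpoly_eval (Poly_Mapping.map \<sigma> g) x = 0"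
    using field_aut_eval[OF s, of g y] xy s0 by simp
qed

text \<open>An element of minimal support of a Galois-stable subspace, scaled to have a coefficient 1,
  is fixed by all automorphisms.\<close>

lemma descent_induct [consumes 5, case_names zero add scale rational]:
  assumes F: "subfield F" "perfect_subfield F" "is_algebraic_closure_of F" and X: "defined_over F V X"
    and g: "g \<in> ideal_of X \<inter> polys_in V"
    and P0: "P 0" and Padd: "\<And>a b. P a \<Longrightarrow> P b \<Longrightarrow> P (a + b)" and Pscale: "\<And>c a. P a \<Longrightarrow> P (mconst c * a)"
    and PF: "\<And>a. a \<in> ideal_of X \<inter> polys_over F V \<Longrightarrow> P a"
  shows "P g"
  using g
proof (induction "card (Poly_Mapping.keys g)" arbitrary: g rule: less_induct)
  case less
  show ?case
  proof (cases "g = 0")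
    case False
    let ?N = "ideal_of X \<inter> polys_in V" and ?k = Poly_Mapping.keys and ?l = Poly_Mapping.lookup
    have N: "a - b \<in> ?N" "mconst c * a \<in> ?N" if "a \<in> ?N" "b \<in> ?N" for a b c
      using that by (auto simp: ideal_of_def intro: polys_in_diff polys_in_mult)
    let ?Q = "\<lambda>a. a \<in> ?N \<and> a \<noteq> 0 \<and> ?k a \<subseteq> ?k g"
    have "?Q g" using False less.prems by blast
    then obtain a where a: "?Q a" "\<And>b. ?Q b \<Longrightarrow> card (?k a) \<le> card (?k b)"
      using ex_has_least_nat[of ?Q g "\<lambda>a. card (?k a)"] by blast
    obtain m where m: "m \<in> ?k a" using a(1) by (metis all_not_in_conv keys_eq_empty)
    define a' where "a' = mconst (inverse (?l a m)) * a"
    have a': "a' \<in> ?N" "?l a' m = 1" "?k a' \<subseteq> ?k a" 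
      using N[of a a] a(1) m by (auto simp: a'_def in_keys_iff)
    have la: "?l a' i = 0" if "?l a i = 0" for i using that by (simp add: a'_def)
    have "?l a' n \<in> F" for n
    proof (rule ccontr)
      assume "?l a' n \<notin> F"
      then obtain \<sigma> where s: "field_aut F \<sigma>" "\<sigma> (?l a' n) \<noteq> ?l a' n"
        using exists_aut_moving[OF F] by blast
      define b where "b = Poly_Mapping.map \<sigma> a' - a'"
      have lb: "?l b i = \<sigma> (?l a' i) - ?l a' i" for i
        using field_aut_0_1[OF s(1)] by (auto simp: b_def lookup_minus Poly_Mapping.map.rep_eq when_def)
      have "Poly_Mapping.map \<sigma> a' \<in> polys_in V"
      proof (rule polys_inI)
        fix i v assume "i \<in> ?k (Poly_Mapping.map \<sigma> a')" "v \<in> ?k i"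
        moreover from this have "i \<in> ?k a'"
          by (auto simp: in_keys_iff Poly_Mapping.map.rep_eq when_def split: if_splits)
        ultimately show "v \<in> V" using polys_inD[of a' V i] a'(1) by blast
      qed
      then have "b \<in> ?N" using ideal_of_aut[OF s(1) X] a'(1) unfolding b_def by (intro N(1)) auto
      moreover have "?k b \<subseteq> ?k a - {m}"
        using a'(2) field_aut_0_1[OF s(1)] by (auto simp: in_keys_iff lb la)
      moreover have "b \<noteq> 0" using s(2) lb[of n] by auto
      ultimately have "card (?k a) \<le> card (?k a - {m})"
        using a(1) card_mono[of "?k a - {m}" "?k b"] by (intro le_trans[OF a(2)[of b]]) auto
      moreover have "card (?k a - {m}) < card (?k a)" using m by (intro card_Diff1_less) auto
      ultimately show False by simp
    qed
    then have Pa': "P a'" using a'(1) by (intro PF) (auto simp: polys_over_def)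
    \<comment> \<open>The support of \<open>a'\<close> lies in that of \<open>g\<close>, so
      cancelling the coefficient at \<open>m\<close> strictly shrinks the support.\<close>
    define b where "b = g - mconst (?l g m) * a'"
    have "?k b \<subseteq> ?k g - {m}"
    proof
      fix i assume i: "i \<in> ?k b"
      then have "?l g i \<noteq> 0 \<or> ?l a' i \<noteq> 0" "i \<noteq> m"
        using a'(2) by (auto simp: b_def in_keys_iff lookup_minus)
      then show "i \<in> ?k g - {m}" using a'(3) a(1) by (auto simp flip: in_keys_iff)
    qed
    moreover have "m \<in> ?k g" using a(1) m by blast
    ultimately have "card (?k b) < card (?k g)"
      by (intro psubset_card_mono) auto
    moreover have "b \<in> ?N" unfolding b_def using less.prems a'(1) N by blast
    ultimately have "P b" by (rule less.hyps)
    then have "P (b + mconst (?l g m) * a')" using Pa' Padd Pscale by blast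
    then show ?thesis by (simp add: b_def)
  qed (use P0 in simp)
qed

section \<open>Rational vector fields near a nonsingular point\<close>

lemma vector_space_fscale: "vector_space (fscale :: 'k::field \<Rightarrow> ('v \<Rightarrow> 'k) \<Rightarrow> ('v \<Rightarrow> 'k))"
  by unfold_locales (auto simp: fun_eq_iff algebra_simps)

lemma sum_apply: "sum f A x = (\<Sum>a\<in>A. f a x)"
  for f :: "'a \<Rightarrow> 'b \<Rightarrow> 'c::comm_monoid_add"
  by (induction A rule: infinite_finite_induct) auto

text \<open>On the columns \<open>B\<close> the system is \<open>h\<close> times the identity, so
  the coordinates in \<open>V - B\<close> are free and determine the others.\<close>

lemma vdim_solution_space:
  fixes \<gamma> :: "'v \<Rightarrow> 'v \<Rightarrow> 'k::field"
  assumes V: "finite V" "B \<subseteq> V" and h: "h \<noteq> 0"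
    and \<gamma>: "\<And>b b'. b \<in> B \<Longrightarrow> b' \<in> B \<Longrightarrow> \<gamma> b b' = (if b = b' then h else 0)"
  shows "vdim {u \<in> aff V. \<forall>b\<in>B. (\<Sum>v\<in>V. \<gamma> b v * u v) = 0} = card (V - B)"
proof -
  interpret vs: vector_space "fscale :: 'k \<Rightarrow> ('v \<Rightarrow> 'k) \<Rightarrow> ('v \<Rightarrow> 'k)" by (rule vector_space_fscale)
  let ?K = "{u \<in> aff V. \<forall>b\<in>B. (\<Sum>v\<in>V. \<gamma> b v * u v) = 0}"
  \<comment> \<open>The solution whose free coordinates are 1 at \<open>t\<close> and 0
    elsewhere.\<close>
  define e where "e t v = (if v = t then 1 else if v \<in> B then - \<gamma> v t / h else 0)" for t v
  have fB: "finite B" using V by (rule rev_finite_subset)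
  have split: "(\<Sum>v\<in>V. f v) = (\<Sum>v\<in>V - B. f v) + (\<Sum>v\<in>B. f v)" for f :: "'v \<Rightarrow> 'k"
    using V by (simp add: sum.subset_diff)
  have row: "(\<Sum>v\<in>V. \<gamma> b v * u v) = (\<Sum>v\<in>V - B. \<gamma> b v * u v) + h * u b" if b: "b \<in> B" for b and u :: "'v \<Rightarrow> 'k"
  proof -
    have "(\<Sum>v\<in>B. \<gamma> b v * u v) = (\<Sum>v\<in>B. if b = v then h * u v else 0)"
      using b \<gamma> by (intro sum.cong) auto
    then show ?thesis using b fB by (simp add: split)
  qed
  have inj: "inj_on e (V - B)"
  proof (rule inj_onI)
    fix s t assume "s \<in> V - B" "t \<in> V - B" "e s = e t"
    then have "e t s = 1" unfolding e_def by (metis (full_types))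
    then show "s = t" using \<open>s \<in> V - B\<close> by (auto simp: e_def split: if_splits)
  qed
  have "vs.dim ?K = card (V - B)"
  proof (rule vs.dim_unique[of "e ` (V - B)"])
    show "e ` (V - B) \<subseteq> ?K"
    proof clarify
      fix t assume t: "t \<in> V" "t \<notin> B"
      have "e t \<in> aff V" using t V by (auto simp: aff_def e_def)
      moreover have "(\<Sum>v\<in>V. \<gamma> b v * e t v) = 0" if b: "b \<in> B" for b
      proof -
        have "(\<Sum>v\<in>V - B. \<gamma> b v * e t v) = (\<Sum>v\<in>V - B. if v = t then \<gamma> b v else 0)"
          by (intro sum.cong) (auto simp: e_def)
        also have "\<dots> = \<gamma> b t" using t V by simp
        finally show ?thesis unfolding row[OF b] using b t h by (auto simp: e_def)
      qed
      ultimately show "e t \<in> aff V \<and> (\<forall>b\<in>B. (\<Sum>v\<in>V. \<gamma> b v * e t v) = 0)" by blast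
    qed
    have val: "(\<Sum>t\<in>V - B. c t * e t s) = c s" if s: "s \<in> V - B" for c s
    proof -
      have "(\<Sum>t\<in>V - B. c t * e t s) = (\<Sum>t\<in>V - B. if s = t then c t else 0)"
        using s by (intro sum.cong) (auto simp: e_def)
      then show ?thesis using s V by simp
    qed
    show "?K \<subseteq> vs.span (e ` (V - B))"
    proof
      fix u assume u: "u \<in> ?K"
      have "u = (\<Sum>t\<in>V - B. fscale (u t) (e t))"
      proof
        fix v
        have app: "(\<Sum>t\<in>V - B. fscale (u t) (e t)) v = (\<Sum>t\<in>V - B. u t * e t v)"
          by (rule sum_apply)
        consider "v \<notin> V" | "v \<in> V - B" | "v \<in> B" by blast
        then show "u v = (\<Sum>t\<in>V - B. fscale (u t) (e t)) v"
        proof cases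
          case 1
          then have "(\<Sum>t\<in>V - B. u t * e t v) = 0"
            using V by (intro sum.neutral) (auto simp: e_def)
          then show ?thesis using u 1 unfolding app by (simp add: aff_def)
        next
          case 2
          then show ?thesis unfolding app by (simp add: val)
        next
          case 3
          have "(\<Sum>t\<in>V - B. u t * e t v) = (\<Sum>t\<in>V - B. - (\<gamma> v t * u t) / h)"
            using 3 by (intro sum.cong) (auto simp: e_def)
          also have "\<dots> = - (\<Sum>t\<in>V - B. \<gamma> v t * u t) / h"
            by (simp add: sum_negf sum_divide_distrib)
          also have "\<dots> = u v"
            using u 3 h row[OF 3, of u] by (auto simp: field_simps add_eq_0_iff)
          finally show ?thesis unfolding app by simp
        qed
      qed
      also have "\<dots> \<in> vs.span (e ` (V - B))"
        by (intro vs.span_sum vs.span_scale vs.span_base) auto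
      finally show "u \<in> vs.span (e ` (V - B))" .
    qed
    show "vs.independent (e ` (V - B))"
    proof (rule vs.independent_if_scalars_zero)
      fix c x assume c: "(\<Sum>x\<in>e ` (V - B). fscale (c x) x) = 0" and "x \<in> e ` (V - B)"
      then obtain s where s: "s \<in> V - B" "x = e s" by blast
      have "0 = (\<Sum>t\<in>V - B. fscale (c (e t)) (e t)) s"
        using c by (simp add: sum.reindex[OF inj] fun_eq_iff)
      also have "\<dots> = (\<Sum>t\<in>V - B. c (e t) * e t s)" by (rule sum_apply)
      also have "\<dots> = c (e s)" using s by (simp add: val[of s "\<lambda>t. c (e t)"])
      finally show "c x = 0" using s by simp
    qed (use V in simp)
    show "card (e ` (V - B)) = card (V - B)" by (rule card_image[OF inj])
  qed
  then show ?thesis by (simp add: vdim_def)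
qed

locale rational_nonsingular =
  fixes F :: "'k::field set" and V :: "'v set" and X :: "('v \<Rightarrow> 'k) set" and x0 :: "'v \<Rightarrow> 'k"
  assumes V: "finite V" and F: "subfield F" "perfect_subfield F" "is_algebraic_closure_of F"
    and X: "irreducible_variety V X" "defined_over F V X"
    and x0: "x0 \<in> X" "\<And>v. x0 v \<in> F" "nonsingular_point V X x0"
begin

abbreviation "I \<equiv> ideal_of X"
abbreviation "R \<equiv> polys_over F V"

sublocale prime_ideal_mpoly I
  unfolding prime_ideal_mpoly_def using X(1) by (rule prime_ideal_of)

lemma vanish_x0: "f \<in> I \<Longrightarrow> mpoly_eval f x0 = 0"
  using x0 by (simp add: ideal_of_def)

lemma R_closed: "p \<in> R \<Longrightarrow> q \<in> R \<Longrightarrow> p * q \<in> R" "p \<in> R \<Longrightarrow> q \<in> R \<Longrightarrow> p - q \<in> R"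
  "p \<in> R \<Longrightarrow> mderiv v p \<in> R" "1 \<in> R" "0 \<in> R"
  using F(1) by (auto intro: polys_over_mult polys_over_diff polys_over_mderiv polys_over_1 polys_over_0)

text \<open>A partially diagonalised Jacobian of \<open>I\<close>, with pivot columns \<open>B\<close> and pivot \<open>h\<close>
  that does not vanish at the point.\<close>

definition frame :: "'v set \<Rightarrow> ('v, 'k) mpoly \<Rightarrow> ('v \<Rightarrow> ('v, 'k) mpoly) \<Rightarrow> bool" where
  "frame B h g \<longleftrightarrow> h \<in> R \<and> mpoly_eval h x0 \<noteq> 0 \<and> (\<forall>b\<in>B. g b \<in> I \<inter> R) \<and>
     (\<forall>b\<in>B. \<forall>b'\<in>B. mderiv b' (g b) - (if b' = b then h else 0) \<in> I)"

text \<open>One step of fraction-free Gaussian elimination with new row \<open>f\<close> and pivot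
  column \<open>v\<close>. By the product rule the derivatives of the multipliers are accompanied by
  elements of \<open>I\<close>, so modulo \<open>I\<close> the multipliers behave like
  scalars.\<close>

lemma frame_extend:
  assumes fr: "frame B h g" and f: "f \<in> I \<inter> R" and v: "v \<notin> B" "mpoly_eval (mderiv v f) x0 \<noteq> 0"
    and vanish: "\<And>b. b \<in> B \<Longrightarrow> mderiv b f \<in> I"
  shows "frame (insert v B) (h * mderiv v f)
    (\<lambda>b. if b = v then h * f else mderiv v f * g b - mderiv v (g b) * f)"
proof -
  define q where "q = mderiv v f"
  define g' where "g' b = (if b = v then h * f else q * g b - mderiv v (g b) * f)" for b
  have R: "h \<in> R" "q \<in> R" "f \<in> R" "\<And>b. b \<in> B \<Longrightarrow> g b \<in> R"
    using fr f by (auto simp: frame_def q_def R_closed)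
  have I: "f \<in> I" "\<And>b. b \<in> B \<Longrightarrow> g b \<in> I" using fr f by (auto simp: frame_def)
  have gI: "g' b \<in> I \<inter> R" if "b \<in> insert v B" for b
    using that R I by (auto simp: g'_def intro: mult_left diff R_closed)
  have dg: "mderiv b' (g b) - (if b' = b then h else 0) \<in> I" if "b \<in> B" "b' \<in> B" for b b'
    using fr that by (auto simp: frame_def)
  have "mderiv b' (g' b) - (if b' = b then h * q else 0) \<in> I" if b: "b \<in> insert v B" and b': "b' \<in> insert v B" for b b'
  proof (cases "b = v")
    case True
    have "mderiv b' (g' b) = mderiv b' h * f + h * mderiv b' f" by (simp add: True g'_def mderiv_mult)
    then have "mderiv b' (g' b) - (if b' = b then h * q else 0) =
      mderiv b' h * f + (if b' = v then 0 else h * mderiv b' f)" by (simp add: True q_def)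
    also have "\<dots> \<in> I" using b' vanish I(1) by (auto intro!: add mult_left zero)
    finally show ?thesis .
  next
    case False
    then have bB: "b \<in> B" using b by simp
    have "mderiv b' (g' b) = q * mderiv b' (g b) - mderiv v (g b) * mderiv b' f +
        (mderiv b' q * g b - mderiv b' (mderiv v (g b)) * f)"
      using False by (simp add: g'_def mderiv_mult algebra_simps)
    then have eq: "mderiv b' (g' b) - (if b' = b then h * q else 0) =
        (q * (mderiv b' (g b) - (if b' = b then h else 0)) - mderiv v (g b) * mderiv b' f) +
        (mderiv b' q * g b - mderiv b' (mderiv v (g b)) * f)"
      by (cases "b' = b") (simp_all add: algebra_simps)
    have "q * (mderiv b' (g b) - (if b' = b then h else 0)) - mderiv v (g b) * mderiv b' f \<in> I"
    proof (cases "b' = v")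
      case True
      then show ?thesis using False by (simp add: q_def mult.commute zero)
    next
      case False
      then have b'B: "b' \<in> B" using b' by simp
      show ?thesis by (rule diff[OF mult_left[OF dg[OF bB b'B]] mult_left[OF vanish[OF b'B]]])
    qed
    from add[OF this diff[OF mult_left[OF I(2)[OF bB]] mult_left[OF I(1)]]]
    show ?thesis unfolding eq .
  qed
  then have "frame (insert v B) (h * q) g'"
    unfolding frame_def using gI R fr v(2) by (auto simp: R_closed q_def frame_def)
  then show ?thesis unfolding g'_def q_def .
qed

text \<open>For a maximal frame, subtracting multiples of the \<open>g b\<close> from
  \<open>h * f\<close> leaves an element whose derivatives along \<open>B\<close> lie in
  \<open>I\<close>; any derivative nonzero at the point would enlarge the frame. So the differential
  of \<open>f\<close> at the point is a combination of those of the \<open>g b\<close>. This is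
  linear in \<open>f\<close>, hence passes from coefficients in \<open>F\<close> to the closure by
  descent.\<close>

lemma exists_frame:
  obtains B h g where "B \<subseteq> V" "frame B h g"
    "\<And>f v. f \<in> vanishing_ideal V X \<Longrightarrow> v \<in> V \<Longrightarrow>
       mpoly_eval h x0 * mpoly_deriv_eval v f x0 =
       (\<Sum>b\<in>B. mpoly_deriv_eval b f x0 * mpoly_deriv_eval v (g b) x0)"
proof -
  let ?\<F> = "{B. B \<subseteq> V \<and> (\<exists>h g. frame B h g)}"
  have fin: "finite ?\<F>" using V by (intro finite_subset[of ?\<F> "Pow V"]) auto
  have "frame {} 1 (\<lambda>_. 0)" by (simp add: frame_def R_closed)
  then have "{} \<in> ?\<F>" by blast
  then have ne: "?\<F> \<noteq> {}" by (rule ex_in_conv[THEN iffD1, OF exI])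
  obtain B where B: "B \<in> ?\<F>" and max: "\<forall>B'\<in>?\<F>. B \<subseteq> B' \<longrightarrow> B = B'"
    using finite_has_maximal[OF fin ne] by (elim bexE)
  then obtain h g where fr: "frame B h g" by auto
  have BV: "B \<subseteq> V" using B by simp
  have fB: "finite B" using V BV by (rule rev_finite_subset)
  have key: "mpoly_eval h x0 * mpoly_deriv_eval v f x0 =
       (\<Sum>b\<in>B. mpoly_deriv_eval b f x0 * mpoly_deriv_eval v (g b) x0)" if v: "v \<in> V" and f: "f \<in> I \<inter> R" for f v
  proof -
    define f' where "f' = h * f - (\<Sum>b\<in>B. mderiv b f * g b)"
    have g: "\<And>b. b \<in> B \<Longrightarrow> g b \<in> I" "\<And>b. b \<in> B \<Longrightarrow> g b \<in> R" "h \<in> R"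
      using fr by (auto simp: frame_def)
    have f': "f' \<in> I \<inter> R"
      unfolding f'_def using f g F(1)
      by (auto intro!: diff mult_left sum R_closed polys_over_sum)
    have d: "mderiv u f' = (h * mderiv u f - (\<Sum>b\<in>B. mderiv b f * mderiv u (g b))) +
       (mderiv u h * f - (\<Sum>b\<in>B. mderiv u (mderiv b f) * g b))" for u
      by (simp add: f'_def mderiv_mult sum.distrib algebra_simps)
    have rest: "mderiv u h * f - (\<Sum>b\<in>B. mderiv u (mderiv b f) * g b) \<in> I" for u
      using f g by (intro diff sum mult_left) auto
    have van: "mderiv u f' \<in> I" if u: "u \<in> B" for u
    proof -
      have "(\<Sum>b\<in>B. mderiv b f * (mderiv u (g b) - (if u = b then h else 0))) \<in> I"
        using fr u by (intro sum mult_left) (auto simp: frame_def)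
      also have "(\<Sum>b\<in>B. mderiv b f * (mderiv u (g b) - (if u = b then h else 0))) =
          (\<Sum>b\<in>B. mderiv b f * mderiv u (g b)) - (\<Sum>b\<in>B. if u = b then mderiv b f * h else 0)"
        unfolding sum_subtractf[symmetric] by (intro sum.cong) (auto simp: right_diff_distrib)
      also have "(\<Sum>b\<in>B. if u = b then mderiv b f * h else 0) = mderiv u f * h"
        using u fB by simp
      also have "(\<Sum>b\<in>B. mderiv b f * mderiv u (g b)) - mderiv u f * h =
          - (h * mderiv u f - (\<Sum>b\<in>B. mderiv b f * mderiv u (g b)))"
        by (simp add: mult.commute)
      finally have "- (h * mderiv u f - (\<Sum>b\<in>B. mderiv b f * mderiv u (g b))) \<in> I" .
      from uminus[OF this] have "h * mderiv u f - (\<Sum>b\<in>B. mderiv b f * mderiv u (g b)) \<in> I"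
        by (simp only: minus_minus)
      then show ?thesis unfolding d using rest by (rule add)
    qed
    have "mpoly_eval (mderiv v f') x0 = 0"
    proof (rule ccontr)
      assume nz: "mpoly_eval (mderiv v f') x0 \<noteq> 0"
      then have "v \<notin> B" using van vanish_x0 by blast
      then have "insert v B \<in> ?\<F>" using frame_extend[OF fr f' _ nz van] BV v by blast
      with max have "B \<subseteq> insert v B \<longrightarrow> B = insert v B" by (rule bspec)
      then show False using \<open>v \<notin> B\<close> by blast
    qed
    then have "mpoly_eval (h * mderiv v f - (\<Sum>b\<in>B. mderiv b f * mderiv v (g b))) x0 = 0"
      unfolding d using vanish_x0[OF rest[of v]] by (simp only: mpoly_eval_add) simp
    then show ?thesis by (simp add: mpoly_eval_mderiv)
  qed
  have "mpoly_eval h x0 * mpoly_deriv_eval v f x0 =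
       (\<Sum>b\<in>B. mpoly_deriv_eval b f x0 * mpoly_deriv_eval v (g b) x0)"
    if f: "f \<in> vanishing_ideal V X" and v: "v \<in> V" for f v
  proof -
    let ?P = "\<lambda>f. mpoly_eval h x0 * mpoly_eval (mderiv v f) x0 =
       (\<Sum>b\<in>B. mpoly_eval (mderiv b f) x0 * mpoly_eval (mderiv v (g b)) x0)"
    have "f \<in> I \<inter> polys_in V" using f by (simp add: vanishing_ideal_eq)
    then have "?P f"
    proof (rule descent_induct[OF F X(2), where P="?P"])
      show "?P a" if "a \<in> I \<inter> R" for a
        using key[OF v that] by (simp add: mpoly_eval_mderiv)
      show "?P (a + b)" if "?P a" "?P b" for a b
        using that by (simp add: distrib_left distrib_right sum.distrib)
      show "?P (mconst c * a)" if "?P a" for a c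
      proof -
        have "mpoly_eval h x0 * mpoly_eval (mderiv v (mconst c * a)) x0 =
            c * (mpoly_eval h x0 * mpoly_eval (mderiv v a) x0)"
          by (simp add: mderiv_mult mult.left_commute)
        then show ?thesis unfolding that by (simp add: mderiv_mult sum_distrib_left mult.assoc)
      qed
    qed simp
    then show ?thesis by (simp add: mpoly_eval_mderiv)
  qed
  then show ?thesis using that BV fr by blast
qed

text \<open>By \<open>key\<close> the tangent space at the point is the common kernel of the
  differentials of the \<open>g b\<close>, and nonsingularity identifies its dimension.\<close>

lemma card_pivots:
  assumes B: "B \<subseteq> V" and fr: "frame B h g"
    and key: "\<And>f v. f \<in> vanishing_ideal V X \<Longrightarrow> v \<in> V \<Longrightarrow>
       mpoly_eval h x0 * mpoly_deriv_eval v f x0 =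
       (\<Sum>b\<in>B. mpoly_deriv_eval b f x0 * mpoly_deriv_eval v (g b) x0)"
  shows "card (V - B) = var_dim V X"
proof -
  let ?h = "mpoly_eval h x0" and ?\<gamma> = "\<lambda>b v. mpoly_deriv_eval v (g b) x0"
  have h0: "?h \<noteq> 0" using fr by (simp add: frame_def)
  have gI: "g b \<in> vanishing_ideal V X" if "b \<in> B" for b
    using fr that by (auto simp: frame_def vanishing_ideal_eq dest: polys_over_in)
  have diag: "?\<gamma> b b' = (if b = b' then ?h else 0)" if "b \<in> B" "b' \<in> B" for b b'
  proof -
    have "mderiv b' (g b) - (if b' = b then h else 0) \<in> I" using fr that by (auto simp: frame_def)
    from vanish_x0[OF this] show ?thesis by (auto simp: mpoly_eval_mderiv split: if_splits)
  qed
  have "tangent_space V X x0 = {u \<in> aff V. \<forall>b\<in>B. (\<Sum>v\<in>V. ?\<gamma> b v * u v) = 0}" (is "_ = ?K")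
  proof
    show "tangent_space V X x0 \<subseteq> ?K" using gI by (auto simp: tangent_space_def)
    show "?K \<subseteq> tangent_space V X x0"
    proof
      fix u assume u: "u \<in> ?K"
      have "(\<Sum>v\<in>V. mpoly_deriv_eval v f x0 * u v) = 0" if f: "f \<in> vanishing_ideal V X" for f
      proof -
        have "?h * (\<Sum>v\<in>V. mpoly_deriv_eval v f x0 * u v) =
            (\<Sum>v\<in>V. (\<Sum>b\<in>B. mpoly_deriv_eval b f x0 * ?\<gamma> b v) * u v)"
          unfolding sum_distrib_left mult.assoc[symmetric] using key[OF f] by (intro sum.cong) auto
        also have "\<dots> = (\<Sum>b\<in>B. mpoly_deriv_eval b f x0 * (\<Sum>v\<in>V. ?\<gamma> b v * u v))"
          unfolding sum_distrib_left sum_distrib_right by (subst sum.swap) (simp add: mult.assoc)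
        also have "\<dots> = 0" using u by simp
        finally show ?thesis using h0 by simp
      qed
      then show "u \<in> tangent_space V X x0" using u by (auto simp: tangent_space_def)
    qed
  qed
  then have "vdim (tangent_space V X x0) = card (V - B)"
    using vdim_solution_space[OF V B h0, of ?\<gamma>] diag by simp
  then show ?thesis using x0(3) by (simp add: nonsingular_point_def)
qed

lemma perfect_UNIV: "perfect_subfield (UNIV :: 'k set)"
proof (cases "\<forall>n::nat. n > 0 \<longrightarrow> (of_nat n :: 'k) \<noteq> 0")
  case False
  then obtain p where p: "prime p" "of_nat p = (0::'k)"
    using F(2) unfolding perfect_subfield_def by blast
  have "\<exists>b. b ^ p = a" for a :: 'k
  proof -
    have "p > 0" using p(1) by (rule prime_gt_0_nat)
    then have "degree (monom 1 p + [:- a:]) = p"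
      by (subst degree_add_eq_left) (auto simp: degree_monom_eq)
    then obtain z where "poly (monom 1 p + [:- a:]) z = 0"
      using F(3) \<open>p > 0\<close> unfolding is_algebraic_closure_of_def by metis
    then show ?thesis by (intro exI[of _ z]) (simp add: poly_monom)
  qed
  then show ?thesis using p unfolding perfect_subfield_def by auto
qed (simp add: perfect_subfield_def)

text \<open>At a generic point the values of the vector fields from \<open>exists_vector_fields\<close> span the common kernel of
  the differentials \<open>d g\<^sub>b\<close>, which has dimension \<open>card (V - B)\<close>. Hence fields annihilating the \<open>g\<^sub>b\<close> preserve \<open>I\<close>.\<close>

lemma frame_field_preserves:
  assumes B: "B \<subseteq> V" and fr: "frame B h g" and card: "card (V - B) = var_dim V X"
    and t: "t \<in> V - B" and f: "f \<in> I \<inter> polys_in V"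
  shows "vfield V (\<lambda>v. if v = t then h else if v \<in> B then - mderiv t (g v) else 0) f \<in> I"
proof -
  define \<xi> where "\<xi> v = (if v = t then h else if v \<in> B then - mderiv t (g v) else 0)" for v
  obtain T q c where T: "T \<subseteq> V" "q \<notin> I" and c0: "\<forall>t\<in>T. \<forall>u\<in>T. c t u = (if u = t then q else 0)"
    and pres: "\<forall>t\<in>T. \<forall>f\<in>I \<inter> polys_in V. vfield V (c t) f \<in> I" and growth: "growth_le V I V (card T)"
    using exists_vector_fields[OF perfect_UNIV V subset_refl] by (elim exE conjE)
  have fT: "finite T" and fB: "finite B" using V T(1) B by (auto intro: finite_subset)
  have "card (V - B) \<le> card T" using var_dim_le_growth[OF X(1) growth] card by simp
  \<comment> \<open>Points where \<open>q\<close> or \<open>h\<close> vanishes are absorbed by the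
    factor \<open>q * h\<close>, which primality removes at the end.\<close>
  have "mpoly_eval (q * h * vfield V \<xi> f) x = 0" if x: "x \<in> X" for x
  proof (cases "mpoly_eval q x = 0 \<or> mpoly_eval h x = 0")
    case False
    then have nz: "mpoly_eval q x \<noteq> 0" "mpoly_eval h x \<noteq> 0" by auto
    have van: "mpoly_eval p x = 0" if "p \<in> I" for p using that x by (simp add: ideal_of_def)
    let ?d = "\<lambda>v p. mpoly_eval (mderiv v p) x"
    have dg: "?d b' (g b) = (if b' = b then mpoly_eval h x else 0)" if "b \<in> B" "b' \<in> B" for b b'
    proof -
      have "mderiv b' (g b) - (if b' = b then h else 0) \<in> I" using fr that by (auto simp: frame_def)
      from van[OF this] show ?thesis by (auto split: if_splits)
    qed
    \<comment> \<open>The rows are the values at \<open>x\<close> of \<open>\<xi>\<close> and of the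
      fields \<open>c j\<close>; there are more of them than coordinates in
      \<open>V - B\<close>.\<close>
    define M where "M a v = (case a of None \<Rightarrow> mpoly_eval (\<xi> v) x | Some j \<Rightarrow> mpoly_eval (c j v) x)" for a v
    define A where "A = insert None (Some ` T)"
    have fA: "finite A" using fT by (simp add: A_def)
    have "card A = Suc (card T)" using fT by (simp add: A_def card_image)
    then have "card (V - B) < card A" using \<open>card (V - B) \<le> card T\<close> by simp
    then obtain \<mu> where mu: "\<exists>a\<in>A. \<mu> a \<noteq> 0" "\<And>s. s \<in> V - B \<Longrightarrow> (\<Sum>a\<in>A. \<mu> a * M a s) = 0"
      using exists_kernel_vector[of "V - B" A M] V fA by blast
    define w where "w v = (\<Sum>a\<in>A. \<mu> a * M a v)" for v
    have gI: "g b \<in> I \<inter> polys_in V" if "b \<in> B" for b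
      using fr that by (auto simp: frame_def dest: polys_over_in)
    have row: "(\<Sum>v\<in>V. M a v * ?d v (g b)) = 0" if a: "a \<in> A" and b: "b \<in> B" for a b
    proof (cases a)
      case (Some j)
      then have "j \<in> T" using a by (auto simp: A_def)
      then have "vfield V (c j) (g b) \<in> I" using pres gI[OF b] by blast
      from van[OF this] show ?thesis by (simp add: vfield_def M_def Some)
    next
      case None
      have "(\<Sum>v\<in>V. M a v * ?d v (g b)) =
          (\<Sum>v\<in>V. (if v = t then mpoly_eval h x * ?d t (g b) else 0) +
                  (if v \<in> B then - (?d t (g v) * ?d v (g b)) else 0))"
        using t by (intro sum.cong) (auto simp: None M_def \<xi>_def)
      also have "\<dots> = mpoly_eval h x * ?d t (g b) - (\<Sum>v\<in>B. ?d t (g v) * ?d v (g b))"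
        using t V B by (simp add: sum.distrib sum_negf flip: sum.inter_restrict) (simp add: Int_absorb1)
      also have "(\<Sum>v\<in>B. ?d t (g v) * ?d v (g b)) = (\<Sum>v\<in>B. if v = b then ?d t (g v) * mpoly_eval h x else 0)"
        using dg b by (intro sum.cong) auto
      also have "\<dots> = ?d t (g b) * mpoly_eval h x" using b fB by simp
      finally show ?thesis by simp
    qed
    have comb: "(\<Sum>v\<in>V. w v * ?d v p) = (\<Sum>a\<in>A. \<mu> a * (\<Sum>v\<in>V. M a v * ?d v p))" for p
      unfolding w_def sum_distrib_left sum_distrib_right
      by (subst sum.swap) (simp add: mult.assoc)
    \<comment> \<open>\<open>w\<close> vanishes on \<open>V - B\<close> by the choice of
      \<open>\<mu>\<close>; being annihilated by the rows \<open>g b\<close>, which are diagonal on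
      \<open>B\<close>, it vanishes on \<open>B\<close> too.\<close>
    have w0: "w v = 0" if v: "v \<in> V" for v
    proof (cases "v \<in> B")
      case True
      have "0 = (\<Sum>u\<in>V. w u * ?d u (g v))" unfolding comb using row True by simp
      also have "\<dots> = (\<Sum>u\<in>B. w u * ?d u (g v))"
        using mu(2) V B by (intro sum.mono_neutral_right) (auto simp: w_def)
      also have "\<dots> = (\<Sum>u\<in>B. if u = v then w u * mpoly_eval h x else 0)"
        using dg True by (intro sum.cong) auto
      also have "\<dots> = w v * mpoly_eval h x" using True fB by simp
      finally show ?thesis using nz by simp
    qed (use mu(2) v in \<open>auto simp: w_def\<close>)
    have sumA: "(\<Sum>a\<in>A. \<phi> a) = \<phi> None + (\<Sum>j\<in>T. \<phi> (Some j))" for \<phi> :: "'v option \<Rightarrow> 'k"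
      unfolding A_def using fT by (simp add: sum.reindex)
    \<comment> \<open>Otherwise the fields \<open>c j\<close> would be linearly dependent at
      \<open>x\<close>, but on \<open>T\<close> they form \<open>mpoly_eval q x\<close> times the
      identity.\<close>
    have "\<mu> None \<noteq> 0"
    proof
      assume n: "\<mu> None = 0"
      have "\<mu> (Some s) = 0" if s: "s \<in> T" for s
      proof -
        have "0 = w s" using w0 s T(1) by auto
        also have "\<dots> = (\<Sum>j\<in>T. \<mu> (Some j) * mpoly_eval (c j s) x)"
          unfolding w_def sumA n by (simp add: M_def)
        also have "\<dots> = (\<Sum>j\<in>T. if s = j then \<mu> (Some j) * mpoly_eval q x else 0)"
          using c0 s by (intro sum.cong) auto
        also have "\<dots> = \<mu> (Some s) * mpoly_eval q x" using s fT by simp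
        finally show ?thesis using nz by simp
      qed
      then show False using mu(1) n by (auto simp: A_def)
    qed
    have "0 = (\<Sum>v\<in>V. w v * ?d v f)" using w0 by simp
    also have "\<dots> = \<mu> None * mpoly_eval (vfield V \<xi> f) x + (\<Sum>j\<in>T. \<mu> (Some j) * mpoly_eval (vfield V (c j) f) x)"
      unfolding comb sumA by (simp add: M_def vfield_def)
    also have "(\<Sum>j\<in>T. \<mu> (Some j) * mpoly_eval (vfield V (c j) f) x) = 0"
      using pres f van by (intro sum.neutral) auto
    finally show ?thesis using \<open>\<mu> None \<noteq> 0\<close> by simp
  qed auto
  then have "q * h * vfield V \<xi> f \<in> I" by (simp add: ideal_of_def)
  moreover have "h \<notin> I" using fr vanish_x0 by (auto simp: frame_def)
  ultimately have "vfield V \<xi> f \<in> I" using T(2) prime by blast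
  moreover have "\<xi> = (\<lambda>v. if v = t then h else if v \<in> B then - mderiv t (g v) else 0)"
    by (simp add: \<xi>_def fun_eq_iff)
  ultimately show ?thesis by simp
qed

text \<open>Dividing by \<open>h\<close> is possible up to an error that vanishes to order \<open>N\<close> at the point:
  with \<open>e = 1 - h / h(x\<^sub>0)\<close> one has \<open>h \<cdot> (\<Sum>i<N. e\<^sup>i) / h(x\<^sub>0) = 1 - e\<^sup>N\<close>.\<close>

theorem exists_rational_fields:
  obtains B e z where "B \<subseteq> V" "card B = card V - var_dim V X"
    "mpoly_eval e x0 = 0"
    "\<And>t v. t \<in> V - B \<Longrightarrow> v \<in> V \<Longrightarrow> z t v \<in> polys_over F V"
    "\<And>t u. t \<in> V - B \<Longrightarrow> u \<in> V - B \<Longrightarrow> z t u = (if u = t then 1 - e ^ N else 0)"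
    "\<And>t f. t \<in> V - B \<Longrightarrow> f \<in> ideal_of X \<inter> polys_in V \<Longrightarrow> vfield V (z t) f \<in> ideal_of X"
proof -
  obtain B h g where B: "B \<subseteq> V" and fr: "frame B h g" and key: "\<And>f v. f \<in> vanishing_ideal V X \<Longrightarrow> v \<in> V \<Longrightarrow>
       mpoly_eval h x0 * mpoly_deriv_eval v f x0 =
       (\<Sum>b\<in>B. mpoly_deriv_eval b f x0 * mpoly_deriv_eval v (g b) x0)"
    using exists_frame by blast
  have card: "card (V - B) = var_dim V X" by (rule card_pivots[OF B fr key])
  define h0 where "h0 = mpoly_eval h x0"
  define e where "e = 1 - mconst (inverse h0) * h"
  define h' where "h' = mconst (inverse h0) * (\<Sum>i<N. e ^ i)"
  have hR: "h \<in> R" "h0 \<noteq> 0" using fr by (auto simp: frame_def h0_def)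
  have "h0 \<in> F" unfolding h0_def using hR(1) x0(2) F(1) by (intro polys_over_eval)
  then have cR: "mconst (inverse h0) \<in> R" using F(1) by (intro polys_over_mconst subfield_closed)
  have eR: "e \<in> R" unfolding e_def using hR cR by (intro R_closed)
  have h'R: "h' \<in> R" unfolding h'_def using F(1) cR eR by (intro R_closed polys_over_sum polys_over_power)
  have "h' * h = (1 - e) * (\<Sum>i<N. e ^ i)" by (simp add: h'_def e_def algebra_simps)
  also have "\<dots> = 1 - e ^ N" by (rule one_diff_power_eq[symmetric])
  finally have hh': "h' * h = 1 - e ^ N" .
  define \<xi> where "\<xi> t v = (if v = t then h else if v \<in> B then - mderiv t (g v) else 0)" for t v
  have gR: "g b \<in> R" if "b \<in> B" for b using fr that by (auto simp: frame_def)
  have \<xi>R: "\<xi> t v \<in> R" for t v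
    using hR(1) gR R_closed(2)[OF R_closed(5) R_closed(3)[OF gR]] by (auto simp: \<xi>_def R_closed)
  show ?thesis
  proof (rule that[of B e "\<lambda>t v. h' * \<xi> t v"])
    show "card B = card V - var_dim V X"
      using card_Diff_subset[of B V] card_mono[OF V B] finite_subset[OF B V] B card by simp
    show "mpoly_eval e x0 = 0" using hR by (simp add: e_def h0_def)
    show "h' * \<xi> t v \<in> polys_over F V" for t v using \<xi>R h'R by (intro R_closed)
    show "h' * \<xi> t u = (if u = t then 1 - e ^ N else 0)" if "t \<in> V - B" "u \<in> V - B" for t u
      using that hh' by (auto simp: \<xi>_def)
    show "vfield V (\<lambda>v. h' * \<xi> t v) f \<in> I" if t: "t \<in> V - B" and f: "f \<in> I \<inter> polys_in V" for t f
    proof -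
      have "vfield V (\<lambda>v. h' * \<xi> t v) f = h' * vfield V (\<xi> t) f"
        by (simp add: vfield_def sum_distrib_left mult.assoc)
      moreover have "vfield V (\<xi> t) f \<in> I"
        using frame_field_preserves[OF B fr card t f] unfolding \<xi>_def[abs_def] .
      ultimately show ?thesis by (simp add: mult_left)
    qed
  qed (rule B)
qed

end

section \<open>Squarefree coefficients\<close>

definition sqf :: "'v set \<Rightarrow> 'v \<Rightarrow>\<^sub>0 nat" where
  "sqf U = (\<Sum>v\<in>U. Poly_Mapping.single v 1)"

definition sqf_coeff :: "'v set \<Rightarrow> ('v, 'k::zero) mpoly \<Rightarrow> 'k" where
  "sqf_coeff U p = Poly_Mapping.lookup p (sqf U)"

text \<open>Congruence modulo the ideal generated by all squares of variables.\<close>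

definition sqf_cong :: "('v, 'k::zero) mpoly \<Rightarrow> ('v, 'k) mpoly \<Rightarrow> bool" where
  "sqf_cong p q \<longleftrightarrow> (\<forall>U. finite U \<longrightarrow> sqf_coeff U p = sqf_coeff U q)"

lemma lookup_sqf: "finite U \<Longrightarrow> Poly_Mapping.lookup (sqf U) v = (if v \<in> U then 1 else 0)"
  by (simp add: sqf_def lookup_sum lookup_single when_def)

lemma sqf_eq_iff: 
  assumes "finite U" "finite W"
  shows "sqf U = sqf W \<longleftrightarrow> U = W"
proof
  assume eq: "sqf U = sqf W"
  have "v \<in> U \<longleftrightarrow> v \<in> W" for v
    using arg_cong[OF eq, of "\<lambda>m. Poly_Mapping.lookup m v"] assms
    by (simp add: lookup_sqf split: if_splits)
  then show "U = W" by blast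
qed simp

lemma sqf_Diff: "finite U \<Longrightarrow> W \<subseteq> U \<Longrightarrow> sqf W + sqf (U - W) = sqf U"
  by (simp add: sqf_def sum.subset_diff add.commute)

lemma sqf_coeff_add: "sqf_coeff U (p + q) = sqf_coeff U p + sqf_coeff U q"
  by (simp add: sqf_coeff_def lookup_add)

lemma sqf_coeff_sum: "sqf_coeff U (sum f A) = (\<Sum>a\<in>A. sqf_coeff U (f a))"
  by (simp add: sqf_coeff_def lookup_sum)

lemma sqf_coeff_diff: "sqf_coeff U (p - q) = sqf_coeff U p - sqf_coeff U (q :: ('v, 'k::field) mpoly)"
  by (simp add: sqf_coeff_def lookup_minus)

text \<open>A factorisation of a squarefree monomial splits its variables into two disjoint sets, so
  higher powers in \<open>p\<close> and \<open>q\<close> never contribute.\<close>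

lemma sqf_coeff_mult:
  fixes p q :: "('v, 'k::field) mpoly"
  assumes U: "finite U"
  shows "sqf_coeff U (p * q) = (\<Sum>W\<in>Pow U. sqf_coeff W p * sqf_coeff (U - W) q)"
proof (induction p rule: mpoly_induct)
  case (single m c)
  show ?case
  proof (induction q rule: mpoly_induct)
    case (single n a)
    have fin: "finite W" if "W \<in> Pow U" for W using U that by (auto intro: finite_subset)
    show ?case
    proof (cases "m + n = sqf U")
      case True
      define W0 where "W0 = {v \<in> U. Poly_Mapping.lookup m v = 1}"
      have W0: "W0 \<in> Pow U" by (auto simp: W0_def)
      have sum: "Poly_Mapping.lookup m v + Poly_Mapping.lookup n v = (if v \<in> U then 1 else 0)" for v
        using arg_cong[OF True, of "\<lambda>l. Poly_Mapping.lookup l v"] U by (simp add: lookup_add lookup_sqf)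
      have m: "m = sqf W0"
      proof (rule poly_mapping_eqI)
        fix v
        have "Poly_Mapping.lookup m v = (if v \<in> W0 then 1 else 0)"
          using sum[of v] by (auto simp: W0_def split: if_splits)
        then show "Poly_Mapping.lookup m v = Poly_Mapping.lookup (sqf W0) v"
          using fin[OF W0] by (simp add: lookup_sqf)
      qed
      have n: "n = sqf (U - W0)"
        using sqf_Diff[OF U, of W0] W0 True unfolding m by (metis PowD add_left_imp_eq)
      have "(\<Sum>W\<in>Pow U. sqf_coeff W (Poly_Mapping.single m c) * sqf_coeff (U - W) (Poly_Mapping.single n a)) =
         (\<Sum>W\<in>Pow U. if W = W0 then c * a else 0)"
      proof (intro sum.cong refl)
        fix W assume W: "W \<in> Pow U"
        show "sqf_coeff W (Poly_Mapping.single m c) * sqf_coeff (U - W) (Poly_Mapping.single n a) =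
          (if W = W0 then c * a else 0)"
          using sqf_eq_iff[OF fin[OF W] fin[OF W0]]
          by (auto simp: sqf_coeff_def m n lookup_single when_def)
      qed
      also have "\<dots> = c * a" using W0 U by (subst sum.delta) auto
      finally show ?thesis by (simp add: sqf_coeff_def mult_single True)
    next
      case False
      have "(\<Sum>W\<in>Pow U. sqf_coeff W (Poly_Mapping.single m c) * sqf_coeff (U - W) (Poly_Mapping.single n a)) = 0"
        using False sqf_Diff[OF U] by (intro sum.neutral) (auto simp: sqf_coeff_def lookup_single when_def)
      then show ?thesis using False by (simp add: sqf_coeff_def mult_single lookup_single when_def)
    qed
  qed (simp add: sqf_coeff_add algebra_simps sum.distrib)
qed (simp add: sqf_coeff_add algebra_simps sum.distrib)

lemma sqf_cong_refl: "sqf_cong p p"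
  by (simp add: sqf_cong_def)

lemma sqf_cong_mult: "sqf_cong p p' \<Longrightarrow> sqf_cong q q' \<Longrightarrow> sqf_cong (p * q) (p' * q')"
  for p :: "('v, 'k::field) mpoly"
  unfolding sqf_cong_def by (auto simp: sqf_coeff_mult finite_subset intro!: sum.cong)

lemma sqf_cong_trans: "sqf_cong p q \<Longrightarrow> sqf_cong q r \<Longrightarrow> sqf_cong p r"
  by (simp add: sqf_cong_def)

lemma sqf_coeff_mvar: "finite U \<Longrightarrow> sqf_coeff U (mvar v :: ('v, 'k::field) mpoly) = (if U = {v} then 1 else 0)"
  using sqf_eq_iff[of "{v}" U] by (auto simp: sqf_coeff_def mvar_def lookup_single when_def sqf_def)

lemma sqf_coeff_mconst: "finite U \<Longrightarrow> sqf_coeff U (mconst c) = (if U = {} then c else 0)"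
  using sqf_eq_iff[of "{}" U] by (auto simp: sqf_coeff_def mconst_def lookup_single when_def sqf_def)

lemma sqf_coeff_mconst_mult: "sqf_coeff U (mconst c * p) = c * sqf_coeff U (p :: ('v, 'k::field) mpoly)"
  by (simp add: sqf_coeff_def)

lemma sqf_coeff_mvar_mult:
  assumes U: "finite U"
  shows "sqf_coeff U (mvar v * p) = (if v \<in> U then sqf_coeff (U - {v}) (p :: ('v, 'k::field) mpoly) else 0)"
proof -
  have "sqf_coeff U (mvar v * p) = (\<Sum>W\<in>Pow U. if W = {v} then sqf_coeff (U - W) p else 0)"
    unfolding sqf_coeff_mult[OF U] using U
    by (intro sum.cong) (auto simp: sqf_coeff_mvar finite_subset)
  also have "\<dots> = (if v \<in> U then sqf_coeff (U - {v}) p else 0)"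
    using U by (subst sum.delta) auto
  finally show ?thesis .
qed

text \<open>As \<open>U\<close> has at least as many elements as there are factors, only the choice
  of the variable in every factor can contribute, and the constants \<open>c\<close> drop
  out.\<close>

lemma sqf_coeff_linear_factors:
  fixes c :: "'v \<Rightarrow> 'k::field"
  assumes "finite A" "inj_on v A" "finite U" "card A \<le> card U"
  shows "sqf_coeff U (\<Prod>i\<in>A. mconst (c (v i)) + mvar (v i)) = (if U = v ` A then 1 else 0)"
  using assms
proof (induction A arbitrary: U rule: finite_induct)
  case empty
  have "sqf_coeff U (1 :: ('v, 'k) mpoly) = (if U = {} then 1 else 0)"
    using sqf_coeff_mconst[of U "1 :: 'k"] empty by (simp only: mconst_1)
  then show ?case by simp
next
  case (insert a A)
  let ?p = "\<Prod>i\<in>A. mconst (c (v i)) + mvar (v i)"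
  have ca: "card A < card U" using insert by simp
  have va: "v a \<notin> v ` A" using insert by auto
  have cv: "card (v ` A) = card A" using insert by (intro card_image) auto
  have 1: "sqf_coeff U ?p = 0" using insert.IH[of U] insert.prems ca cv by auto
  have 2: "sqf_coeff (U - {v a}) ?p = (if U - {v a} = v ` A then 1 else 0)" if "v a \<in> U"
    using insert.IH[of "U - {v a}"] insert.prems ca that by simp
  have "sqf_coeff U (\<Prod>i\<in>insert a A. mconst (c (v i)) + mvar (v i)) =
      c (v a) * sqf_coeff U ?p + (if v a \<in> U then sqf_coeff (U - {v a}) ?p else 0)"
    using insert by (simp add: distrib_right sqf_coeff_add sqf_coeff_mconst_mult sqf_coeff_mvar_mult)
  also have "\<dots> = (if U = v ` insert a A then 1 else 0)"
    using 1 2 va by auto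
  finally show ?case .
qed

section \<open>Iterated derivations\<close>

text \<open>The list fixes the order of application, its head coming last, because the derivations
  need not commute; \<open>M\<close> selects which of them are applied.\<close>

primrec iter_deriv :: "('v \<Rightarrow> 'a \<Rightarrow> 'a) \<Rightarrow> 'v list \<Rightarrow> 'v set \<Rightarrow> 'a \<Rightarrow> 'a" where
  "iter_deriv D [] M f = f"
| "iter_deriv D (t # ts) M f = (if t \<in> M then D t (iter_deriv D ts M f) else iter_deriv D ts M f)"

lemma iter_deriv_cong: "M \<inter> set ts = M' \<inter> set ts \<Longrightarrow> iter_deriv D ts M f = iter_deriv D ts M' f"
proof (induction ts)
  case (Cons t ts)
  then have "t \<in> M \<longleftrightarrow> t \<in> M'" "M \<inter> set ts = M' \<inter> set ts" by auto
  then show ?case using Cons.IH by simp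
qed simp

lemma iter_deriv_preserves:
  "f \<in> S \<Longrightarrow> (\<And>t g. t \<in> set ts \<Longrightarrow> g \<in> S \<Longrightarrow> D t g \<in> S) \<Longrightarrow> iter_deriv D ts M f \<in> S"
  by (induction ts) auto

lemma sum_Pow_insert:
  assumes "finite M" "t \<notin> M"
  shows "(\<Sum>W\<in>Pow (insert t M). \<phi> W) = (\<Sum>W\<in>Pow M. \<phi> W + \<phi> (insert t W))"
proof -
  have "inj_on (insert t) (Pow M)" using assms(2) by (intro inj_onI) (metis PowD insert_ident subsetD)
  then have "(\<Sum>W\<in>insert t ` Pow M. \<phi> W) = (\<Sum>W\<in>Pow M. \<phi> (insert t W))"
    by (simp add: sum.reindex)
  moreover have "Pow M \<inter> insert t ` Pow M = {}" using assms(2) by auto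
  ultimately show ?thesis
    unfolding Pow_insert using assms(1) by (subst sum.union_disjoint) (auto simp: sum.distrib)
qed

text \<open>Each derivation occurs once and hits one of the two factors, so the choices are the
  subsets of \<open>M\<close>, without multiplicities. Both factors inherit the order of the list,
  which is why no commutation is required.\<close>

lemma iter_deriv_mult:
  fixes D :: "'v \<Rightarrow> 'a::comm_ring_1 \<Rightarrow> 'a"
  assumes D: "\<And>t. t \<in> set ts \<Longrightarrow> derivation (D t)" and ts: "distinct ts" "M \<subseteq> set ts"
  shows "iter_deriv D ts M (f * g) = (\<Sum>W\<in>Pow M. iter_deriv D ts W f * iter_deriv D ts (M - W) g)"
  using assms
proof (induction ts arbitrary: M)
  case (Cons t ts)
  have tts: "t \<notin> set ts" using Cons.prems by simp
  show ?case
  proof (cases "t \<in> M")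
    case False
    then have "M \<subseteq> set ts" using Cons.prems by auto
    then show ?thesis using Cons.IH[of M] Cons.prems False by (auto intro!: sum.cong)
  next
    case True
    define M' where "M' = M - {t}"
    have M': "M = insert t M'" "t \<notin> M'" "M' \<subseteq> set ts" "finite M'"
      using True Cons.prems finite_subset[of M' "set ts"] by (auto simp: M'_def)
    let ?A = "\<lambda>W. iter_deriv D ts W f" and ?B = "\<lambda>W. iter_deriv D ts W g"
    have dt: "derivation (D t)" using Cons.prems by simp
    have ins: "iter_deriv D ts (insert t W) h = iter_deriv D ts W h" for W h
      using tts by (intro iter_deriv_cong) auto
    have "iter_deriv D (t # ts) M (f * g) = D t (iter_deriv D ts M' (f * g))"
      using ins by (simp add: M'(1))
    also have "\<dots> = (\<Sum>W\<in>Pow M'. D t (?A W) * ?B (M' - W) + ?A W * D t (?B (M' - W)))"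
      using Cons.IH[OF _ _ M'(3)] Cons.prems
      by (simp add: derivation_sum[OF dt] derivation_mult[OF dt])
    also have "\<dots> = (\<Sum>W\<in>Pow M'. iter_deriv D (t # ts) W f * iter_deriv D (t # ts) (M - W) g +
        iter_deriv D (t # ts) (insert t W) f * iter_deriv D (t # ts) (M - insert t W) g)"
    proof (intro sum.cong refl)
      fix W assume "W \<in> Pow M'"
      then have W: "t \<notin> W" "M - W = insert t (M' - W)" "M - insert t W = M' - W" using M' by auto
      show "D t (?A W) * ?B (M' - W) + ?A W * D t (?B (M' - W)) =
        iter_deriv D (t # ts) W f * iter_deriv D (t # ts) (M - W) g +
        iter_deriv D (t # ts) (insert t W) f * iter_deriv D (t # ts) (M - insert t W) g"
        unfolding W(2,3) using W(1) M'(2) by (simp add: ins add.commute)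
    qed
    also have "\<dots> = (\<Sum>W\<in>Pow M. iter_deriv D (t # ts) W f * iter_deriv D (t # ts) (M - W) g)"
      unfolding M'(1) by (rule sum_Pow_insert[symmetric]) (use M' in auto)
    finally show ?thesis .
  qed
qed simp

lemma derivation_power_dvd:
  fixes e :: "'a::comm_ring_1"
  assumes D: "derivation D" and p: "e ^ Suc n dvd p"
  shows "e ^ n dvd D p"
proof -
  have pw: "e ^ n dvd D (e ^ Suc n)" for n
  proof (induction n)
    case (Suc n)
    have "D (e ^ Suc (Suc n)) = D e * e ^ Suc n + e * D (e ^ Suc n)"
      using derivation_mult[OF D, of e "e ^ Suc n"] by simp
    moreover have "e ^ Suc n dvd e * D (e ^ Suc n)" using Suc by (simp add: mult_dvd_mono)
    ultimately show ?case by (simp only: dvd_add dvd_triv_right)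
  qed simp
  obtain a where "p = e ^ Suc n * a" using p by (rule dvdE)
  then have "D p = D (e ^ Suc n) * a + e ^ Suc n * D a" by (simp only: derivation_mult[OF D])
  moreover have "e ^ n dvd e ^ Suc n" by (rule le_imp_power_dvd) simp
  ultimately show ?thesis using pw[of n] by (simp only: dvd_add dvd_mult2)
qed

locale flow =
  fixes D :: "'v \<Rightarrow> ('v, 'k::field) mpoly \<Rightarrow> ('v, 'k) mpoly" and ts :: "'v list" and x0 :: "'v \<Rightarrow> 'k"
  assumes D: "\<And>t. t \<in> set ts \<Longrightarrow> derivation (D t)" and scale: "\<And>t c f. t \<in> set ts \<Longrightarrow> D t (mconst c * f) = mconst c * D t f"
    and ts: "distinct ts"
begin

text \<open>The Taylor expansion at \<open>x0\<close> along the composed flows of the fields, cut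
  off at first order in each parameter. The parameters are named by the variables themselves, so the
  result can be compared with coordinates.\<close>

definition flow :: "('v, 'k) mpoly \<Rightarrow> ('v, 'k) mpoly" where
  "flow f = (\<Sum>M\<in>Pow (set ts). Poly_Mapping.single (sqf M) (mpoly_eval (iter_deriv D ts M f) x0))"

lemma sqf_coeff_flow:
  assumes U: "finite U"
  shows "sqf_coeff U (flow f) = (if U \<subseteq> set ts then mpoly_eval (iter_deriv D ts U f) x0 else 0)"
proof -
  have "sqf_coeff U (flow f) = (\<Sum>M\<in>Pow (set ts). if M = U then mpoly_eval (iter_deriv D ts M f) x0 else 0)"
    unfolding flow_def sqf_coeff_sum
    by (intro sum.cong refl)
      (use U in \<open>auto simp: sqf_coeff_def lookup_single when_def sqf_eq_iff finite_subset\<close>)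
  then show ?thesis by (simp add: sum.delta)
qed

text \<open>The Leibniz rule over subsets is the same convolution as the product formula for
  squarefree coefficients.\<close>

lemma flow_mult: "sqf_cong (flow (f * g)) (flow f * flow g)"
  unfolding sqf_cong_def
proof (intro allI impI)
  fix U :: "'v set" assume U: "finite U"
  have fin: "finite W" if "W \<subseteq> U" for W using U that by (rule rev_finite_subset)
  have R: "sqf_coeff U (flow f * flow g) =
    (\<Sum>W\<in>Pow U. sqf_coeff W (flow f) * sqf_coeff (U - W) (flow g))" by (rule sqf_coeff_mult[OF U])
  show "sqf_coeff U (flow (f * g)) = sqf_coeff U (flow f * flow g)"
  proof (cases "U \<subseteq> set ts")
    case True
    have "sqf_coeff U (flow (f * g)) =
        (\<Sum>W\<in>Pow U. mpoly_eval (iter_deriv D ts W f) x0 * mpoly_eval (iter_deriv D ts (U - W) g) x0)"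
      using True by (simp add: sqf_coeff_flow[OF U] iter_deriv_mult[OF D ts True])
    also have "\<dots> = sqf_coeff U (flow f * flow g)"
      unfolding R using True by (intro sum.cong refl) (auto simp: sqf_coeff_flow fin)
    finally show ?thesis .
  next
    case False
    have "sqf_coeff W (flow f) * sqf_coeff (U - W) (flow g) = 0" if "W \<in> Pow U" for W
    proof -
      have "\<not> W \<subseteq> set ts \<or> \<not> U - W \<subseteq> set ts" using False by blast
      then show ?thesis using that by (auto simp: sqf_coeff_flow fin)
    qed
    then have "sqf_coeff U (flow f * flow g) = 0" unfolding R by (rule sum.neutral[OF ballI])
    then show ?thesis using False by (simp add: sqf_coeff_flow[OF U])
  qed
qed

lemma flow_1: "sqf_cong (flow 1) 1"
  unfolding sqf_cong_def
proof (intro allI impI)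
  fix U :: "'v set" assume U: "finite U"
  have "iter_deriv D us U 1 = (if U \<inter> set us = {} then 1 else 0)" if "set us \<subseteq> set ts" for us
    using that D by (induction us) (auto simp: derivation_1 derivation_0)
  then show "sqf_coeff U (flow 1) = sqf_coeff U 1"
    using sqf_coeff_mconst[OF U, of "1::'k"] by (auto simp: sqf_coeff_flow[OF U])
qed

lemma flow_prod: "sqf_cong (flow (\<Prod>i\<in>A. f i)) (\<Prod>i\<in>A. flow (f i))"
proof (induction A rule: infinite_finite_induct)
  case (insert a A)
  have "sqf_cong (flow (f a * prod f A)) (flow (f a) * (\<Prod>i\<in>A. flow (f i)))"
    by (rule sqf_cong_trans[OF flow_mult sqf_cong_mult[OF sqf_cong_refl insert.IH]])
  then show ?case using insert by simp
qed (use flow_1 in auto)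

lemma flow_sum: "flow (\<Sum>i\<in>A. mconst (c i) * f i) = (\<Sum>i\<in>A. mconst (c i) * flow (f i))"
proof -
  have 1: "iter_deriv D us M (\<Sum>i\<in>A. mconst (c i) * f i) = (\<Sum>i\<in>A. mconst (c i) * iter_deriv D us M (f i))"
    if "set us \<subseteq> set ts" for us M
    using that by (induction us) (simp_all add: derivation_sum[OF D] scale)
  have 2: "Poly_Mapping.single m (\<Sum>i\<in>A. a i) = (\<Sum>i\<in>A. Poly_Mapping.single m (a i))" for m :: "'v \<Rightarrow>\<^sub>0 nat" and a :: "_ \<Rightarrow> 'k"
    by (induction A rule: infinite_finite_induct) (auto simp: single_add)
  have 3: "Poly_Mapping.single m (a * b) = mconst a * Poly_Mapping.single m b" for m :: "'v \<Rightarrow>\<^sub>0 nat" and a b :: 'k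
    by (simp add: mconst_def mult_single)
  show ?thesis
    unfolding flow_def sum_distrib_left by (subst sum.swap) (simp add: 1 2 3)
qed

lemma flow_eq_0:
  assumes f: "f \<in> S" and S: "\<And>t g. t \<in> set ts \<Longrightarrow> g \<in> S \<Longrightarrow> D t g \<in> S" "\<And>g. g \<in> S \<Longrightarrow> mpoly_eval g x0 = 0"
  shows "flow f = 0"
proof -
  have "iter_deriv D ts M f \<in> S" for M by (rule iter_deriv_preserves[OF f S(1)])
  then show ?thesis unfolding flow_def using S(2) by simp
qed

lemma flow_rational:
  assumes F: "subfield F" and f: "f \<in> S" and S: "\<And>t g. t \<in> set ts \<Longrightarrow> g \<in> S \<Longrightarrow> D t g \<in> S"
    "\<And>g. g \<in> S \<Longrightarrow> mpoly_eval g x0 \<in> F"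
  shows "flow f \<in> polys_over F UNIV"
proof -
  have "iter_deriv D ts M f \<in> S" for M by (rule iter_deriv_preserves[OF f S(1)])
  then have "mpoly_eval (iter_deriv D ts M f) x0 \<in> F" for M by (rule S(2))
  then show ?thesis
    unfolding flow_def using F
    by (intro polys_over_sum) (auto simp: polys_over_def lookup_single when_def intro: subfield_closed)
qed

text \<open>The first derivation applied to \<open>mvar v\<close> gives 0 or
  \<open>1 - e ^ N\<close>. Every further one lowers the power of \<open>e\<close> dividing the
  error by at most one, and \<open>length ts < N\<close> leaves a factor \<open>e\<close>, which
  vanishes at \<open>x0\<close>.\<close>

lemma flow_mvar:
  assumes e: "mpoly_eval e x0 = 0" 
    and coord: "\<And>t u. t \<in> set ts \<Longrightarrow> u \<in> set ts \<Longrightarrow> D t (mvar u) = (if u = t then 1 - e ^ N else 0)"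
    and v: "v \<in> set ts" and N: "length ts < N"
  shows "sqf_cong (flow (mvar v)) (mconst (x0 v) + mvar v)"
proof -
  have claim: "if M \<inter> set us = {} then iter_deriv D us M (mvar v) = mvar v
     else if M \<inter> set us = {v} then iter_deriv D us M (mvar v) = 1 - e ^ N
     else e ^ (N - length us) dvd iter_deriv D us M (mvar v)"
    if "set us \<subseteq> set ts" "length us \<le> length ts" "distinct us" for us M
    using that
  proof (induction us)
    case (Cons t us)
    have t: "t \<in> set ts" and us: "set us \<subseteq> set ts" "length us \<le> length ts" "distinct us" using Cons.prems by auto
    note IH = Cons.IH[OF us]
    let ?p = "iter_deriv D us M (mvar v)"
    have mono: "e ^ (N - length (t # us)) dvd q" if "e ^ (N - length us) dvd q" for q
      by (rule dvd_trans[OF _ that]) (intro le_imp_power_dvd diff_le_mono2, simp)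
    show ?case
    proof (cases "t \<in> M")
      case False
      then have "M \<inter> set (t # us) = M \<inter> set us" by auto
      then show ?thesis using IH False mono by (auto split: if_splits)
    next
      case True
      have ne: "M \<inter> set (t # us) \<noteq> {}" using True by auto
      consider "M \<inter> set us = {}" | "M \<inter> set us = {v}" | "M \<inter> set us \<noteq> {}" "M \<inter> set us \<noteq> {v}" by blast
      then show ?thesis
      proof cases
        case 1
        then have "M \<inter> set (t # us) = {t}" using True by auto
        then show ?thesis using 1 IH True coord[OF t v] by auto
      next
        case 2
        have "e ^ (N - 1) dvd D t (e ^ N)" by (rule derivation_power_dvd[OF D[OF t]]) (use N in simp)
        then have "e ^ (N - length (t # us)) dvd D t (e ^ N)"
          by (rule dvd_trans[rotated]) (rule le_imp_power_dvd, simp)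
        moreover have "D t (1 - e ^ N) = - D t (e ^ N)"
          using derivation_diff[OF D[OF t], of 1 "e ^ N"] derivation_1[OF D[OF t]] by simp
        ultimately have "e ^ (N - length (t # us)) dvd D t (1 - e ^ N)"
          by (simp only: dvd_minus_iff)
        moreover have "iter_deriv D (t # us) M (mvar v) = D t (1 - e ^ N)"
          using 2 IH True by simp
        moreover have "M \<inter> set (t # us) \<noteq> {v}" using 2 True Cons.prems(3) by auto
        ultimately show ?thesis using ne by (simp only: if_False)
      next
        case 3
        have "N - length us = Suc (N - length (t # us))" using Cons.prems N by simp
        then have "e ^ Suc (N - length (t # us)) dvd ?p" using 3 IH by simp
        then have "e ^ (N - length (t # us)) dvd D t ?p" by (rule derivation_power_dvd[OF D[OF t]])
        moreover have "M \<inter> set (t # us) \<noteq> {v}" using 3 True Cons.prems(3) by auto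
        moreover have "iter_deriv D (t # us) M (mvar v) = D t ?p" using True by simp
        ultimately show ?thesis using ne by (simp only: if_False)
      qed
    qed
  qed simp
  show ?thesis
    unfolding sqf_cong_def
  proof (intro allI impI)
    fix U :: "'v set" assume U: "finite U"
    have R: "sqf_coeff U (mconst (x0 v) + mvar v) = (if U = {} then x0 v else 0) + (if U = {v} then 1 else 0)"
      by (simp add: sqf_coeff_add sqf_coeff_mconst[OF U] sqf_coeff_mvar[OF U])
    show "sqf_coeff U (flow (mvar v)) = sqf_coeff U (mconst (x0 v) + mvar v)"
    proof (cases "U \<subseteq> set ts")
      case True
      then have inter: "U \<inter> set ts = U" by blast
      have L: "sqf_coeff U (flow (mvar v)) = mpoly_eval (iter_deriv D ts U (mvar v)) x0"
        using True by (simp add: sqf_coeff_flow[OF U])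
      consider "U = {}" | "U = {v}" | "U \<noteq> {}" "U \<noteq> {v}" by blast
      then show ?thesis
        unfolding L R
      proof cases
        case 3
        then have "e ^ (N - length ts) dvd iter_deriv D ts U (mvar v)"
          using claim[of ts U] ts unfolding inter by simp
        then have "e dvd iter_deriv D ts U (mvar v)"
          by (rule dvd_trans[rotated]) (use N in \<open>simp add: dvd_power\<close>)
        then have "mpoly_eval (iter_deriv D ts U (mvar v)) x0 = 0" using e by (auto elim!: dvdE)
        then show "mpoly_eval (iter_deriv D ts U (mvar v)) x0 =
            (if U = {} then x0 v else 0) + (if U = {v} then 1 else 0)" using 3 by simp
      qed (use claim[of ts U] ts v e N in \<open>simp_all add: power_0_left\<close>)
    next
      case False
      then have "U \<noteq> {}" "U \<noteq> {v}" using v by auto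
      then show ?thesis using False by (simp add: sqf_coeff_flow[OF U] R)
    qed
  qed
qed

end

section \<open>Decomposition of the tensor\<close>

lemma prod_diff_telescope:
  fixes P Q :: "nat \<Rightarrow> 'a::comm_ring_1"
  shows "(\<Prod>i<n. P i) - (\<Prod>i<n. Q i) =
    (\<Sum>i<n. (\<Prod>l<i. P l) * (\<Prod>l\<in>{i<..<n}. Q l) * (P i - Q i))"
proof (induction n)
  case (Suc n)
  have "(\<Prod>l\<in>{i<..<Suc n}. Q l) = (\<Prod>l\<in>{i<..<n}. Q l) * Q n" if "i < n" for i
  proof -
    have "{i<..<Suc n} = insert n {i<..<n}" using that by auto
    then show ?thesis by (simp add: mult.commute)
  qed
  then have "(\<Sum>i<n. (\<Prod>l<i. P l) * (\<Prod>l\<in>{i<..<Suc n}. Q l) * (P i - Q i)) =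
      ((\<Prod>i<n. P i) - (\<Prod>i<n. Q i)) * Q n"
    unfolding Suc.IH sum_distrib_right by (intro sum.cong) auto
  moreover have "{n<..<Suc n} = {}" by auto
  ultimately show ?case by (simp add: algebra_simps)
qed simp

lemma finite_tidx: "finite (tidx k d)"
proof (rule finite_subset)
  let ?B = "\<Union>i<k. {..<d i}"
  show "tidx k d \<subseteq> {j. \<forall>i. (i \<in> {..<k} \<longrightarrow> j i \<in> ?B) \<and> (i \<notin> {..<k} \<longrightarrow> j i = 0)}"
    by (auto simp: tidx_def)
  show "finite {j. \<forall>i. (i \<in> {..<k} \<longrightarrow> j i \<in> ?B) \<and> (i \<notin> {..<k} \<longrightarrow> j i = 0)}"
    by (rule finite_set_of_finite_funs) auto
qed

lemma finite_slice_vars: "finite (slice_vars k d)"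
proof (rule finite_subset)
  show "slice_vars k d \<subseteq> (SIGMA i:{..<k - 1}. {..<d i})" by (auto simp: slice_vars_def)
qed auto

lemma slicing_poly_eq:
  "slicing_poly k d T c = (\<Sum>j\<in>{j \<in> tidx k d. j (k - 1) = c}. mconst (T j) * (\<Prod>i<k - 1. mvar (i, j i)))"
proof -
  have "(\<Prod>i\<in>A. mvar (i, j i)) = Poly_Mapping.single (\<Sum>i\<in>A. Poly_Mapping.single (i, j i) (1::nat)) (1::'a)"
    for A :: "nat set" and j :: "nat \<Rightarrow> nat"
    by (induction A rule: infinite_finite_induct) (simp_all add: mvar_def mult_single)
  then show ?thesis by (simp add: slicing_poly_def mconst_def mult_single)
qed

text \<open>The coefficient of a product at a squarefree monomial splits along the subsets \<open>S\<close> of the first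
  \<open>n\<close> axes. The last axis is attached to \<open>S\<close>, and \<open>S\<close> is proper because the second factor has no constant term.\<close>

lemma partition_rank_le_splitting:
  fixes T :: "(nat \<Rightarrow> nat) \<Rightarrow> 'k::field"
    and \<alpha> :: "nat \<Rightarrow> nat \<times> nat \<Rightarrow> (nat \<times> nat, 'k) mpoly" and \<gamma> :: "nat \<times> nat \<Rightarrow> (nat \<times> nat, 'k) mpoly"
  assumes B: "finite B" and rat: "\<And>c b. \<alpha> c b \<in> polys_over F UNIV" "\<And>b. b \<in> B \<Longrightarrow> \<gamma> b \<in> polys_over F UNIV"
    and T: "\<And>j. j \<in> tidx (Suc n) d \<Longrightarrow>
      T j = (\<Sum>b\<in>B. sqf_coeff ((\<lambda>i. (i, j i)) ` {..<n}) (\<alpha> (j n) b * \<gamma> b))"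
    and \<gamma>0: "\<And>b. b \<in> B \<Longrightarrow> sqf_coeff {} (\<gamma> b) = 0"
  shows "partition_rank F (Suc n) d T \<le> (2 ^ n - 1) * card B"
proof -
  define U where "U j S = (\<lambda>i. (i, j i)) ` S" for j :: "nat \<Rightarrow> nat" and S
  define \<Omega> where "\<Omega> = (Pow {..<n} - {{..<n}}) \<times> B"
  have fin: "finite \<Omega>" using B by (simp add: \<Omega>_def)
  have card: "card \<Omega> = (2 ^ n - 1) * card B"
    by (simp add: \<Omega>_def card_cartesian_product card_Diff_singleton card_Pow)
  obtain \<pi> where \<pi>: "bij_betw \<pi> {0..<card \<Omega>} \<Omega>" using ex_bij_betw_nat_finite[OF fin] by blast
  have \<pi>in: "fst (\<pi> l) \<subseteq> {..<n}" "fst (\<pi> l) \<noteq> {..<n}" "snd (\<pi> l) \<in> B" if "l < card \<Omega>" for l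
    using bij_betwE[OF \<pi>] that by (auto simp: \<Omega>_def mem_Times_iff)
  define S where "S l = insert n (fst (\<pi> l))" for l
  define P where "P l j = sqf_coeff (U j (fst (\<pi> l))) (\<alpha> (j n) (snd (\<pi> l)))" for l and j :: "nat \<Rightarrow> nat"
  define Q where "Q l j = sqf_coeff (U j ({..<n} - fst (\<pi> l))) (\<gamma> (snd (\<pi> l)))" for l and j :: "nat \<Rightarrow> nat"
  have "T j = (\<Sum>l<card \<Omega>. P l (restr_idx j (S l)) * Q l (restr_idx j ({..<Suc n} - S l)))"
    if j: "j \<in> tidx (Suc n) d" for j
  proof -
    have inj: "inj_on (\<lambda>i. (i, j i)) A" for A by (auto intro: inj_onI)
    have split: "sqf_coeff (U j {..<n}) (p * q) = (\<Sum>S\<in>Pow {..<n}. sqf_coeff (U j S) p * sqf_coeff (U j ({..<n} - S)) q)"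
      for p q :: "(nat \<times> nat, 'k) mpoly"
    proof -
      have "Pow (U j {..<n}) = U j ` Pow {..<n}" by (auto simp: U_def image_Pow_surj)
      moreover have "inj_on (U j) (Pow {..<n})"
        unfolding U_def by (intro inj_onI) (auto simp: image_iff set_eq_iff)
      moreover have "U j {..<n} - U j S = U j ({..<n} - S)" for S by (auto simp: U_def)
      ultimately show ?thesis
        by (subst sqf_coeff_mult) (simp_all add: sum.reindex U_def[of j "{..<n}"])
    qed
    let ?\<phi> = "\<lambda>S b. sqf_coeff (U j S) (\<alpha> (j n) b) * sqf_coeff (U j ({..<n} - S)) (\<gamma> b)"
    have "T j = (\<Sum>b\<in>B. \<Sum>S\<in>Pow {..<n}. ?\<phi> S b)"
      using T[OF j] by (simp add: split flip: U_def)
    also have "\<dots> = (\<Sum>b\<in>B. \<Sum>S\<in>Pow {..<n} - {{..<n}}. ?\<phi> S b)"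
      by (rule sum.cong[OF refl], rule sum.mono_neutral_right) (auto simp: U_def \<gamma>0)
    also have "\<dots> = (\<Sum>(S, b)\<in>\<Omega>. ?\<phi> S b)"
      unfolding \<Omega>_def by (subst sum.swap) (rule sum.cartesian_product)
    also have "\<dots> = (\<Sum>l\<in>{0..<card \<Omega>}. case \<pi> l of (S, b) \<Rightarrow> ?\<phi> S b)"
      by (rule sum.reindex_bij_betw[OF \<pi>, symmetric])
    also have "\<dots> = (\<Sum>l<card \<Omega>. P l (restr_idx j (S l)) * Q l (restr_idx j ({..<Suc n} - S l)))"
    proof (intro sum.cong)
      fix l assume "l \<in> {..<card \<Omega>}"
      then have l: "fst (\<pi> l) \<subseteq> {..<n}" using \<pi>in by auto
      have "{..<Suc n} - S l = {..<n} - fst (\<pi> l)" by (auto simp: S_def)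
      \<comment> \<open>Resetting the indices outside \<open>A\<close> to 0 has no effect, as only
        the axes in \<open>A'\<close> are read.\<close>
      moreover have "U (restr_idx j A) A' = U j A'" if "A' \<subseteq> A" for A A'
        unfolding U_def using that by (intro image_cong refl) (auto simp: restr_idx_def)
      moreover have "restr_idx j (S l) n = j n" by (simp add: restr_idx_def S_def)
      moreover have "fst (\<pi> l) \<subseteq> S l" by (auto simp: S_def)
      ultimately show "(case \<pi> l of (S, b) \<Rightarrow> ?\<phi> S b) =
          P l (restr_idx j (S l)) * Q l (restr_idx j ({..<Suc n} - S l))"
        by (simp add: P_def Q_def case_prod_unfold)
    qed auto
    finally show ?thesis .
  qed
  moreover have "S l \<subseteq> {..<Suc n} \<and> S l \<noteq> {} \<and> S l \<noteq> {..<Suc n}" if "l < card \<Omega>" for l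
  proof -
    have "n \<notin> fst (\<pi> l)" using \<pi>in(1)[OF that] by auto
    moreover have "{..<Suc n} = insert n {..<n}" by auto
    ultimately show ?thesis using \<pi>in(1,2)[OF that] unfolding S_def
      by (metis insert_ident insert_mono insert_not_empty lessThan_iff order_less_irrefl)
  qed
  moreover have "P l j \<in> F \<and> Q l j \<in> F" if "l < card \<Omega>" for l j
    using rat \<pi>in(3)[OF that] by (simp add: P_def Q_def sqf_coeff_def polys_over_def)
  ultimately have "\<exists>S P Q. (\<forall>l<card \<Omega>. S l \<subseteq> {..<Suc n} \<and> S l \<noteq> {} \<and> S l \<noteq> {..<Suc n}) \<and>
      (\<forall>l<card \<Omega>. \<forall>j. P l j \<in> F \<and> Q l j \<in> F) \<and>
      (\<forall>j\<in>tidx (Suc n) d. T j = (\<Sum>l<card \<Omega>. P l (restr_idx j (S l)) * Q l (restr_idx j ({..<Suc n} - S l))))"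
    by (intro exI[of _ S] exI[of _ P] exI[of _ Q]) blast
  then show ?thesis unfolding partition_rank_def card[symmetric] by (rule Least_le)
qed

theorem theorem6p1:
  fixes F :: "'k::field set" and k :: nat and d :: "nat \<Rightarrow> nat"
    and T :: "(nat \<Rightarrow> nat) \<Rightarrow> 'k" and X :: "(nat \<times> nat \<Rightarrow> 'k) set"
    and x0 :: "nat \<times> nat \<Rightarrow> 'k"
  assumes "subfield F" and "perfect_subfield F" and "is_algebraic_closure_of F"
    and "k \<ge> 2"
    and "\<forall>j\<in>tidx k d. T j \<in> F"
    and "X \<subseteq> slicing_kernel k d T"
    and "irreducible_variety (slice_vars k d) X"
    and "defined_over F (slice_vars k d) X"
    and "x0 \<in> X" and "\<forall>v. x0 v \<in> F"
    and "nonsingular_point (slice_vars k d) X x0"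
    and "\<not> jac_singular k d T X x0"
  shows "partition_rank F k d T
           \<le> (2 ^ (k - 1) - 1) * (card (slice_vars k d) - var_dim (slice_vars k d) X)"
proof -
  define n where "n = k - 1"
  have k: "k = Suc n" using assms(4) by (simp add: n_def)
  let ?V = "slice_vars k d"
  have V: "finite ?V" by (rule finite_slice_vars)
  interpret rational_nonsingular F ?V X x0
    by (rule rational_nonsingular.intro[OF V assms(1,2,3,7,8,9) _ assms(11)]) (use assms(10) in blast)
  \<comment> \<open>Larger than the number of fields, which is at most
    \<open>card ?V\<close>.\<close>
  define N where "N = Suc (card ?V)"
  obtain B e z where B: "B \<subseteq> ?V" "card B = card ?V - var_dim ?V X" and e: "mpoly_eval e x0 = 0"
    and zR: "\<And>t v. t \<in> ?V - B \<Longrightarrow> v \<in> ?V \<Longrightarrow> z t v \<in> polys_over F ?V"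
    and zd: "\<And>t u. t \<in> ?V - B \<Longrightarrow> u \<in> ?V - B \<Longrightarrow> z t u = (if u = t then 1 - e ^ N else 0)"
    and zI: "\<And>t f. t \<in> ?V - B \<Longrightarrow> f \<in> ideal_of X \<inter> polys_in ?V \<Longrightarrow> vfield ?V (z t) f \<in> ideal_of X"
    by (rule exists_rational_fields[where N = N], rule that)
  have fB: "finite B" using V B(1) by (rule rev_finite_subset)
  have fVB: "finite (?V - B)" using V by simp
  obtain ts where tsB: "set ts = ?V - B" and tsd: "distinct ts" using finite_distinct_list[OF fVB] by blast
  have len: "length ts < N"
    using distinct_card[OF tsd] card_mono[of ?V "?V - B"] V unfolding tsB N_def by simp
  interpret flow "\<lambda>t. vfield ?V (z t)" ts x0
  proof
    show "derivation (vfield ?V (z t))" for t by (rule derivation_vfield)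
    show "vfield ?V (z t) (mconst c * f) = mconst c * vfield ?V (z t) f" for t c f
      by (simp add: vfield_def mderiv_mult sum_distrib_left mult.left_commute)
  qed (rule tsd)
  have zts: "z t v \<in> polys_over F ?V" if "t \<in> set ts" "v \<in> ?V" for t v
    using zR[of t v] that unfolding tsB by blast
  have vin: "vfield ?V (z t) f \<in> polys_over F ?V" if "t \<in> set ts" "f \<in> polys_over F ?V" for t f
    by (rule polys_over_vfield[OF assms(1) zts[OF that(1)] that(2)])
  have vin': "vfield ?V (z t) f \<in> polys_in ?V" if "t \<in> set ts" "f \<in> polys_in ?V" for t f
    unfolding vfield_def
    by (intro polys_in_sum polys_in_mult polys_in_mderiv that(2) polys_over_in[OF zts[OF that(1)]])
  have coord: "vfield ?V (z t) (mvar u) = (if u = t then 1 - e ^ N else 0)"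
    if "t \<in> set ts" "u \<in> set ts" for t u
  proof -
    have "vfield ?V (z t) (mvar u) = (\<Sum>v\<in>?V. if v = u then z t v else 0)"
      unfolding vfield_def by (intro sum.cong) auto
    also have "\<dots> = z t u" using V that unfolding tsB by simp
    finally show ?thesis using zd[of t u] that unfolding tsB by simp
  qed
  define P where "P v = mconst (x0 v) + mvar v" for v
  \<comment> \<open>For a parameter coordinate, \<open>flow (mvar v)\<close> is only congruent to
    \<open>P v\<close>. Using \<open>P v\<close> itself makes \<open>P v - Q v\<close> exactly zero
    outside \<open>B\<close>.\<close>
  define Q where "Q v = (if v \<in> B then flow (mvar v) else P v)" for v
  have PQ: "sqf_cong (flow (mvar v)) (Q v)" if "v \<in> ?V" for v
    using flow_mvar[OF e coord _ len, of v] that sqf_cong_refl by (auto simp: Q_def P_def tsB)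
  have rat: "P v \<in> polys_over F UNIV" "v \<in> ?V \<Longrightarrow> Q v \<in> polys_over F UNIV" for v
  proof -
    show P: "P v \<in> polys_over F UNIV"
      unfolding P_def
      by (intro polys_over_add[OF assms(1)] polys_over_mconst[OF assms(1)] polys_over_mvar[OF assms(1)] x0(2) UNIV_I)
    show "Q v \<in> polys_over F UNIV" if "v \<in> ?V"
    proof (cases "v \<in> B")
      case True
      have "flow (mvar v) \<in> polys_over F UNIV"
        by (rule flow_rational[OF assms(1) polys_over_mvar[OF assms(1) that] vin polys_over_eval[OF assms(1) _ x0(2)]])
      then show ?thesis using True by (simp add: Q_def)
    qed (use P in \<open>simp add: Q_def\<close>)
  qed
  define J where "J c = {j \<in> tidx k d. j n = c}" for c
  define \<gamma> where "\<gamma> b = P b - Q b" for b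
  define \<theta> where "\<theta> j i = (\<Prod>l<i. P (l, j l)) * (\<Prod>l\<in>{i<..<n}. Q (l, j l))" for j :: "nat \<Rightarrow> nat" and i
  \<comment> \<open>Collects the telescoping terms in which the coordinate \<open>b\<close> is
    exchanged, over all axes \<open>i\<close> and all entries \<open>j\<close> of the slice
    \<open>c\<close>.\<close>
  define \<alpha> where "\<alpha> c b = (\<Sum>j\<in>J c. mconst (T j) * (\<Sum>i<n. if (i, j i) = b then \<theta> j i else 0))" for c b
  have inV: "(i, j i) \<in> ?V" if "j \<in> tidx k d" "i < n" for i j
    using that by (simp add: slice_vars_def tidx_def k)
  have diff: "(\<Sum>j\<in>J c. mconst (T j) * (\<Prod>i<n. P (i, j i))) - (\<Sum>j\<in>J c. mconst (T j) * (\<Prod>i<n. Q (i, j i))) =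
      (\<Sum>b\<in>B. \<alpha> c b * \<gamma> b)" for c
  proof -
    have one: "(\<Prod>i<n. P (i, j i)) - (\<Prod>i<n. Q (i, j i)) =
        (\<Sum>b\<in>B. (\<Sum>i<n. if (i, j i) = b then \<theta> j i else 0) * \<gamma> b)" for j
    proof -
      have "\<theta> j i * \<gamma> (i, j i) = (\<Sum>b\<in>B. (if (i, j i) = b then \<theta> j i else 0) * \<gamma> b)" for i
      proof -
        have "(\<Sum>b\<in>B. (if (i, j i) = b then \<theta> j i else 0) * \<gamma> b) = (\<Sum>b\<in>B. if (i, j i) = b then \<theta> j i * \<gamma> b else 0)"
          by (intro sum.cong) auto
        \<comment> \<open>This covers indices outside \<open>B\<close> too: no summand matches, and
          \<open>\<gamma>\<close> is zero there.\<close>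
        also have "\<dots> = \<theta> j i * \<gamma> (i, j i)" using fB by (simp add: \<gamma>_def Q_def)
        finally show ?thesis by simp
      qed
      then have "(\<Sum>i<n. \<theta> j i * \<gamma> (i, j i)) = (\<Sum>b\<in>B. \<Sum>i<n. (if (i, j i) = b then \<theta> j i else 0) * \<gamma> b)"
        by (simp only:) (rule sum.swap)
      then show ?thesis
        unfolding prod_diff_telescope by (simp only: \<gamma>_def \<theta>_def sum_distrib_right)
    qed
    have "(\<Sum>j\<in>J c. mconst (T j) * (\<Prod>i<n. P (i, j i))) - (\<Sum>j\<in>J c. mconst (T j) * (\<Prod>i<n. Q (i, j i))) =
       (\<Sum>j\<in>J c. mconst (T j) * (\<Sum>b\<in>B. (\<Sum>i<n. if (i, j i) = b then \<theta> j i else 0) * \<gamma> b))"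
      by (simp only: one flip: sum_subtractf right_diff_distrib)
    also have "\<dots> = (\<Sum>b\<in>B. \<alpha> c b * \<gamma> b)"
      unfolding \<alpha>_def sum_distrib_right sum_distrib_left mult.assoc by (rule sum.swap)
    finally show ?thesis .
  qed
  have QT: "sqf_coeff U (\<Sum>j\<in>J c. mconst (T j) * (\<Prod>i<n. Q (i, j i))) = 0"
    if c: "c < d n" and U: "finite U" for c U
  proof -
    have "slicing_poly k d T c \<in> ideal_of X"
      using assms(6) c by (auto simp: ideal_of_def slicing_kernel_def zero_set_def n_def)
    moreover have sp: "slicing_poly k d T c = (\<Sum>j\<in>J c. mconst (T j) * (\<Prod>i<n. mvar (i, j i)))"
      by (simp add: slicing_poly_eq J_def n_def)
    moreover have "slicing_poly k d T c \<in> polys_in ?V"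
      unfolding sp using inV
      by (intro polys_in_sum polys_in_mult polys_in_prod polys_in_mvar polys_in_mconst) (auto simp: J_def)
    \<comment> \<open>The slice vanishes on \<open>X\<close>, and all iterated derivatives stay in
      the ideal, whose elements vanish at \<open>x0\<close>.\<close>
    ultimately have "flow (slicing_poly k d T c) = 0"
      by (intro flow_eq_0[of _ "ideal_of X \<inter> polys_in ?V"])
        (use zI vin' vanish_x0 in \<open>auto simp: tsB\<close>)
    then have "0 = (\<Sum>j\<in>J c. T j * sqf_coeff U (flow (\<Prod>i<n. mvar (i, j i))))"
      unfolding sp flow_sum by (simp add: sqf_coeff_def[of U 0] flip: sqf_coeff_mconst_mult sqf_coeff_sum)
    also have "\<dots> = (\<Sum>j\<in>J c. T j * sqf_coeff U (\<Prod>i<n. Q (i, j i)))"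
    proof (intro sum.cong refl arg_cong2[of _ _ _ _ "(*)"])
      fix j assume j: "j \<in> J c"
      have "sqf_cong (\<Prod>i\<in>A. flow (mvar (i, j i))) (\<Prod>i\<in>A. Q (i, j i))" if "A \<subseteq> {..<n}" for A
        using finite_subset[OF that finite_lessThan] that
      proof (induction A rule: finite_induct)
        case (insert a A)
        have "sqf_cong (flow (mvar (a, j a))) (Q (a, j a))"
          using insert.prems j by (intro PQ inV) (auto simp: J_def)
        then show ?case using insert by (simp add: sqf_cong_mult)
      qed (simp add: sqf_cong_refl)
      from sqf_cong_trans[OF flow_prod this[OF subset_refl]]
      show "sqf_coeff U (flow (\<Prod>i<n. mvar (i, j i))) = sqf_coeff U (\<Prod>i<n. Q (i, j i))"
        using U by (simp only: sqf_cong_def)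
    qed
    finally show ?thesis by (simp add: sqf_coeff_sum sqf_coeff_mconst_mult)
  qed
  have T: "T j = (\<Sum>b\<in>B. sqf_coeff ((\<lambda>i. (i, j i)) ` {..<n}) (\<alpha> (j n) b * \<gamma> b))" if j: "j \<in> tidx k d" for j
  proof -
    let ?U = "\<lambda>j. (\<lambda>i. (i, j i)) ` {..<n}"
    \<comment> \<open>The variable from axis \<open>i\<close> is tagged by \<open>i\<close>, so the
      monomial determines the first \<open>n\<close> indices, while membership in
      \<open>J (j n)\<close> fixes the last one.\<close>
    have "sqf_coeff (?U j) (\<Prod>i<n. P (i, j' i)) = (if j' = j then 1 else 0)" if j': "j' \<in> J (j n)" for j'
    proof -
      have "card (?U j) = n" by (subst card_image) (auto intro: inj_onI)
      then have "sqf_coeff (?U j) (\<Prod>i<n. P (i, j' i)) = (if ?U j = ?U j' then 1 else 0)"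
        unfolding P_def by (intro sqf_coeff_linear_factors) (auto intro: inj_onI)
      moreover have "?U j = ?U j' \<longleftrightarrow> j' = j"
      proof
        assume eq: "?U j = ?U j'"
        show "j' = j"
        proof
          fix i
          consider "i < n" | "i = n" | "i > n" by linarith
          then show "j' i = j i"
          proof cases
            case 1
            then have "(i, j i) \<in> ?U j'" using eq by blast
            then show ?thesis by auto
          qed (use j j' in \<open>auto simp: J_def tidx_def k\<close>)
        qed
      qed simp
      ultimately show ?thesis by simp
    qed
    then have "sqf_coeff (?U j) (\<Sum>j'\<in>J (j n). mconst (T j') * (\<Prod>i<n. P (i, j' i))) =
        (\<Sum>j'\<in>J (j n). if j' = j then T j' else 0)"
      unfolding sqf_coeff_sum sqf_coeff_mconst_mult by (intro sum.cong) auto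
    also have "\<dots> = T j" using j finite_tidx[of k d] by (simp add: J_def)
    finally have PT: "sqf_coeff (?U j) (\<Sum>j'\<in>J (j n). mconst (T j') * (\<Prod>i<n. P (i, j' i))) = T j" .
    have "j n < d n" using j by (simp add: tidx_def k)
    then have "sqf_coeff (?U j) (\<Sum>j'\<in>J (j n). mconst (T j') * (\<Prod>i<n. Q (i, j' i))) = 0"
      by (intro QT) auto
    with PT have "T j = sqf_coeff (?U j) (\<Sum>b\<in>B. \<alpha> (j n) b * \<gamma> b)"
      unfolding diff[symmetric] sqf_coeff_diff by simp
    then show ?thesis by (simp add: sqf_coeff_sum)
  qed
  have "partition_rank F (Suc n) d T \<le> (2 ^ n - 1) * card B"
  proof (rule partition_rank_le_splitting[OF fB])
    show "\<gamma> b \<in> polys_over F UNIV" if "b \<in> B" for b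
      unfolding \<gamma>_def by (rule polys_over_diff[OF assms(1) rat(1) rat(2)[OF subsetD[OF B(1) that]]])
    show "\<alpha> c b \<in> polys_over F UNIV" for c b
    proof -
      have "\<theta> j i \<in> polys_over F UNIV" if "j \<in> J c" "i < n" for j i
        unfolding \<theta>_def using rat inV that assms(1)
        by (intro polys_over_mult polys_over_prod) (auto simp: J_def)
      then show ?thesis
        unfolding \<alpha>_def using assms(1,5)
        by (intro polys_over_sum polys_over_mult polys_over_mconst) (auto simp: J_def intro: polys_over_0)
    qed
    \<comment> \<open>For constant terms no derivation is selected, so \<open>P b\<close> and
      \<open>Q b\<close> both have constant term \<open>x0 b\<close>.\<close>
    show "sqf_coeff {} (\<gamma> b) = 0" if b: "b \<in> B" for b
    proof -
      have "iter_deriv (\<lambda>t. vfield ?V (z t)) us {} (mvar b) = mvar b" for us by (induction us) auto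
      then show ?thesis
        using b by (simp add: \<gamma>_def Q_def P_def sqf_coeff_diff sqf_coeff_add sqf_coeff_flow sqf_coeff_mconst sqf_coeff_mvar)
    qed
    show "T j = (\<Sum>b\<in>B. sqf_coeff ((\<lambda>i. (i, j i)) ` {..<n}) (\<alpha> (j n) b * \<gamma> b))" if "j \<in> tidx (Suc n) d" for j
      using T that unfolding k by blast
  qed
  then show ?thesis using B(2) by (simp add: k)
qed

end
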